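(* Let $\pi:M\to\mathbb{R}$ be a smooth fibred manifold with $\dim M=n+1$, and let $\theta$ be a $k$-form on $J^1\pi$, $k\ge 1$. (i) If $\theta$ is $d_J$-exact (modulo $dt$), i.e. there is a $(k-1)$-form $\omega$ on $J^1\pi$ with $\theta\wedge dt=d_J\omega\wedge dt$, then $\theta$ is $d_J$-closed (modulo $dt$), i.e. $d_J\theta\wedge dt=0$. (ii) If $\theta$ is semi-basic and $d_J$-closed (modulo $dt$), i.e. $d_J\theta\wedge dt=0$, then $\theta$ is locally $d_J$-exact (modulo $dt$): every point of $J^1\pi$ has an open neighbourhood $U$ and a $(k-1)$-form $\omega$ on $U$ with $\theta\wedge dt=d_J\omega\wedge dt$ on $U$.
   Context: Everything is $C^\infty$. $\pi:M\to\mathbb{R}$ is a fibred manifold (surjective submersion) with $\dim M=n+1$, $J^1\pi$ is the first jet bundle of local sections of $\pi$, and $\pi_{10}:J^1\pi\to M$. Fibred coordinates $(t,x^i)$ on $M$ ($t$ the global coordinate of $\mathbb{R}$) induce coordinates $(t,x^i,y^i)$ on $J^1\pi$. Put $\delta x^i=dx^i-y^i\,dt$. Vertical vectors are those in $\operatorname{Ker}D\pi_{10}$, spanned by $\partial/\partial y^i$. The vertical endomorphism is $J=\frac{\partial}{\partial y^i}\otimes\delta x^i$. A $k$-form $\theta$ ($k\ge1$) is semi-basic if $\theta(X_1,\dots,X_k)=0$ whenever one of the $X_j$ is vertical. For a $k$-form $\omega$: $i_J\omega(X_1,\dots,X_k)=\sum_{j}\omega(X_1,\dots,JX_j,\dots,X_k)$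 (and $i_J\omega=0$ if $k=0$), and $d_J\omega=i_Jd\omega-d\,i_J\omega$. *)

theory Defs
  imports "HOL-Analysis.Analysis"
begin

section \<open>Model spaces and smooth maps between them\<close>

text \<open>
  Finite-dimensional inner product spaces. Unlike the class \<open>euclidean_space\<close>, dimension 0 is
  admitted; the fibre dimension of a fibred manifold over the line may be any natural number.
\<close>

class fin_dim_inner = real_inner +
  assumes finite_generating_set: "\<exists>B. finite B \<and> (\<forall>x. \<exists>r. x = (\<Sum>b\<in>B. r b *\<^sub>R b))"

lemma finite_spanning_set: "\<exists>B :: 'a::fin_dim_inner set. finite B \<and> span B = UNIV"
proof -
  obtain B :: "'a set" where B: "finite B" "\<And>x. \<exists>r. x = (\<Sum>b\<in>B. r b *\<^sub>R b)"
    using finite_generating_set by blast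
  have "x \<in> span B" for x
  proof -
    obtain r where r: "x = (\<Sum>b\<in>B. r b *\<^sub>R b)"
      using B(2) by blast
    show ?thesis
      unfolding r by (intro span_sum span_scale span_base)
  qed
  then show ?thesis
    using B(1) by blast
qed

instance euclidean_space \<subseteq> fin_dim_inner
proof
  show "\<exists>B :: 'a set. finite B \<and> (\<forall>x. \<exists>r. x = (\<Sum>b\<in>B. r b *\<^sub>R b))"
    using euclidean_representation[symmetric] finite_Basis by blast
qed

instance prod :: (fin_dim_inner, fin_dim_inner) fin_dim_inner
proof
  obtain B :: "'a set" and C :: "'b set"
    where B: "finite B" "span B = UNIV" and C: "finite C" "span C = UNIV"
    using finite_spanning_set by metis
  define S :: "('a \<times> 'b) set" where "S = (\<lambda>b. (b, 0)) ` B \<union> (\<lambda>c. (0, c)) ` C"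
  have S: "finite S"
    using B(1) C(1) by (simp add: S_def)
  have "(x, y) \<in> span S" for x y
  proof -
    have "(\<lambda>b. (b, 0 :: 'b)) ` span B \<subseteq> span S"
      unfolding S_def
      by (subst linear_span_image[symmetric])
         (auto intro!: linearI span_mono)
    moreover have "(\<lambda>c. (0 :: 'a, c)) ` span C \<subseteq> span S"
      unfolding S_def
      by (subst linear_span_image[symmetric])
         (auto intro!: linearI span_mono)
    ultimately have "(x, 0) \<in> span S" "(0, y) \<in> span S"
      using B(2) C(2) by auto
    then have "(x, 0) + (0, y) \<in> span S"
      by (rule span_add)
    then show ?thesis
      by simp
  qed
  then have "\<exists>r. z = (\<Sum>b\<in>S. r b *\<^sub>R b)" for z
    using span_finite[OF S] by (cases z) auto
  then show "\<exists>S :: ('a \<times> 'b) set. finite S \<and> (\<forall>z. \<exists>r. z = (\<Sum>b\<in>S. r b *\<^sub>R b))"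
    using S by blast
qed

text \<open>Intended for open subsets of finite-dimensional spaces.\<close>

primrec Ck_on :: "nat \<Rightarrow> ('a::real_normed_vector \<Rightarrow> 'b::real_normed_vector) \<Rightarrow> 'a set \<Rightarrow> bool" where
  "Ck_on 0 f S \<longleftrightarrow> continuous_on S f"
| "Ck_on (Suc k) f S \<longleftrightarrow>
     (\<forall>x\<in>S. f differentiable (at x)) \<and> (\<forall>v. Ck_on k (\<lambda>x. frechet_derivative f (at x) v) S)"

definition smooth_on :: "('a::real_normed_vector \<Rightarrow> 'b::real_normed_vector) \<Rightarrow> 'a set \<Rightarrow> bool" where
  "smooth_on f S \<longleftrightarrow> (\<forall>k. Ck_on k f S)"


section \<open>Smooth manifolds\<close>

text \<open>
  A chart is a pair of its domain and its coordinate map (the values of the coordinate map outside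
  the domain are irrelevant). A manifold is given by an atlas; its point set is the union of the
  chart domains and its topology is the one making the charts homeomorphisms onto open sets.
\<close>

type_synonym ('p, 'e) chart = "'p set \<times> ('p \<Rightarrow> 'e)"

abbreviation chart_inv :: "('p, 'e) chart \<Rightarrow> 'e \<Rightarrow> 'p" where
  "chart_inv c \<equiv> inv_into (fst c) (snd c)"

definition compatible ::
  "('p, 'e::real_normed_vector) chart \<Rightarrow> ('p, 'e) chart \<Rightarrow> bool" where
  "compatible c d \<longleftrightarrow>
     open (snd c ` (fst c \<inter> fst d)) \<and> smooth_on (snd d \<circ> chart_inv c) (snd c ` (fst c \<inter> fst d)) \<and>
     open (snd d ` (fst c \<inter> fst d)) \<and> smooth_on (snd c \<circ> chart_inv d) (snd d ` (fst c \<inter> fst d))"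

definition smooth_atlas :: "('p, 'e::real_normed_vector) chart set \<Rightarrow> bool" where
  "smooth_atlas A \<longleftrightarrow> (\<forall>c\<in>A. inj_on (snd c) (fst c)) \<and> (\<forall>c\<in>A. \<forall>d\<in>A. compatible c d)"

definition points :: "('p, 'e) chart set \<Rightarrow> 'p set" where
  "points A = (\<Union>c\<in>A. fst c)"

definition atlas_open :: "('p, 'e::real_normed_vector) chart set \<Rightarrow> 'p set \<Rightarrow> bool" where
  "atlas_open A W \<longleftrightarrow> W \<subseteq> points A \<and> (\<forall>c\<in>A. open (snd c ` (W \<inter> fst c)))"

definition atlas_topology :: "('p, 'e::real_normed_vector) chart set \<Rightarrow> 'p topology" where
  "atlas_topology A = topology (atlas_open A)"

lemma istopology_atlas_open:
  assumes "smooth_atlas A"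
  shows "istopology (atlas_open A)"
  unfolding istopology_def
proof (intro conjI allI impI)
  fix S T assume S: "atlas_open A S" and T: "atlas_open A T"
  have "open (snd c ` (S \<inter> T \<inter> fst c))" if c: "c \<in> A" for c
  proof -
    have "inj_on (snd c) (fst c)"
      using assms c by (simp add: smooth_atlas_def)
    then have "snd c ` (S \<inter> T \<inter> fst c) = snd c ` (S \<inter> fst c) \<inter> snd c ` (T \<inter> fst c)"
      by (auto simp: inj_on_def)
    then show ?thesis
      using S T c by (auto simp: atlas_open_def)
  qed
  then show "atlas_open A (S \<inter> T)"
    using S by (auto simp: atlas_open_def)
next
  fix K assume K: "\<forall>W\<in>K. atlas_open A W"
  have "open (snd c ` (\<Union>K \<inter> fst c))" if c: "c \<in> A" for c
  proof -
    have "snd c ` (\<Union>K \<inter> fst c) = (\<Union>W\<in>K. snd c ` (W \<inter> fst c))"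
      by auto
    then show ?thesis
      using K c by (auto simp: atlas_open_def)
  qed
  then show "atlas_open A (\<Union>K)"
    using K by (auto simp: atlas_open_def)
qed

lemma openin_atlas_topology:
  "smooth_atlas A \<Longrightarrow> openin (atlas_topology A) W \<longleftrightarrow> atlas_open A W"
  by (simp add: atlas_topology_def topology_inverse' istopology_atlas_open)

definition smooth_manifold :: "('p, 'e::real_normed_vector) chart set \<Rightarrow> bool" where
  "smooth_manifold A \<longleftrightarrow>
     smooth_atlas A \<and> Hausdorff_space (atlas_topology A) \<and> second_countable (atlas_topology A)"

definition maximal_atlas ::
  "('p, 'e::real_normed_vector) chart set \<Rightarrow> ('p, 'e) chart set" where
  "maximal_atlas A =
     {c. fst c \<subseteq> points A \<and> inj_on (snd c) (fst c) \<and> compatible c c \<and> (\<forall>d\<in>A. compatible c d)}"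


section \<open>Tangent vectors\<close>

text \<open>
  A tangent vector at \<open>p\<close> is the family of its components in the charts of the atlas around \<open>p\<close>,
  which transform by the derivatives of the transition maps. The family is 0 at all other charts,
  so that it is determined by the vector; the linear structure is pointwise.
\<close>

type_synonym ('p, 'e) tvec = "('p, 'e) chart \<Rightarrow> 'e"

definition charts_at :: "('p, 'e) chart set \<Rightarrow> 'p \<Rightarrow> ('p, 'e) chart set" where
  "charts_at A p = {c \<in> A. p \<in> fst c}"

definition tangent_space ::
  "('p, 'e::real_normed_vector) chart set \<Rightarrow> 'p \<Rightarrow> ('p, 'e) tvec set" where
  "tangent_space A p =
     {v. (\<forall>c. c \<notin> charts_at A p \<longrightarrow> v c = 0) \<and>
         (\<forall>c\<in>charts_at A p. \<forall>d\<in>charts_at A p.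
            v d = frechet_derivative (snd d \<circ> chart_inv c) (at (snd c p)) (v c))}"

text \<open>The tangent vector at \<open>p\<close> with components \<open>u\<close> in the chart \<open>c\<close>.\<close>

definition tangent_vector ::
  "('p, 'e::real_normed_vector) chart set \<Rightarrow> ('p, 'e) chart \<Rightarrow> 'p \<Rightarrow> 'e \<Rightarrow> ('p, 'e) tvec" where
  "tangent_vector A c p u =
     (\<lambda>d. if d \<in> charts_at A p
          then frechet_derivative (snd d \<circ> chart_inv c) (at (snd c p)) u else 0)"

definition some_chart :: "('p, 'e) chart set \<Rightarrow> 'p \<Rightarrow> ('p, 'e) chart" where
  "some_chart A p = (SOME c. c \<in> charts_at A p)"

text \<open>
  The derivative at \<open>p\<close> of a smooth map \<open>f\<close> between the manifolds with atlases \<open>A\<close> and \<open>B\<close>. By the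
  chain rule it does not depend on the chart chosen at \<open>p\<close>.
\<close>

definition tangent_map ::
  "('p, 'e::real_normed_vector) chart set \<Rightarrow> ('q, 'f::real_normed_vector) chart set \<Rightarrow>
   ('p \<Rightarrow> 'q) \<Rightarrow> 'p \<Rightarrow> ('p, 'e) tvec \<Rightarrow> ('q, 'f) tvec" where
  "tangent_map A B f p v =
     (let c = some_chart A p in
      (\<lambda>d. if d \<in> charts_at B (f p)
           then frechet_derivative (snd d \<circ> f \<circ> chart_inv c) (at (snd c p)) (v c) else 0))"


section \<open>Differential forms\<close>

text \<open>
  A \<open>k\<close>-form assigns to a point \<open>p\<close> a function of \<open>k\<close> tangent vectors at \<open>p\<close>, passed as a list.
  Its values at other arguments are irrelevant, whence \<open>form_eq\<close>.
\<close>

type_synonym ('p, 'e) form = "'p \<Rightarrow> ('p, 'e) tvec list \<Rightarrow> real"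

definition tangent_tuples ::
  "('p, 'e::real_normed_vector) chart set \<Rightarrow> nat \<Rightarrow> 'p \<Rightarrow> ('p, 'e) tvec list set" where
  "tangent_tuples A k p = {vs. length vs = k \<and> set vs \<subseteq> tangent_space A p}"

definition k_form ::
  "('p, 'e::real_normed_vector) chart set \<Rightarrow> nat \<Rightarrow> 'p set \<Rightarrow> ('p, 'e) form \<Rightarrow> bool" where
  "k_form A k U \<omega> \<longleftrightarrow>
     (\<forall>p\<in>U. \<forall>vs\<in>tangent_tuples A k p. \<forall>i<k. \<forall>v\<in>tangent_space A p. \<forall>w\<in>tangent_space A p. \<forall>a b.
        \<omega> p (vs[i := (\<lambda>c. a *\<^sub>R v c + b *\<^sub>R w c)]) = a * \<omega> p (vs[i := v]) + b * \<omega> p (vs[i := w])) \<and>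
     (\<forall>p\<in>U. \<forall>vs\<in>tangent_tuples A k p. \<forall>i j. i < j \<and> j < k \<and> vs ! i = vs ! j \<longrightarrow> \<omega> p vs = 0) \<and>
     (\<forall>c\<in>A. \<forall>us. length us = k \<longrightarrow>
        smooth_on (\<lambda>z. \<omega> (chart_inv c z) (map (tangent_vector A c (chart_inv c z)) us))
          (snd c ` (U \<inter> fst c)))"

definition form_eq ::
  "('p, 'e::real_normed_vector) chart set \<Rightarrow> nat \<Rightarrow> 'p set \<Rightarrow> ('p, 'e) form \<Rightarrow> ('p, 'e) form \<Rightarrow> bool"
  where
  "form_eq A k U \<omega> \<eta> \<longleftrightarrow> (\<forall>p\<in>U. \<forall>vs\<in>tangent_tuples A k p. \<omega> p vs = \<eta> p vs)"

definition omit :: "nat \<Rightarrow> 'a list \<Rightarrow> 'a list" where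
  "omit i xs = take i xs @ drop (Suc i) xs"

text \<open>
  The invariant formula for \<open>d\<omega>\<close>, evaluated at the vector fields with constant components in a
  chart (whose brackets vanish):
  \<open>d\<omega>(V\<^sub>0,\<dots>,V\<^sub>k) = \<Sum>\<^sub>i (-1)\<^sup>i V\<^sub>i(\<omega>(V\<^sub>0,\<dots>,\<close> without \<open>V\<^sub>i,\<dots>,V\<^sub>k))\<close>.
\<close>

definition ext_deriv ::
  "('p, 'e::real_normed_vector) chart set \<Rightarrow> ('p, 'e) form \<Rightarrow> ('p, 'e) form" where
  "ext_deriv A \<omega> p vs =
     (let c = some_chart A p in
      \<Sum>i<length vs. (- 1) ^ i *
        frechet_derivative
          (\<lambda>z. \<omega> (chart_inv c z)
                  (map (\<lambda>v. tangent_vector A c (chart_inv c z) (v c)) (omit i vs)))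
          (at (snd c p)) ((vs ! i) c))"

definition wedge_1form :: "('p, 'e) form \<Rightarrow> ('p, 'e) form \<Rightarrow> ('p, 'e) form" where
  "wedge_1form \<theta> \<alpha> p vs =
     (\<Sum>i<length vs. (- 1) ^ (length vs - 1 - i) * \<theta> p (omit i vs) * \<alpha> p [vs ! i])"


section \<open>Manifolds fibred over the line and their first jet bundle\<close>

definition fibred_manifold ::
  "('p, 'e::real_normed_vector) chart set \<Rightarrow> ('p \<Rightarrow> real) \<Rightarrow> bool" where
  "fibred_manifold A \<pi> \<longleftrightarrow>
     smooth_manifold A \<and>
     (\<forall>c\<in>A. smooth_on (\<pi> \<circ> chart_inv c) (snd c ` fst c)) \<and>
     (\<forall>c\<in>A. \<forall>p\<in>fst c. surj (frechet_derivative (\<pi> \<circ> chart_inv c) (at (snd c p)))) \<and>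
     \<pi> ` points A = UNIV"

text \<open>Fibred coordinates \<open>(t, x)\<close>: the first one is the global coordinate of the line.\<close>

definition fibred_charts ::
  "('p, real \<times> 'v::real_normed_vector) chart set \<Rightarrow> ('p \<Rightarrow> real) \<Rightarrow> ('p, real \<times> 'v) chart set" where
  "fibred_charts A \<pi> = {c \<in> maximal_atlas A. \<forall>p\<in>fst c. fst (snd c p) = \<pi> p}"

definition local_section ::
  "('p, 'e::real_normed_vector) chart set \<Rightarrow> ('p \<Rightarrow> real) \<Rightarrow> real \<Rightarrow> (real \<Rightarrow> 'p) \<Rightarrow> bool" where
  "local_section A \<pi> t \<gamma> \<longleftrightarrow>
     (\<exists>I. open I \<and> t \<in> I \<and> \<gamma> ` I \<subseteq> points A \<and> (\<forall>s\<in>I. \<pi> (\<gamma> s) = s) \<and>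
        (\<forall>c\<in>A. open {s \<in> I. \<gamma> s \<in> fst c} \<and> smooth_on (snd c \<circ> \<gamma>) {s \<in> I. \<gamma> s \<in> fst c}))"

text \<open>
  The 1-jet at \<open>t\<close> of a local section \<open>\<gamma>\<close> is its class under having the same value and the same
  first derivative at \<open>t\<close>. It is stored together with its target \<open>\<gamma> t\<close>, so that the projection
  \<open>\<pi>\<^sub>1\<^sub>0\<close> to the manifold is \<open>fst\<close>.
\<close>

type_synonym 'p jet = "'p \<times> (real \<Rightarrow> 'p) set"

definition jet1 ::
  "('p, 'e::real_normed_vector) chart set \<Rightarrow> ('p \<Rightarrow> real) \<Rightarrow> real \<Rightarrow> (real \<Rightarrow> 'p) \<Rightarrow> 'p jet" where
  "jet1 A \<pi> t \<gamma> =
     (\<gamma> t, {\<eta>. local_section A \<pi> t \<eta> \<and> \<eta> t = \<gamma> t \<and>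
              (\<forall>c\<in>charts_at A (\<gamma> t).
                 vector_derivative (snd c \<circ> \<eta>) (at t) = vector_derivative (snd c \<circ> \<gamma>) (at t))})"

definition jet_space ::
  "('p, 'e::real_normed_vector) chart set \<Rightarrow> ('p \<Rightarrow> real) \<Rightarrow> 'p jet set" where
  "jet_space A \<pi> = {jet1 A \<pi> t \<gamma> | t \<gamma>. local_section A \<pi> t \<gamma>}"

text \<open>The coordinates \<open>(t, x, y)\<close> induced by fibred coordinates \<open>(t, x)\<close>; here \<open>y = dx/dt\<close>.\<close>

definition jet_chart ::
  "('p, real \<times> 'v::real_normed_vector) chart set \<Rightarrow> ('p \<Rightarrow> real) \<Rightarrow> ('p, real \<times> 'v) chart \<Rightarrow>
   ('p jet, real \<times> 'v \<times> 'v) chart" where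
  "jet_chart A \<pi> c =
     ({j \<in> jet_space A \<pi>. fst j \<in> fst c},
      \<lambda>j. let t = \<pi> (fst j); x = snd (snd c (fst j)); \<gamma> = (SOME \<gamma>. \<gamma> \<in> snd j)
          in (t, x, snd (vector_derivative (snd c \<circ> \<gamma>) (at t))))"

definition jet_atlas ::
  "('p, real \<times> 'v::real_normed_vector) chart set \<Rightarrow> ('p \<Rightarrow> real) \<Rightarrow>
   ('p jet, real \<times> 'v \<times> 'v) chart set" where
  "jet_atlas A \<pi> = jet_chart A \<pi> ` fibred_charts A \<pi>"

definition dt_form ::
  "('p, real \<times> 'v::real_normed_vector) chart set \<Rightarrow> ('p \<Rightarrow> real) \<Rightarrow>
   ('p jet, real \<times> 'v \<times> 'v) form" where
  "dt_form A \<pi> = ext_deriv (jet_atlas A \<pi>) (\<lambda>j vs. \<pi> (fst j))"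

text \<open>The kernel of the derivative of \<open>\<pi>\<^sub>1\<^sub>0\<close>.\<close>

definition vertical ::
  "('p, real \<times> 'v::real_normed_vector) chart set \<Rightarrow> ('p \<Rightarrow> real) \<Rightarrow> 'p jet \<Rightarrow>
   ('p jet, real \<times> 'v \<times> 'v) tvec set" where
  "vertical A \<pi> j =
     {v \<in> tangent_space (jet_atlas A \<pi>) j. tangent_map (jet_atlas A \<pi>) A fst j v = (\<lambda>_. 0)}"

definition semi_basic ::
  "('p, real \<times> 'v::real_normed_vector) chart set \<Rightarrow> ('p \<Rightarrow> real) \<Rightarrow> nat \<Rightarrow>
   ('p jet, real \<times> 'v \<times> 'v) form \<Rightarrow> bool" where
  "semi_basic A \<pi> k \<theta> \<longleftrightarrow>
     (\<forall>j\<in>jet_space A \<pi>. \<forall>vs\<in>tangent_tuples (jet_atlas A \<pi>) k j.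
        (\<exists>i<k. vs ! i \<in> vertical A \<pi> j) \<longrightarrow> \<theta> j vs = 0)"

text \<open>
  The vertical endomorphism \<open>J = \<partial>/\<partial>y\<^sup>i \<otimes> \<delta>x\<^sup>i\<close> with \<open>\<delta>x\<^sup>i = dx\<^sup>i - y\<^sup>i dt\<close>: in every induced chart it
  sends the vector with components \<open>(\<tau>, \<xi>, \<eta>)\<close> at \<open>(t, x, y)\<close> to \<open>(0, 0, \<xi> - \<tau> y)\<close>.
\<close>

definition vert_endo ::
  "('p, real \<times> 'v::real_normed_vector) chart set \<Rightarrow> ('p \<Rightarrow> real) \<Rightarrow> 'p jet \<Rightarrow>
   ('p jet, real \<times> 'v \<times> 'v) tvec \<Rightarrow> ('p jet, real \<times> 'v \<times> 'v) tvec" where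
  "vert_endo A \<pi> j v =
     (\<lambda>c. if c \<in> charts_at (jet_atlas A \<pi>) j
          then (case snd c j of (t, x, y) \<Rightarrow> case v c of (\<tau>, \<xi>, \<eta>) \<Rightarrow> (0, 0, \<xi> - \<tau> *\<^sub>R y))
          else 0)"

definition i_J ::
  "('p, real \<times> 'v::real_normed_vector) chart set \<Rightarrow> ('p \<Rightarrow> real) \<Rightarrow>
   ('p jet, real \<times> 'v \<times> 'v) form \<Rightarrow> ('p jet, real \<times> 'v \<times> 'v) form" where
  "i_J A \<pi> \<omega> j vs = (\<Sum>i<length vs. \<omega> j (vs[i := vert_endo A \<pi> j (vs ! i)]))"

definition d_J ::
  "('p, real \<times> 'v::real_normed_vector) chart set \<Rightarrow> ('p \<Rightarrow> real) \<Rightarrow>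
   ('p jet, real \<times> 'v \<times> 'v) form \<Rightarrow> ('p jet, real \<times> 'v \<times> 'v) form" where
  "d_J A \<pi> \<omega> j vs =
     i_J A \<pi> (ext_deriv (jet_atlas A \<pi>) \<omega>) j vs - ext_deriv (jet_atlas A \<pi>) (i_J A \<pi> \<omega>) j vs"

text \<open>\<open>\<theta> \<and> dt = d\<^sub>J \<omega> \<and> dt\<close> on \<open>U\<close>, for a \<open>k\<close>-form \<open>\<theta>\<close> and a \<open>(k-1)\<close>-form \<open>\<omega>\<close>.\<close>

definition d_J_primitive_mod_dt ::
  "('p, real \<times> 'v::real_normed_vector) chart set \<Rightarrow> ('p \<Rightarrow> real) \<Rightarrow> nat \<Rightarrow> 'p jet set \<Rightarrow>
   ('p jet, real \<times> 'v \<times> 'v) form \<Rightarrow> ('p jet, real \<times> 'v \<times> 'v) form \<Rightarrow> bool" where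
  "d_J_primitive_mod_dt A \<pi> k U \<theta> \<omega> \<longleftrightarrow>
     form_eq (jet_atlas A \<pi>) (k + 1) U
       (wedge_1form \<theta> (dt_form A \<pi>)) (wedge_1form (d_J A \<pi> \<omega>) (dt_form A \<pi>))"

text \<open>\<open>d\<^sub>J \<theta> \<and> dt = 0\<close> for a \<open>k\<close>-form \<open>\<theta>\<close>.\<close>

definition d_J_closed_mod_dt ::
  "('p, real \<times> 'v::real_normed_vector) chart set \<Rightarrow> ('p \<Rightarrow> real) \<Rightarrow> nat \<Rightarrow>
   ('p jet, real \<times> 'v \<times> 'v) form \<Rightarrow> bool" where
  "d_J_closed_mod_dt A \<pi> k \<theta> \<longleftrightarrow>
     form_eq (jet_atlas A \<pi>) (k + 2) (jet_space A \<pi>)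
       (wedge_1form (d_J A \<pi> \<theta>) (dt_form A \<pi>)) (\<lambda>_ _. 0)"

end

theory Submission
  imports Defs
begin

text \<open>
  Modulo \<open>dt\<close> only the restriction of a form to the kernel of \<open>dt\<close> matters. In an induced chart \<open>J\<close> has
  constant components there, \<open>J(0, \<xi>, \<eta>) = (0, 0, \<xi>)\<close>, and \<open>i\<^sub>J d - d i\<^sub>J\<close> becomes the antisymmetrized
  derivative \<open>\<omega> \<mapsto> \<Sum>\<^sub>i (-1)\<^sup>i D\<^bsub>J v\<^sub>i\<^esub> \<omega>(\<dots>,\<close> without \<open>v\<^sub>i, \<dots>)\<close> along \<open>J\<close>. It squares to zero because
  directional derivatives commute; this is (i). On semi-basic forms it is the exterior derivative in
  the fibre coordinates \<open>y\<close>, with \<open>(t, x)\<close> as parameters. The image of an induced chart contains whole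
  fibres, so the radial homotopy operator of the Poincare lemma yields a primitive; this is (ii).
\<close>

section \<open>Calculus on finite-dimensional inner product spaces\<close>

text \<open>\<open>ext_deriv\<close> and \<open>dt_form\<close> are computed at each point in the
  chart that \<open>some_chart\<close> picks there, and these choices need not be coherent between
  neighbouring points. Applying d_J twice, or checking a primitive built in one chart, needs a
  formula in one fixed chart on a whole neighbourhood. The real obstacle is thus chart independence
  of the antisymmetrized derivative. \<open>d_along_pullback\<close> supplies it directly, without
  passing through invariance of the exterior derivative, and it works on the kernel of dt: off it
  the components of J depend on y.

  These also turn a derivative in a varying direction, or a form with varying arguments, into sums
  with fixed directions and arguments, the shape in which \<open>Ck_on\<close> and
  \<open>k_form\<close> express smoothness.

  The atlas of the manifold is arbitrary, so fibred charts have to be constructed from the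
  submersion condition. Only one real coordinate must be straightened, which lets monotonicity and
  the intermediate value theorem replace a fixed point argument.\<close>

abbreviation FD :: "('a::real_normed_vector \<Rightarrow> 'b::real_normed_vector) \<Rightarrow> 'a \<Rightarrow> 'a \<Rightarrow> 'b" where
  "FD f x \<equiv> frechet_derivative f (at x)"

text \<open>Gram-Schmidt, one vector at a time: the residue \<open>r\<close> of the new vector is
  orthogonal to \<open>C\<close>; it is either 0, so that \<open>C\<close> already suffices, or it
  is normalised and added.\<close>

lemma orthonormal_span_exists:
  fixes B :: "'a::real_inner set"
  assumes "finite B"
  shows "\<exists>C. finite C \<and> (\<forall>x\<in>C. \<forall>y\<in>C. x \<bullet> y = (if x = y then 1 else 0)) \<and> B \<subseteq> span C"
  using assms
proof induction
  case empty
  show ?case by (intro exI[of _ "{}"]) auto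
next
  case (insert b B)
  then obtain C where C: "finite C" "\<forall>x\<in>C. \<forall>y\<in>C. x \<bullet> y = (if x = y then 1 else 0)" "B \<subseteq> span C"
    by blast
  define r where "r = b - (\<Sum>c\<in>C. (b \<bullet> c) *\<^sub>R c)"
  have sum_in: "(\<Sum>c\<in>C. (b \<bullet> c) *\<^sub>R c) \<in> span C"
    by (intro span_sum span_scale span_base)
  have orth: "r \<bullet> c = 0" if "c \<in> C" for c
  proof -
    have "(\<Sum>d\<in>C. (b \<bullet> d) * (d \<bullet> c)) = (\<Sum>d\<in>C. if d = c then b \<bullet> c else 0)"
      using C(2) that by (intro sum.cong) auto
    then show ?thesis
      using C(1) that by (simp add: r_def inner_diff_left inner_sum_left)
  qed
  show ?case
  proof (cases "r = 0")
    case True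
    then have "b \<in> span C" using sum_in by (simp add: r_def)
    then show ?thesis using C by blast
  next
    case False
    define e where "e = r /\<^sub>R norm r"
    have e: "e \<bullet> e = 1" using False by (simp add: e_def dot_square_norm power2_eq_square)
    have e0: "e \<bullet> c = 0" "c \<bullet> e = 0" if "c \<in> C" for c
      using orth[OF that] by (simp_all add: e_def inner_commute)
    have "r = norm r *\<^sub>R e" using False by (simp add: e_def)
    then have "b = norm r *\<^sub>R e + (\<Sum>c\<in>C. (b \<bullet> c) *\<^sub>R c)" by (simp add: r_def)
    also have "\<dots> \<in> span (insert e C)"
      by (intro span_add span_scale span_sum span_base) auto
    finally have "insert b B \<subseteq> span (insert e C)"
      using C(3) span_mono[of C "insert e C"] by auto
    moreover have "\<forall>x\<in>insert e C. \<forall>y\<in>insert e C. x \<bullet> y = (if x = y then 1 else 0)"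
      using C(2) e e0 by auto
    ultimately show ?thesis using C(1) by (intro exI[of _ "insert e C"]) auto
  qed
qed

text \<open>Pinned down by the reconstruction formula rather than by orthonormality; a finite
  Parseval frame would qualify too. Every use expands a vector or a linear map over this
  set.\<close>

definition onb :: "'a::fin_dim_inner set" where
  "onb = (SOME B. finite B \<and> (\<forall>x. x = (\<Sum>b\<in>B. (x \<bullet> b) *\<^sub>R b)))"

lemma onb_expansion: "x = (\<Sum>b\<in>onb. (x \<bullet> b) *\<^sub>R (b::'a::fin_dim_inner))"
proof -
  obtain B :: "'a set" where B: "finite B" "span B = UNIV"
    using finite_spanning_set by blast
  obtain C where C: "finite C" "\<forall>x\<in>C. \<forall>y\<in>C. x \<bullet> y = (if x = y then 1 else 0)" "B \<subseteq> span C"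
    using orthonormal_span_exists[OF B(1)] by blast
  have sp: "x \<in> span C" for x
    using span_mono[OF C(3)] B(2) by (metis UNIV_I span_span subsetD)
  have "x = (\<Sum>b\<in>C. (x \<bullet> b) *\<^sub>R b)" for x
  proof -
    obtain u where u: "x = (\<Sum>b\<in>C. u b *\<^sub>R b)"
      using sp[of x] span_finite[OF C(1)] by auto
    have "x \<bullet> c = u c" if "c \<in> C" for c
    proof -
      have "(\<Sum>d\<in>C. u d * (d \<bullet> c)) = (\<Sum>d\<in>C. if d = c then u c else 0)"
        using C(2) that by (intro sum.cong) auto
      then show ?thesis using C(1) that by (simp add: u inner_sum_left)
    qed
    then show ?thesis by (subst u) (intro sum.cong, auto)
  qed
  then have "finite (onb :: 'a set) \<and> (\<forall>x. x = (\<Sum>b\<in>onb. (x \<bullet> b) *\<^sub>R (b::'a)))"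
    unfolding onb_def by (intro someI[of "\<lambda>B. finite B \<and> (\<forall>x. x = (\<Sum>b\<in>B. (x \<bullet> b) *\<^sub>R b))"]) (use C(1) in auto)
  then show ?thesis by (elim conjE allE)
qed

lemma linear_onb_expansion:
  assumes "linear f" shows "f x = (\<Sum>b\<in>onb. (x \<bullet> b) *\<^sub>R f (b::'a::fin_dim_inner))"
  by (subst (1) onb_expansion[of x]) (simp add: linear_sum[OF assms] linear_scale[OF assms])

lemma linear_imp_bounded:
  fixes f :: "'a::fin_dim_inner \<Rightarrow> 'b::real_normed_vector"
  assumes "linear f" shows "bounded_linear f"
proof -
  have "bounded_linear (\<lambda>x. \<Sum>b\<in>onb. (x \<bullet> b) *\<^sub>R f b)"
    by (intro bounded_linear_sum bounded_linear_scaleR_left[THEN bounded_linear_compose]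
        bounded_linear_inner_left)
  then show ?thesis by (simp add: linear_onb_expansion[OF assms, symmetric])
qed

section \<open>Locality of derivatives and of C^k regularity\<close>

lemma FD_eqI: "(f has_derivative f') (at x) \<Longrightarrow> FD f x = f'"
  by (rule frechet_derivative_at[symmetric])

lemma FD_cong_open:
  assumes "open T" "x \<in> T" "\<And>y. y \<in> T \<Longrightarrow> f y = g y"
  shows "FD f x = FD g x"
proof -
  have "(f has_derivative f') (at x) = (g has_derivative f') (at x)" for f'
    using has_derivative_transform_within_open[OF _ assms(1,2), of f f' UNIV g]
      has_derivative_transform_within_open[OF _ assms(1,2), of g f' UNIV f] assms(3) by auto
  then show ?thesis by (simp add: frechet_derivative_def)
qed

lemma Ck_on_cong:
  assumes "open S" "\<And>x. x \<in> S \<Longrightarrow> f x = g x" "Ck_on k f S"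
  shows "Ck_on k g S"
  using assms(2,3)
proof (induction k arbitrary: f g)
  case 0
  then show ?case using continuous_on_cong by auto
next
  case (Suc k)
  have "g differentiable (at x)" if "x \<in> S" for x
  proof -
    have "(f has_derivative FD f x) (at x)"
      using Suc.prems(2) that by (simp add: frechet_derivative_works[symmetric])
    then have "(g has_derivative FD f x) (at x)"
      by (rule has_derivative_transform_within_open[of f "FD f x" x UNIV S g])
        (fact assms(1), fact that, rule Suc.prems(1))
    then show ?thesis by (rule differentiableI)
  qed
  moreover have "Ck_on k (\<lambda>x. FD g x v) S" for v
  proof (rule Suc.IH[of "\<lambda>x. FD f x v"])
    show "FD f x v = FD g x v" if "x \<in> S" for x
      by (rule fun_cong[OF FD_cong_open[OF assms(1) that Suc.prems(1)]])
    show "Ck_on k (\<lambda>x. FD f x v) S" using Suc.prems(2) by simp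
  qed
  ultimately show ?case by simp
qed

lemma Ck_on_SucI:
  assumes "open S" "\<And>x. x \<in> S \<Longrightarrow> (f has_derivative f' x) (at x)" "\<And>v. Ck_on k (\<lambda>x. f' x v) S"
  shows "Ck_on (Suc k) f S"
proof -
  have "Ck_on k (\<lambda>x. FD f x v) S" for v
    by (rule Ck_on_cong[OF assms(1) _ assms(3)[of v]]) (simp add: FD_eqI[OF assms(2)])
  then show ?thesis using assms(2) by (auto simp: differentiable_def)
qed

lemma Ck_on_SucD:
  assumes "Ck_on (Suc k) f S"
  shows "x \<in> S \<Longrightarrow> (f has_derivative FD f x) (at x)" "Ck_on k (\<lambda>x. FD f x v) S"
  using assms by (auto simp: frechet_derivative_works)

lemma Ck_on_Suc_imp: "Ck_on (Suc k) f S \<Longrightarrow> Ck_on k f S"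
proof (induction k arbitrary: f)
  case 0
  then show ?case
    by (auto intro!: differentiable_imp_continuous_within continuous_at_imp_continuous_on)
qed auto

lemma Ck_on_le: "Ck_on m f S \<Longrightarrow> k \<le> m \<Longrightarrow> Ck_on k f S"
  by (induction m) (auto simp: le_Suc_eq intro: Ck_on_Suc_imp simp del: Ck_on.simps(2))

lemma Ck_on_imp_continuous_on: "Ck_on k f S \<Longrightarrow> continuous_on S f"
  using Ck_on_le[of k f S 0] by simp

lemma Ck_on_subset: "Ck_on k f S \<Longrightarrow> T \<subseteq> S \<Longrightarrow> Ck_on k f T"
  by (induction k arbitrary: f) (auto intro: continuous_on_subset)

text \<open>Derivatives are taken at points, not within the set, so only the continuity at the
  bottom of the recursion has to be localised.\<close>

lemma Ck_on_local:
  assumes "\<And>x. x \<in> S \<Longrightarrow> \<exists>T. open T \<and> x \<in> T \<and> Ck_on k f (S \<inter> T)"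
  shows "Ck_on k f S"
  using assms
proof (induction k arbitrary: f)
  case 0
  have "continuous (at x within S) f" if x: "x \<in> S" for x
  proof -
    obtain T where T: "open T" "x \<in> T" "continuous_on (S \<inter> T) f"
      using 0 x by auto
    have "at x within (S \<inter> T) = at x within S"
      by (rule at_within_nhd[OF T(2,1)]) auto
    then show ?thesis
      using T(2,3) x by (metis IntI continuous_on_eq_continuous_within)
  qed
  then show ?case by (simp add: continuous_on_eq_continuous_within)
next
  case (Suc k)
  have "Ck_on k (\<lambda>x. FD f x v) S" for v
    by (rule Suc.IH) (use Suc.prems in fastforce)
  moreover have "f differentiable (at x)" if "x \<in> S" for x
    using Suc.prems[OF that] that by auto
  ultimately show ?case by simp
qed

section \<open>Closure of C^k maps under algebraic operations and composition\<close>

lemma Ck_on_const: "Ck_on k (\<lambda>x. c) S"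
  by (induction k arbitrary: c) auto

lemma Ck_on_bounded_linear:
  assumes "open S" "bounded_linear f" shows "Ck_on k f S"
proof (cases k)
  case 0
  then show ?thesis using assms by (simp add: linear_continuous_on)
next
  case (Suc m)
  show ?thesis unfolding Suc
    by (rule Ck_on_SucI[where f' = "\<lambda>_. f"])
      (use assms in \<open>auto simp: Ck_on_const bounded_linear_imp_has_derivative\<close>)
qed

lemma Ck_on_linear_compose:
  assumes "open S" "bounded_linear h" "Ck_on k f S" shows "Ck_on k (\<lambda>x. h (f x)) S"
  using assms(3)
proof (induction k arbitrary: f)
  case 0
  then show ?case using bounded_linear.continuous_on[OF assms(2)] by auto
next
  case (Suc k)
  show ?case
  proof (rule Ck_on_SucI[OF assms(1)])
    show "((\<lambda>x. h (f x)) has_derivative (\<lambda>v. h (FD f x v))) (at x)" if "x \<in> S" for x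
      by (rule bounded_linear.has_derivative[OF assms(2) Ck_on_SucD(1)[OF Suc.prems that]])
    show "Ck_on k (\<lambda>x. h (FD f x v)) S" for v
      by (rule Suc.IH[OF Ck_on_SucD(2)[OF Suc.prems]])
  qed
qed

lemma Ck_on_add:
  assumes "open S" "Ck_on k f S" "Ck_on k g S" shows "Ck_on k (\<lambda>x. f x + g x) S"
  using assms(2,3)
proof (induction k arbitrary: f g)
  case 0
  then show ?case by (auto intro: continuous_intros)
next
  case (Suc k)
  show ?case
    by (rule Ck_on_SucI[OF assms(1) has_derivative_add[OF Ck_on_SucD(1)[OF Suc.prems(1)] Ck_on_SucD(1)[OF Suc.prems(2)]]
        Suc.IH[OF Ck_on_SucD(2)[OF Suc.prems(1)] Ck_on_SucD(2)[OF Suc.prems(2)]]])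
qed

lemma Ck_on_sum:
  assumes "open S" "\<And>i. i \<in> I \<Longrightarrow> Ck_on k (f i) S" shows "Ck_on k (\<lambda>x. \<Sum>i\<in>I. f i x) S"
  using assms(2)
  by (induction I rule: infinite_finite_induct) (auto intro: Ck_on_const Ck_on_add[OF assms(1)])

lemma Ck_on_bilinear:
  assumes "open S" "bounded_bilinear h" "Ck_on k f S" "Ck_on k g S"
  shows "Ck_on k (\<lambda>x. h (f x) (g x)) S"
  using assms(3,4)
proof (induction k arbitrary: f g)
  case 0
  then show ?case using bounded_bilinear.continuous_on[OF assms(2)] by auto
next
  case (Suc k)
  show ?case
  proof (rule Ck_on_SucI[OF assms(1)])
    show "((\<lambda>x. h (f x) (g x)) has_derivative (\<lambda>v. h (f x) (FD g x v) + h (FD f x v) (g x))) (at x)"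
      if "x \<in> S" for x
      by (rule bounded_bilinear.FDERIV[OF assms(2) Ck_on_SucD(1)[OF Suc.prems(1) that]
            Ck_on_SucD(1)[OF Suc.prems(2) that]])
    show "Ck_on k (\<lambda>x. h (f x) (FD g x v) + h (FD f x v) (g x)) S" for v
      by (intro Ck_on_add[OF assms(1)] Suc.IH Ck_on_SucD(2) Suc.prems Ck_on_Suc_imp)
  qed
qed

lemma Ck_on_scaleR:
  assumes "open S" "Ck_on k f S" "Ck_on k g S" shows "Ck_on k (\<lambda>x. f x *\<^sub>R g x) S"
  by (rule Ck_on_bilinear[OF assms(1) bounded_bilinear_scaleR assms(2,3)])

lemma Ck_on_mult:
  fixes f :: "'a::real_normed_vector \<Rightarrow> real"
  assumes "open S" "Ck_on k f S" "Ck_on k g S" shows "Ck_on k (\<lambda>x. f x * g x) S"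
  by (rule Ck_on_bilinear[OF assms(1) bounded_bilinear_mult assms(2,3)])

lemma Ck_on_uminus:
  assumes "open S" "Ck_on k f S" shows "Ck_on k (\<lambda>x. - f x) S"
  by (rule Ck_on_linear_compose[OF assms(1) bounded_linear_minus[OF bounded_linear_ident] assms(2)])

lemma Ck_on_diff:
  assumes "open S" "Ck_on k f S" "Ck_on k g S" shows "Ck_on k (\<lambda>x. f x - g x) S"
  using Ck_on_add[OF assms(1,2) Ck_on_uminus[OF assms(1,3)]] by simp

lemma Ck_on_power:
  fixes f :: "'a::real_normed_vector \<Rightarrow> real"
  assumes "open S" "Ck_on k f S" shows "Ck_on k (\<lambda>x. f x ^ m) S"
  by (induction m) (auto intro: Ck_on_const Ck_on_mult assms)

lemma Ck_on_Pair:
  assumes "open S" "Ck_on k f S" "Ck_on k g S" shows "Ck_on k (\<lambda>x. (f x, g x)) S"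
proof -
  have "Ck_on k (\<lambda>x. (f x, 0) + (0, g x)) S"
    by (intro Ck_on_add[OF assms(1)] Ck_on_linear_compose[OF assms(1) _ assms(2), where h = "\<lambda>u. (u, 0)"]
        Ck_on_linear_compose[OF assms(1) _ assms(3), where h = "\<lambda>u. (0, u)"]
        bounded_linear_Pair bounded_linear_ident bounded_linear_zero)
  then show ?thesis by simp
qed

lemma Ck_on_fst: "open S \<Longrightarrow> Ck_on k f S \<Longrightarrow> Ck_on k (\<lambda>x. fst (f x)) S"
  and Ck_on_snd: "open S \<Longrightarrow> Ck_on k f S \<Longrightarrow> Ck_on k (\<lambda>x. snd (f x)) S"
  by (auto intro: Ck_on_linear_compose bounded_linear_fst bounded_linear_snd)

text \<open>The chain rule differentiates g in the direction \<open>FD f x v\<close>, which moves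
  with x, whereas \<open>Ck_on\<close> speaks of fixed directions. Expanding over \<open>onb\<close>
  separates scalar factors from the maps \<open>FD g (f x) b\<close> with b fixed; these are
  compositions with a derivative of g, so the induction generalises g.\<close>

lemma Ck_on_compose:
  fixes g :: "'b::fin_dim_inner \<Rightarrow> 'c::real_normed_vector"
  assumes "open S" "open T" "Ck_on k f S" "Ck_on k g T" "f ` S \<subseteq> T"
  shows "Ck_on k (\<lambda>x. g (f x)) S"
  using assms(3-5)
proof (induction k arbitrary: g)
  case 0
  then show ?case using continuous_on_compose2[of T g S f] by auto
next
  case (Suc k)
  show ?case
  proof (rule Ck_on_SucI[OF assms(1)])
    show "((\<lambda>x. g (f x)) has_derivative (\<lambda>v. \<Sum>b\<in>onb. (FD f x v \<bullet> b) *\<^sub>R FD g (f x) b)) (at x)"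
      if "x \<in> S" for x
    proof -
      have "f x \<in> T" using Suc.prems(3) that by auto
      note g = Ck_on_SucD(1)[OF Suc.prems(2) this]
      have "((\<lambda>x. g (f x)) has_derivative (\<lambda>v. FD g (f x) (FD f x v))) (at x)"
        using has_derivative_compose[OF Ck_on_SucD(1)[OF Suc.prems(1) that] g] .
      then show ?thesis
        by (rule has_derivative_eq_rhs) (rule ext, rule linear_onb_expansion[OF has_derivative_linear[OF g]])
    qed
    show "Ck_on k (\<lambda>x. \<Sum>b\<in>onb. (FD f x v \<bullet> b) *\<^sub>R FD g (f x) b) S" for v
      by (intro Ck_on_sum[OF assms(1)] Ck_on_scaleR[OF assms(1)] Suc.IH[of "\<lambda>y. FD g y _"]
          Ck_on_linear_compose[OF assms(1) bounded_linear_inner_left] Ck_on_SucD(2) Suc.prems Ck_on_Suc_imp)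
  qed
qed

text \<open>The derivative is a product of \<open>FD f x v\<close> and the inverse itself, so each
  order of smoothness of the inverse yields the next.\<close>

lemma Ck_on_inverse:
  fixes f :: "'a::real_normed_vector \<Rightarrow> real"
  assumes "open S" "Ck_on k f S" "\<And>x. x \<in> S \<Longrightarrow> f x \<noteq> 0"
  shows "Ck_on k (\<lambda>x. inverse (f x)) S"
  using assms(2)
proof (induction k)
  case 0
  then show ?case using assms(3) by (auto intro: continuous_intros)
next
  case (Suc k)
  show ?case
  proof (rule Ck_on_SucI[OF assms(1)])
    show "((\<lambda>x. inverse (f x)) has_derivative (\<lambda>v. - (inverse (f x) * FD f x v * inverse (f x)))) (at x)"
      if "x \<in> S" for x
      by (rule Deriv.has_derivative_inverse[OF assms(3)[OF that] Ck_on_SucD(1)[OF Suc.prems that]])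
    show "Ck_on k (\<lambda>x. - (inverse (f x) * FD f x v * inverse (f x))) S" for v
      by (intro Ck_on_uminus Ck_on_mult assms(1) Suc.IH Ck_on_SucD(2) Suc.prems Ck_on_Suc_imp)
  qed
qed

section \<open>Smooth maps and their directional derivatives\<close>

lemma smooth_onI: "(\<And>k. Ck_on k f S) \<Longrightarrow> smooth_on f S" and smooth_onD: "smooth_on f S \<Longrightarrow> Ck_on k f S"
  by (auto simp: smooth_on_def)

lemma smooth_imp_continuous_on: "smooth_on f S \<Longrightarrow> continuous_on S f"
  using Ck_on_imp_continuous_on smooth_onD by blast

lemma smooth_on_subset: "smooth_on f S \<Longrightarrow> T \<subseteq> S \<Longrightarrow> smooth_on f T"
  by (meson Ck_on_subset smooth_on_def)

lemma smooth_on_cong: "open S \<Longrightarrow> (\<And>x. x \<in> S \<Longrightarrow> f x = g x) \<Longrightarrow> smooth_on f S \<Longrightarrow> smooth_on g S"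
  unfolding smooth_on_def using Ck_on_cong by blast

lemma smooth_on_local:
  assumes "\<And>x. x \<in> S \<Longrightarrow> \<exists>T. open T \<and> x \<in> T \<and> smooth_on f (S \<inter> T)"
  shows "smooth_on f S"
  by (intro smooth_onI Ck_on_local) (meson assms smooth_onD)

lemma smooth_on_FDERIV: "smooth_on f S \<Longrightarrow> x \<in> S \<Longrightarrow> (f has_derivative FD f x) (at x)"
  using Ck_on_SucD(1) smooth_onD by blast

lemma smooth_on_FD: "smooth_on f S \<Longrightarrow> smooth_on (\<lambda>x. FD f x v) S"
  using Ck_on_SucD(2) smooth_onD smooth_onI by blast

lemma linear_FD: "smooth_on f S \<Longrightarrow> x \<in> S \<Longrightarrow> linear (FD f x)"
  using smooth_on_FDERIV has_derivative_linear by blast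

lemma smooth_on_const: "smooth_on (\<lambda>x. c) S"
  by (simp add: smooth_on_def Ck_on_const)

lemma smooth_on_bounded_linear: "open S \<Longrightarrow> bounded_linear f \<Longrightarrow> smooth_on f S"
  by (simp add: smooth_on_def Ck_on_bounded_linear)

lemma smooth_on_ident: "open S \<Longrightarrow> smooth_on (\<lambda>x. x) S"
  by (simp add: smooth_on_bounded_linear)

lemma smooth_on_linear_compose:
  "open S \<Longrightarrow> bounded_linear h \<Longrightarrow> smooth_on f S \<Longrightarrow> smooth_on (\<lambda>x. h (f x)) S"
  by (simp add: smooth_on_def Ck_on_linear_compose)

lemma smooth_on_add: "open S \<Longrightarrow> smooth_on f S \<Longrightarrow> smooth_on g S \<Longrightarrow> smooth_on (\<lambda>x. f x + g x) S"
  by (simp add: smooth_on_def Ck_on_add)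

lemma smooth_on_diff: "open S \<Longrightarrow> smooth_on f S \<Longrightarrow> smooth_on g S \<Longrightarrow> smooth_on (\<lambda>x. f x - g x) S"
  by (simp add: smooth_on_def Ck_on_diff)

lemma smooth_on_sum: "open S \<Longrightarrow> (\<And>i. i \<in> I \<Longrightarrow> smooth_on (f i) S) \<Longrightarrow> smooth_on (\<lambda>x. \<Sum>i\<in>I. f i x) S"
  by (simp add: smooth_on_def Ck_on_sum)

lemma smooth_on_scaleR: "open S \<Longrightarrow> smooth_on f S \<Longrightarrow> smooth_on g S \<Longrightarrow> smooth_on (\<lambda>x. f x *\<^sub>R g x) S"
  by (simp add: smooth_on_def Ck_on_scaleR)

lemma smooth_on_mult:
  fixes f :: "'a::real_normed_vector \<Rightarrow> real"
  shows "open S \<Longrightarrow> smooth_on f S \<Longrightarrow> smooth_on g S \<Longrightarrow> smooth_on (\<lambda>x. f x * g x) S"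
  by (simp add: smooth_on_def Ck_on_mult)

lemma smooth_on_power:
  fixes f :: "'a::real_normed_vector \<Rightarrow> real"
  shows "open S \<Longrightarrow> smooth_on f S \<Longrightarrow> smooth_on (\<lambda>x. f x ^ m) S"
  by (simp add: smooth_on_def Ck_on_power)

lemma smooth_on_Pair: "open S \<Longrightarrow> smooth_on f S \<Longrightarrow> smooth_on g S \<Longrightarrow> smooth_on (\<lambda>x. (f x, g x)) S"
  by (simp add: smooth_on_def Ck_on_Pair)

lemma smooth_on_fst: "open S \<Longrightarrow> smooth_on f S \<Longrightarrow> smooth_on (\<lambda>x. fst (f x)) S"
  and smooth_on_snd: "open S \<Longrightarrow> smooth_on f S \<Longrightarrow> smooth_on (\<lambda>x. snd (f x)) S"
  by (simp_all add: smooth_on_def Ck_on_fst Ck_on_snd)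

lemma smooth_on_compose:
  fixes g :: "'b::fin_dim_inner \<Rightarrow> 'c::real_normed_vector"
  shows "open S \<Longrightarrow> open T \<Longrightarrow> smooth_on f S \<Longrightarrow> smooth_on g T \<Longrightarrow> f ` S \<subseteq> T \<Longrightarrow> smooth_on (\<lambda>x. g (f x)) S"
  unfolding smooth_on_def using Ck_on_compose by blast

text \<open>Point and direction both vary, and again expansion over \<open>onb\<close> freezes the
  direction. This is what makes the velocity component of an induced coordinate change
  smooth.\<close>

lemma smooth_on_FD_apply:
  fixes f :: "'a::fin_dim_inner \<Rightarrow> 'b::real_normed_vector"
  assumes "open S" "open T" "smooth_on f T" "smooth_on g S" "g ` S \<subseteq> T" "smooth_on h S"
  shows "smooth_on (\<lambda>x. FD f (g x) (h x)) S"
proof (rule smooth_on_cong[OF assms(1)])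
  show "smooth_on (\<lambda>x. \<Sum>b\<in>onb. (h x \<bullet> b) *\<^sub>R FD f (g x) b) S"
    by (intro smooth_on_sum[OF assms(1)] smooth_on_scaleR[OF assms(1)]
        smooth_on_compose[OF assms(1,2,4) _ assms(5), of "\<lambda>y. FD f y _"]
        smooth_on_linear_compose[OF assms(1) bounded_linear_inner_left] smooth_on_FD assms(3,6))
  show "(\<Sum>b\<in>onb. (h x \<bullet> b) *\<^sub>R FD f (g x) b) = FD f (g x) (h x)" if "x \<in> S" for x
    using assms(5) that by (intro linear_onb_expansion[symmetric] linear_FD[OF assms(3)]) auto
qed

lemma FD_chain:
  assumes "smooth_on f S" "x \<in> S" "smooth_on g T" "f x \<in> T"
  shows "FD (\<lambda>x. g (f x)) x v = FD g (f x) (FD f x v)"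
  using FD_eqI[OF has_derivative_compose[OF smooth_on_FDERIV[OF assms(1,2)]
        smooth_on_FDERIV[OF assms(3,4)]]] by simp

section \<open>Symmetry of second derivatives\<close>

lemma second_difference_mvt:
  fixes f :: "'a::real_normed_vector \<Rightarrow> real"
  assumes "smooth_on f S" and h: "h > 0"
    and S: "\<And>s t. 0 \<le> s \<Longrightarrow> s \<le> h \<Longrightarrow> 0 \<le> t \<Longrightarrow> t \<le> h \<Longrightarrow> x + s *\<^sub>R v + t *\<^sub>R w \<in> S"
  shows "\<exists>s t. 0 < s \<and> s < h \<and> 0 < t \<and> t < h \<and>
    f (x + h *\<^sub>R v + h *\<^sub>R w) - f (x + h *\<^sub>R v) - f (x + h *\<^sub>R w) + f x =
      h * h * FD (\<lambda>y. FD f y v) (x + s *\<^sub>R v + t *\<^sub>R w) w"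
proof -
  have line: "((\<lambda>s. g (a + s *\<^sub>R u)) has_real_derivative FD g (a + s *\<^sub>R u) u) (at s)"
    if "smooth_on g S" "a + s *\<^sub>R u \<in> S" for g :: "'a \<Rightarrow> real" and a u s
  proof -
    have "((\<lambda>s. a + s *\<^sub>R u) has_derivative (\<lambda>r. r *\<^sub>R u)) (at s)"
      by (auto intro!: derivative_eq_intros)
    from has_derivative_compose[OF this smooth_on_FDERIV[OF that]]
    show ?thesis
      unfolding has_field_derivative_def
      by (rule has_derivative_eq_rhs) (simp add: fun_eq_iff linear_scale[OF linear_FD[OF that]])
  qed
  \<comment> \<open>The second difference equals \<phi> h - \<phi> 0. A mean value step in the
    direction v leaves a difference of first derivatives along w; a second step in the direction w
    finishes.\<close>
  define \<phi> where "\<phi> s = f (x + h *\<^sub>R w + s *\<^sub>R v) - f (x + s *\<^sub>R v)" for s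
  have "\<exists>s>0. s < h \<and> \<phi> h - \<phi> 0 = (h - 0) * (FD f (x + h *\<^sub>R w + s *\<^sub>R v) v - FD f (x + s *\<^sub>R v) v)"
    unfolding \<phi>_def
  proof (rule MVT2[OF h])
    fix s assume s: "0 \<le> s" "s \<le> h"
    show "((\<lambda>s. f (x + h *\<^sub>R w + s *\<^sub>R v) - f (x + s *\<^sub>R v)) has_real_derivative
        FD f (x + h *\<^sub>R w + s *\<^sub>R v) v - FD f (x + s *\<^sub>R v) v) (at s)"
      using S[of s h] S[of s 0] s h
      by (intro DERIV_diff line[OF assms(1)]) (auto simp: algebra_simps)
  qed
  then obtain s where s: "0 < s" "s < h"
    "\<phi> h - \<phi> 0 = h * (FD f (x + h *\<^sub>R w + s *\<^sub>R v) v - FD f (x + s *\<^sub>R v) v)" by auto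
  have "\<exists>t>0. t < h \<and> FD f (x + s *\<^sub>R v + h *\<^sub>R w) v - FD f (x + s *\<^sub>R v + 0 *\<^sub>R w) v =
      (h - 0) * FD (\<lambda>y. FD f y v) (x + s *\<^sub>R v + t *\<^sub>R w) w"
    using S[of s] s(1,2) by (intro MVT2[OF h] line smooth_on_FD assms(1)) auto
  then obtain t where "0 < t" "t < h"
    "FD f (x + s *\<^sub>R v + h *\<^sub>R w) v - FD f (x + s *\<^sub>R v) v = h * FD (\<lambda>y. FD f y v) (x + s *\<^sub>R v + t *\<^sub>R w) w"
    by auto
  then show ?thesis
    using s by (intro exI[of _ s] exI[of _ t]) (simp add: \<phi>_def algebra_simps)
qed

text \<open>The second difference over the parallelogram spanned by h v and h w does not change when
  v and w are exchanged. Its two mean value forms equate a value of P with a value of Q, both taken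
  near x; continuity of P and Q then excludes a gap at x.\<close>

lemma FD_FD_commute_real:
  fixes f :: "'a::real_normed_vector \<Rightarrow> real"
  assumes "open S" "smooth_on f S" "x \<in> S"
  shows "FD (\<lambda>y. FD f y v) x w = FD (\<lambda>y. FD f y w) x v"
proof (rule ccontr)
  define P where "P y = FD (\<lambda>y. FD f y v) y w" for y
  define Q where "Q y = FD (\<lambda>y. FD f y w) y v" for y
  assume "\<not> ?thesis"
  then have ne: "\<bar>P x - Q x\<bar> > 0" by (simp add: P_def Q_def)
  have "isCont P x" "isCont Q x"
    unfolding P_def Q_def using assms
    by (auto intro!: continuous_on_interior[of S] smooth_imp_continuous_on smooth_on_FD
        simp: interior_open)
  then obtain d1 d2 where d: "d1 > 0" "\<And>y. dist y x < d1 \<Longrightarrow> dist (P y) (P x) < \<bar>P x - Q x\<bar> / 2"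
    "d2 > 0" "\<And>y. dist y x < d2 \<Longrightarrow> dist (Q y) (Q x) < \<bar>P x - Q x\<bar> / 2"
    using ne unfolding continuous_at_eps_delta by (metis half_gt_zero)
  obtain d3 where d3: "d3 > 0" "ball x d3 \<subseteq> S"
    using assms(1,3) openE by blast
  \<comment> \<open>Small enough that the whole parallelogram stays where P and Q are controlled and
    f is smooth; the summand 1 keeps the quotient defined for v = w = 0.\<close>
  define h where "h = min d1 (min d2 d3) / (norm v + norm w + 1)"
  have N: "norm v + norm w + 1 > 0" by (simp add: add_nonneg_pos)
  have h: "h > 0" using d(1,3) d3(1) N by (simp add: h_def)
  have near: "dist (x + s *\<^sub>R v + t *\<^sub>R w) x < min d1 (min d2 d3)"
    if "0 \<le> s" "s \<le> h" "0 \<le> t" "t \<le> h" for s t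
  proof -
    have "dist (x + s *\<^sub>R v + t *\<^sub>R w) x \<le> s * norm v + t * norm w"
      using norm_triangle_ineq[of "s *\<^sub>R v" "t *\<^sub>R w"] that by (simp add: dist_norm add.assoc)
    also have "\<dots> \<le> h * norm v + h * norm w"
      using that by (intro add_mono mult_right_mono) auto
    also have "\<dots> < h * (norm v + norm w + 1)" using h by (simp add: algebra_simps)
    also have "\<dots> = min d1 (min d2 d3)" using N by (simp add: h_def)
    finally show ?thesis .
  qed
  have inS: "x + s *\<^sub>R v + t *\<^sub>R w \<in> S" "x + t *\<^sub>R w + s *\<^sub>R v \<in> S"
    if "0 \<le> s" "s \<le> h" "0 \<le> t" "t \<le> h" for s t
    using near[OF that] d3(2) by (auto simp: dist_commute add.assoc add.commute[of "t *\<^sub>R w"])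
  obtain s t where st: "0 < s" "s < h" "0 < t" "t < h"
    "f (x + h *\<^sub>R v + h *\<^sub>R w) - f (x + h *\<^sub>R v) - f (x + h *\<^sub>R w) + f x = h * h * P (x + s *\<^sub>R v + t *\<^sub>R w)"
    unfolding P_def using second_difference_mvt[OF assms(2) h inS(1)] by blast
  obtain s' t' where st': "0 < s'" "s' < h" "0 < t'" "t' < h"
    "f (x + h *\<^sub>R w + h *\<^sub>R v) - f (x + h *\<^sub>R w) - f (x + h *\<^sub>R v) + f x = h * h * Q (x + t' *\<^sub>R w + s' *\<^sub>R v)"
    unfolding Q_def using second_difference_mvt[OF assms(2) h inS(2)] by blast
  have e: "x + h *\<^sub>R w + h *\<^sub>R v = x + h *\<^sub>R v + h *\<^sub>R w" "x + t' *\<^sub>R w + s' *\<^sub>R v = x + s' *\<^sub>R v + t' *\<^sub>R w"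
    by (simp_all add: algebra_simps)
  have "h * h * P (x + s *\<^sub>R v + t *\<^sub>R w) = h * h * Q (x + s' *\<^sub>R v + t' *\<^sub>R w)"
    using st(5) st'(5) unfolding e by linarith
  then have "P (x + s *\<^sub>R v + t *\<^sub>R w) = Q (x + s' *\<^sub>R v + t' *\<^sub>R w)" using h by simp
  moreover have "dist (P (x + s *\<^sub>R v + t *\<^sub>R w)) (P x) < \<bar>P x - Q x\<bar> / 2"
    using near[of s t] st by (intro d(2)) auto
  moreover have "dist (Q (x + s' *\<^sub>R v + t' *\<^sub>R w)) (Q x) < \<bar>P x - Q x\<bar> / 2"
    using near[of s' t'] st' by (intro d(4)) auto
  ultimately show False by (simp add: dist_real_def abs_if split: if_splits)
qed

text \<open>Pairing with an arbitrary vector c reduces the claim to real functions.\<close>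

lemma FD_FD_commute:
  fixes f :: "'a::real_normed_vector \<Rightarrow> 'b::real_inner"
  assumes "open S" "smooth_on f S" "x \<in> S"
  shows "FD (\<lambda>y. FD f y v) x w = FD (\<lambda>y. FD f y w) x v"
proof -
  have *: "FD (\<lambda>y. FD f y v) x w \<bullet> c = FD (\<lambda>y. FD (\<lambda>y. f y \<bullet> c) y v) x w" for c v w
  proof -
    have 1: "FD (\<lambda>y. g y \<bullet> c) y u = FD g y u \<bullet> c" if "smooth_on g S" "y \<in> S" for g :: "'a \<Rightarrow> 'b" and y u
      using FD_eqI[OF bounded_linear.has_derivative[OF bounded_linear_inner_left smooth_on_FDERIV[OF that]]]
      by simp
    have "FD (\<lambda>y. FD (\<lambda>y. f y \<bullet> c) y v) x w = FD (\<lambda>y. FD f y v \<bullet> c) x w"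
      by (rule fun_cong[OF FD_cong_open[OF assms(1,3)]]) (simp add: 1 assms)
    also have "\<dots> = FD (\<lambda>y. FD f y v) x w \<bullet> c"
      using 1[OF smooth_on_FD[OF assms(2)] assms(3)] .
    finally show ?thesis by simp
  qed
  have "FD (\<lambda>y. FD f y v) x w \<bullet> c = FD (\<lambda>y. FD f y w) x v \<bullet> c" for c
    unfolding * by (intro FD_FD_commute_real[OF assms(1) _ assms(3)]
        smooth_on_linear_compose[OF assms(1) bounded_linear_inner_left assms(2)])
  then show ?thesis
    using vector_eq_rdot by blast
qed

section \<open>Alternating forms and antisymmetrized derivatives\<close>

definition alternating :: "nat \<Rightarrow> ('e::real_vector list \<Rightarrow> real) \<Rightarrow> bool" where
  "alternating k f \<longleftrightarrow>
     (\<forall>us i v w a b. length us = k \<longrightarrow> i < k \<longrightarrow>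
        f (us[i := a *\<^sub>R v + b *\<^sub>R w]) = a * f (us[i := v]) + b * f (us[i := w])) \<and>
     (\<forall>us i j. length us = k \<longrightarrow> i < j \<longrightarrow> j < k \<longrightarrow> us ! i = us ! j \<longrightarrow> f us = 0)"

lemma alternating_lin:
  "alternating k f \<Longrightarrow> length us = k \<Longrightarrow> i < k \<Longrightarrow>
    f (us[i := a *\<^sub>R v + b *\<^sub>R w]) = a * f (us[i := v]) + b * f (us[i := w])"
  by (simp add: alternating_def)

lemma alternating_alt:
  assumes "alternating k f" "length us = k" "i \<noteq> j" "i < k" "j < k" "us ! i = us ! j" shows "f us = 0"
proof (cases "i < j")
  case True
  then show ?thesis using assms unfolding alternating_def by blast
next
  case False
  then have "j < i" using assms(3) by simp
  then show ?thesis using assms unfolding alternating_def by metis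
qed

lemma alternating_linear:
  assumes "alternating k f" "length us = k" "i < k" shows "linear (\<lambda>v. f (us[i := v]))"
  using alternating_lin[OF assms, of 1 _ 1] alternating_lin[OF assms, of _ _ 0] by (intro linearI) simp_all

lemma alternating_expand:
  fixes f :: "'e::fin_dim_inner list \<Rightarrow> real"
  assumes "alternating k f" "length us = k" "i < k"
  shows "f (us[i := v]) = (\<Sum>b\<in>onb. (v \<bullet> b) * f (us[i := b]))"
  using linear_onb_expansion[OF alternating_linear[OF assms], of v] by simp

text \<open>Polarisation: expand the vanishing of f with v + w in both slots.\<close>

lemma alternating_swap:
  assumes "alternating k f" "length us = k" "i \<noteq> j" "i < k" "j < k"
  shows "f (us[i := v, j := w]) = - f (us[i := w, j := v])"
proof -
  have [simp]: "us[j := x, i := y] = us[i := y, j := x]" for x y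
    using assms(3) by (simp add: list_update_swap)
  have z: "f (us[i := x, j := x]) = 0" for x
    using assms by (intro alternating_alt[OF assms(1) _ assms(3-5)]) auto
  have 1: "f (us[i := x, j := v + w]) = f (us[i := x, j := v]) + f (us[i := x, j := w])" for x
    using alternating_lin[OF assms(1) _ assms(5), of "us[i := x]" 1 v 1 w] assms(2) by simp
  have 2: "f (us[i := v + w, j := x]) = f (us[i := v, j := x]) + f (us[i := w, j := x])" for x
    using alternating_lin[OF assms(1) _ assms(4), of "us[j := x]" 1 v 1 w] assms(2) by simp
  show ?thesis using z[of "v + w"] z[of v] z[of w] unfolding 1 2 by simp
qed

lemma alternating_move:
  assumes "alternating k f" "length xs + length ys + length zs + 1 = k"
  shows "f (xs @ s # ys @ zs) = (- 1) ^ length ys * f (xs @ ys @ s # zs)"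
  using assms(2)
proof (induction ys arbitrary: xs)
  case (Cons y ys)
  have "f (xs @ s # y # ys @ zs) = - f (xs @ y # s # ys @ zs)"
    using alternating_swap[OF assms(1), of "xs @ s # y # ys @ zs" "length xs" "Suc (length xs)" s y] Cons.prems
    by (simp add: list_update_append)
  with Cons.IH[of "xs @ [y]"] Cons.prems show ?case by simp
qed simp

text \<open>The increasing map that misses i: position l of the list without entry i is position
  \<open>skip i l\<close> of the full list. It reindexes sums over shortened lists by positions in
  the full list.\<close>

definition skip :: "nat \<Rightarrow> nat \<Rightarrow> nat" where
  "skip i l = (if l < i then l else Suc l)"

section \<open>Lists with omitted entries and the signs of their rearrangements\<close>

lemma length_omit: "i < length xs \<Longrightarrow> length (omit i xs) = length xs - 1"
  by (simp add: omit_def)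

lemma set_omit: "set (omit i xs) \<subseteq> set xs"
  using set_take_subset[of i xs] set_drop_subset[of "Suc i" xs] by (auto simp: omit_def)

lemma map_omit: "map f (omit i xs) = omit i (map f xs)"
  by (simp add: omit_def take_map drop_map)

lemma nth_omit: "i < length xs \<Longrightarrow> l < length xs - 1 \<Longrightarrow> omit i xs ! l = xs ! skip i l"
  by (auto simp: omit_def skip_def nth_append min_def)

lemma omit_update_same: "omit i (xs[i := v]) = omit i xs"
  by (simp add: omit_def drop_update_cancel)

lemma omit_update:
  "i < length xs \<Longrightarrow> l < length xs - 1 \<Longrightarrow> (omit i xs)[l := v] = omit i (xs[skip i l := v])"
  by (rule nth_equalityI) (auto simp: length_omit nth_omit nth_list_update skip_def)

text \<open>The simplicial identity: after entry i is removed, the later entry m stands at position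
  m - 1.\<close>

lemma omit_omit:
  assumes "i < m" "m < length xs" shows "omit (m - 1) (omit i xs) = omit i (omit m xs)"
  using assms by (intro nth_equalityI) (auto simp: length_omit nth_omit skip_def)

lemma skip_bij: "i \<le> k \<Longrightarrow> bij_betw (skip i) {..<k} ({..<Suc k} - {i})"
  by (rule bij_betwI[where g = "\<lambda>m. if m < i then m else m - 1"]) (auto simp: skip_def split: if_splits)

text \<open>The sign of leaving out entry m, combined with that of moving a vector past the entries
  strictly between i and m, is opposite to the sign of leaving out entry i. Cancellation in
  alternating sums of shortened lists rests on this.\<close>

lemma sign_shift: "i < m \<Longrightarrow> (- 1) ^ m * (- 1) ^ (m - 1 - i) = - ((- 1 :: real) ^ i)"
proof -
  assume "i < m"
  then obtain d where "m = Suc (i + d)" using less_imp_Suc_add by blast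
  moreover have "(- 1 :: real) ^ d * (- 1) ^ d = 1" by (simp flip: power_mult_distrib)
  ultimately show ?thesis by (simp add: power_add)
qed

lemma sum_skip: "i \<le> k \<Longrightarrow> (\<Sum>l<k. h (skip i l)) = (\<Sum>m\<in>{..<Suc k} - {i}. h m)"
  by (rule sum.reindex_bij_betw[OF skip_bij])

text \<open>Both lists contain the same vectors in the same order, except that \<open>s\<close>
  stands before or after the m - 1 - i entries strictly between positions i and m.\<close>

lemma omit_move:
  assumes "alternating k f" "length vs = Suc k" "i < m" "m < Suc k"
  shows "f (omit m (vs[i := s])) = (- 1) ^ (m - 1 - i) * f (omit i (vs[m := s]))"
proof -
  define xs ys zs where "xs = take i vs" and "ys = take (m - 1 - i) (drop (Suc i) vs)" and "zs = drop (Suc m) vs"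
  have len: "length xs = i" "length ys = m - 1 - i" "length zs = k - m"
    using assms(2-4) by (simp_all add: xs_def ys_def zs_def)
  have "vs = xs @ (vs ! i) # ys @ (vs ! m) # zs"
  proof -
    have "drop (Suc i) vs = ys @ drop (m - 1 - i) (drop (Suc i) vs)"
      unfolding ys_def by (rule append_take_drop_id[symmetric])
    also have "drop (m - 1 - i) (drop (Suc i) vs) = drop m vs" using assms(3) by simp
    also have "drop m vs = (vs ! m) # zs" using assms by (simp add: zs_def Cons_nth_drop_Suc)
    finally have d: "drop (Suc i) vs = ys @ (vs ! m) # zs" .
    show ?thesis
      by (rule trans[OF id_take_nth_drop[of i vs]]) (use assms in \<open>simp_all add: d xs_def\<close>)
  qed
  then obtain a b where vs: "vs = xs @ a # ys @ b # zs" by blast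
  have "m = length xs + Suc (length ys)" using len assms(3) by simp
  then have "omit m (vs[i := s]) = xs @ s # ys @ zs" "omit i (vs[m := s]) = xs @ ys @ s # zs"
    using len(1) by (simp_all add: vs omit_def list_update_append)
  moreover have "length xs + length ys + length zs + 1 = k" using len assms by simp
  ultimately show ?thesis
    using alternating_move[OF assms(1), of xs ys zs s] len(2) by simp
qed

text \<open>Once the diagonal is filled with 0, exchanging the two summations shows that the sum
  equals its own negative.\<close>

lemma antisym_sum_zero:
  fixes T :: "nat \<Rightarrow> nat \<Rightarrow> real"
  assumes "\<And>i m. i < m \<Longrightarrow> m < n \<Longrightarrow> T i m = - T m i"
  shows "(\<Sum>i<n. \<Sum>m\<in>{..<n} - {i}. T i m) = 0"
proof -
  define U where "U i m = (if i = m then 0 else T i m)" for i m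
  have U: "U i m = - U m i" if "i < n" "m < n" for i m
    using assms[of i m] assms[of m i] that by (cases i m rule: linorder_cases) (auto simp: U_def)
  have "(\<Sum>m\<in>{..<n} - {i}. T i m) = (\<Sum>m<n. U i m)" for i
    by (intro sum.mono_neutral_cong_left) (auto simp: U_def)
  then have e: "(\<Sum>i<n. \<Sum>m\<in>{..<n} - {i}. T i m) = (\<Sum>i<n. \<Sum>m<n. U i m)" by simp
  have "(\<Sum>i<n. \<Sum>m<n. U i m) = (\<Sum>i<n. \<Sum>m<n. - U m i)"
    by (intro sum.cong refl) (simp add: U[symmetric])
  also have "\<dots> = - (\<Sum>i<n. \<Sum>m<n. U m i)" by (simp add: sum_negf)
  also have "(\<Sum>i<n. \<Sum>m<n. U m i) = (\<Sum>i<n. \<Sum>m<n. U i m)" by (rule sum.swap)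
  finally show ?thesis using e by simp
qed

text \<open>The reason why second derivatives of a coordinate change drop out: \<open>S i m\<close>
  plays the part of a symmetric second derivative that replaces entry m in the term omitting entry
  i, and exchanging i and m changes the sign.\<close>

lemma alt_sum_symmetric_zero:
  assumes "alternating k f" "length vs = Suc k" "\<And>i m. S i m = S m i"
  shows "(\<Sum>i<Suc k. (- 1) ^ i * (\<Sum>m\<in>{..<Suc k} - {i}. f (omit i (vs[m := S i m])))) = 0"
proof -
  have "(- 1) ^ i * f (omit i (vs[m := S i m])) = - ((- 1) ^ m * f (omit m (vs[i := S m i])))"
    if "i < m" "m < Suc k" for i m
    using omit_move[OF assms(1,2) that, of "S m i"] assms(3)[of i m] sign_shift[OF that(1)]
    by (simp flip: mult.assoc del: One_nat_def)
  then show ?thesis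
    unfolding sum_distrib_left by (rule antisym_sum_zero)
qed

text \<open>Serves the antisymmetrized derivative and the wedge product with a linear functional
  alike. If entries i and m coincide, every summand retaining both vanishes, and the two remaining
  ones cancel by \<open>omit_move\<close>.\<close>

lemma alternating_alt_sum:
  assumes g: "\<And>v. alternating k (g v)" "\<And>us. length us = k \<Longrightarrow> linear (\<lambda>v. g v us)"
  shows "alternating (Suc k) (\<lambda>vs. \<Sum>i<length vs. (- 1) ^ i * g (vs ! i) (omit i vs))"
  unfolding alternating_def
proof (intro conjI allI impI)
  fix us :: "'a list" and i v w a b
  assume us: "length us = Suc k" and i: "i < Suc k"
  have "(- 1) ^ j * g (us[i := a *\<^sub>R v + b *\<^sub>R w] ! j) (omit j (us[i := a *\<^sub>R v + b *\<^sub>R w])) =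
      a * ((- 1) ^ j * g (us[i := v] ! j) (omit j (us[i := v]))) +
      b * ((- 1) ^ j * g (us[i := w] ! j) (omit j (us[i := w])))" if j: "j < Suc k" for j
  proof (cases "j = i")
    case True
    have l: "linear (\<lambda>v. g v (omit i us))" using us i by (intro g(2)) (simp add: length_omit)
    show ?thesis
      using True us i by (simp add: omit_update_same linear_add[OF l] linear_scale[OF l] algebra_simps)
  next
    case False
    have "i \<in> skip j ` {..<k}"
      using skip_bij[of j k] j i False by (auto simp: bij_betw_def)
    then obtain l where l: "l < k" "i = skip j l" by auto
    have o: "omit j (us[i := x]) = (omit j us)[l := x]" for x
      using omit_update[of j us l x] us j l by simp
    have "g (us ! j) (omit j (us[i := a *\<^sub>R v + b *\<^sub>R w])) =
        a * g (us ! j) (omit j (us[i := v])) + b * g (us ! j) (omit j (us[i := w]))"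
      unfolding o using us j by (intro alternating_lin[OF g(1) _ l(1)]) (simp add: length_omit)
    then show ?thesis using False by (simp add: algebra_simps)
  qed
  then show "(\<Sum>j<length (us[i := a *\<^sub>R v + b *\<^sub>R w]). (- 1) ^ j * g (us[i := a *\<^sub>R v + b *\<^sub>R w] ! j) (omit j (us[i := a *\<^sub>R v + b *\<^sub>R w]))) =
      a * (\<Sum>j<length (us[i := v]). (- 1) ^ j * g (us[i := v] ! j) (omit j (us[i := v]))) +
      b * (\<Sum>j<length (us[i := w]). (- 1) ^ j * g (us[i := w] ! j) (omit j (us[i := w])))"
    by (simp add: us sum_distrib_left sum.distrib del: sum.lessThan_Suc)
next
  fix us :: "'a list" and i m
  assume us: "length us = Suc k" and im: "i < m" "m < Suc k" and eq: "us ! i = us ! m"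
  have z: "g v (omit j us) = 0" if j: "j < Suc k" "j \<noteq> i" "j \<noteq> m" for j v
  proof -
    have "i \<in> skip j ` {..<k}" "m \<in> skip j ` {..<k}"
      using skip_bij[of j k] j im by (auto simp: bij_betw_def)
    then obtain l l' where l: "l < k" "i = skip j l" "l' < k" "m = skip j l'" by auto
    then show ?thesis
      using us j im eq by (intro alternating_alt[OF g(1), of "omit j us" l l']) (auto simp: length_omit nth_omit)
  qed
  have "(\<Sum>j<length us. (- 1) ^ j * g (us ! j) (omit j us)) = (\<Sum>j\<in>{i, m}. (- 1) ^ j * g (us ! j) (omit j us))"
    using im z us by (intro sum.mono_neutral_right) auto
  also have "\<dots> = (- 1) ^ i * g (us ! i) (omit i us) + (- 1) ^ m * g (us ! i) (omit m us)"
    using im eq by simp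
  also have "g (us ! i) (omit m us) = (- 1) ^ (m - 1 - i) * g (us ! i) (omit i us)"
    using omit_move[OF g(1) us im, of "us ! i" "us ! i"] eq by (simp add: list_update_id) (metis list_update_id)
  also have "(- 1 :: real) ^ m * ((- 1) ^ (m - 1 - i) * g (us ! i) (omit i us)) = - ((- 1) ^ i * g (us ! i) (omit i us))"
    using sign_shift[OF im(1)] by (simp flip: mult.assoc del: One_nat_def)
  finally show "(\<Sum>j<length us. (- 1) ^ j * g (us ! j) (omit j us)) = 0" by simp
qed

section \<open>Vanishing of wedge products with a linear functional\<close>

lemma alternating_scale: "alternating k f \<Longrightarrow> alternating k (\<lambda>us. c * f us)"
  unfolding alternating_def by (simp add: algebra_simps)

lemma alternating_diff: "alternating k f \<Longrightarrow> alternating k g \<Longrightarrow> alternating k (\<lambda>us. f us - g us)"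
  unfolding alternating_def by (simp add: algebra_simps)

text \<open>Column elimination: with two entries outside the kernel of T, subtracting a multiple of
  one from the other leaves the value of f unchanged and lowers the number of such entries. The
  process ends at tuples with at most one entry outside the kernel.\<close>

lemma alternating_zeroI:
  assumes f: "alternating k f" and T: "linear (T :: 'a::real_vector \<Rightarrow> real)"
    and z: "\<And>us. length us = k \<Longrightarrow> (\<exists>m<k. \<forall>i<k. i \<noteq> m \<longrightarrow> T (us ! i) = 0) \<Longrightarrow> f us = 0"
    and k: "k > 0" and us: "length us = k"
  shows "f us = 0"
  using us
proof (induction "card {i. i < k \<and> T (us ! i) \<noteq> 0}" arbitrary: us rule: less_induct)
  case less
  show ?case
  proof (cases "\<exists>m<k. \<forall>i<k. i \<noteq> m \<longrightarrow> T (us ! i) = 0")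
    case True
    then show ?thesis by (rule z[OF less.prems])
  next
    case False
    with k obtain m where m: "m < k" "T (us ! m) \<noteq> 0" by auto
    with False obtain i where i: "i < k" "i \<noteq> m" "T (us ! i) \<noteq> 0" by blast
    define r where "r = T (us ! i) / T (us ! m)"
    define v where "v = us ! i - r *\<^sub>R (us ! m)"
    have Tv: "T v = 0" using m by (simp add: v_def r_def linear_diff[OF T] linear_scale[OF T])
    have "f (us[i := 1 *\<^sub>R v + r *\<^sub>R (us ! m)]) = 1 * f (us[i := v]) + r * f (us[i := us ! m])"
      by (rule alternating_lin[OF f less.prems i(1)])
    moreover have "us[i := 1 *\<^sub>R v + r *\<^sub>R (us ! m)] = us" by (simp add: v_def)
    moreover have "f (us[i := us ! m]) = 0"
      using i m less.prems by (intro alternating_alt[OF f, of _ i m]) auto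
    moreover have "f (us[i := v]) = 0"
    proof (rule less.hyps)
      have "{j. j < k \<and> T (us[i := v] ! j) \<noteq> 0} \<subset> {j. j < k \<and> T (us ! j) \<noteq> 0}"
        using i Tv less.prems by (auto simp: nth_list_update)
      then show "card {j. j < k \<and> T (us[i := v] ! j) \<noteq> 0} < card {j. j < k \<and> T (us ! j) \<noteq> 0}"
        by (intro psubset_card_mono) auto
    qed (simp add: less.prems)
    ultimately show ?thesis by simp
  qed
qed

text \<open>The product is itself alternating, so by \<open>alternating_zeroI\<close> only tuples
  with at most one entry m outside the kernel matter: the summand omitting m has a zero factor f,
  and every other summand has a zero factor T.\<close>

lemma wedge_zeroI:
  assumes f: "alternating k f" and T: "linear (T :: 'a::real_vector \<Rightarrow> real)"
    and z: "\<And>us. length us = k \<Longrightarrow> (\<forall>u\<in>set us. T u = 0) \<Longrightarrow> f us = 0"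
    and vs: "length vs = Suc k"
  shows "(\<Sum>i<Suc k. (- 1) ^ (k - i) * f (omit i vs) * T (vs ! i)) = 0"
proof -
  define h where "h vs = (\<Sum>i<length vs. (- 1) ^ i * (\<lambda>v us. T v * f us) (vs ! i) (omit i vs))" for vs
  have h: "alternating (Suc k) h"
    unfolding h_def by (intro alternating_alt_sum alternating_scale f) (auto intro!: linearI simp: linear_add[OF T] linear_scale[OF T] algebra_simps)
  have "h vs = 0"
  proof (rule alternating_zeroI[OF h T _ _ vs])
    fix us :: "'a list" assume us: "length us = Suc k"
    assume "\<exists>m<Suc k. \<forall>i<Suc k. i \<noteq> m \<longrightarrow> T (us ! i) = 0"
    then obtain m where m: "m < Suc k" "\<And>i. i < Suc k \<Longrightarrow> i \<noteq> m \<Longrightarrow> T (us ! i) = 0" by blast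
    have "f (omit m us) = 0"
    proof (rule z)
      show "\<forall>u\<in>set (omit m us). T u = 0"
        using us m(1) by (auto simp: in_set_conv_nth length_omit nth_omit intro!: m(2)) (auto simp: skip_def split: if_splits)
    qed (use us m in \<open>simp add: length_omit\<close>)
    then have "(- 1) ^ i * (T (us ! i) * f (omit i us)) = 0" if "i < Suc k" for i
      using m(2)[OF that] by (cases "i = m") auto
    then show "h us = 0" unfolding h_def us by (intro sum.neutral) auto
  qed simp
  \<comment> \<open>Here the functional stands last, as in \<open>wedge_1form\<close>, while in
    \<open>h\<close> it stands first; moving it across k slots gives the global sign.\<close>
  moreover have "(\<Sum>i<Suc k. (- 1) ^ (k - i) * f (omit i vs) * T (vs ! i)) = (- 1) ^ k * h vs"
  proof -
    have "(- 1 :: real) ^ (k - i) = (- 1) ^ k * (- 1) ^ i" if "i < Suc k" for i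
    proof -
      obtain d where "k = i + d" using \<open>i < Suc k\<close> le_Suc_ex[of i k] by (auto simp: less_Suc_eq_le)
      moreover have "(- 1 :: real) ^ i * (- 1) ^ i = 1" by (simp flip: power_mult_distrib)
      ultimately show ?thesis by (simp add: power_add)
    qed
    then show ?thesis
      unfolding h_def vs sum_distrib_left by (intro sum.cong) (auto simp: algebra_simps)
  qed
  ultimately show ?thesis by simp
qed

section \<open>Local forms and their antisymmetrized derivatives\<close>

definition local_form ::
  "nat \<Rightarrow> 'a::real_normed_vector set \<Rightarrow> ('a \<Rightarrow> 'e::real_vector list \<Rightarrow> real) \<Rightarrow> bool" where
  "local_form k S F \<longleftrightarrow> (\<forall>z\<in>S. alternating k (F z)) \<and> (\<forall>us. length us = k \<longrightarrow> smooth_on (\<lambda>z. F z us) S)"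

text \<open>For P the identity this is the exterior derivative, evaluated at constant vector fields;
  for P = \<open>vert\<close> it will be d_J on the kernel of dt. For linear P it is the derivation
  i_P d - d i_P of the constant endomorphism P.\<close>

definition d_along :: "('e \<Rightarrow> 'e) \<Rightarrow> ('e::real_normed_vector \<Rightarrow> 'e list \<Rightarrow> real) \<Rightarrow> 'e \<Rightarrow> 'e list \<Rightarrow> real" where
  "d_along P F z vs = (\<Sum>i<length vs. (- 1) ^ i * FD (\<lambda>z. F z (omit i vs)) z (P (vs ! i)))"

definition i_along :: "('e \<Rightarrow> 'e) \<Rightarrow> ('e list \<Rightarrow> real) \<Rightarrow> 'e list \<Rightarrow> real" where
  "i_along P f us = (\<Sum>l<length us. f (us[l := P (us ! l)]))"

lemma cformD: "local_form k S F \<Longrightarrow> z \<in> S \<Longrightarrow> alternating k (F z)"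
  "local_form k S F \<Longrightarrow> length us = k \<Longrightarrow> smooth_on (\<lambda>z. F z us) S"
  by (auto simp: local_form_def)

lemma local_form_FD:
  assumes "open S" "local_form k S F" "z \<in> S"
  shows "alternating k (\<lambda>us. FD (\<lambda>z. F z us) z v)"
  unfolding alternating_def
proof (intro conjI allI impI)
  fix us :: "'b list" and i x w and a b :: real
  assume us: "length us = k" and i: "i < k"
  have D: "((\<lambda>z. F z (us[i := y])) has_derivative FD (\<lambda>z. F z (us[i := y])) z) (at z)" for y
    using us by (intro smooth_on_FDERIV[OF cformD(2)[OF assms(2)] assms(3)]) simp
  have "FD (\<lambda>z. F z (us[i := a *\<^sub>R x + b *\<^sub>R w])) z = FD (\<lambda>z. a * F z (us[i := x]) + b * F z (us[i := w])) z"
    by (rule FD_cong_open[OF assms(1,3)]) (rule alternating_lin[OF cformD(1)[OF assms(2)] us i])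
  also have "\<dots> = (\<lambda>v. a * FD (\<lambda>z. F z (us[i := x])) z v + b * FD (\<lambda>z. F z (us[i := w])) z v)"
    by (intro FD_eqI has_derivative_add has_derivative_mult_right D)
  finally show "FD (\<lambda>z. F z (us[i := a *\<^sub>R x + b *\<^sub>R w])) z v =
      a * FD (\<lambda>z. F z (us[i := x])) z v + b * FD (\<lambda>z. F z (us[i := w])) z v" by simp
next
  fix us :: "'b list" and i j
  assume us: "length us = k" and ij: "i < j" "j < k" "us ! i = us ! j"
  have "FD (\<lambda>z. F z us) z = FD (\<lambda>z. 0) z"
    by (rule FD_cong_open[OF assms(1,3)])
      (rule alternating_alt[OF cformD(1)[OF assms(2)] us, of _ i j], use ij in auto)
  then show "FD (\<lambda>z. F z us) z v = 0" by simp
qed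

lemma local_form_d_along:
  assumes "open S" "local_form k S F" "linear P"
  shows "local_form (Suc k) S (d_along P F)"
  unfolding local_form_def
proof (intro conjI ballI allI impI)
  fix z assume z: "z \<in> S"
  show "alternating (Suc k) (d_along P F z)"
    unfolding d_along_def
  proof (rule alternating_alt_sum)
    show "alternating k (\<lambda>us. FD (\<lambda>z. F z us) z (P v))" for v by (rule local_form_FD[OF assms(1,2) z])
    show "linear (\<lambda>v. FD (\<lambda>z. F z us) z (P v))" if "length us = k" for us
      using linear_compose[OF assms(3) linear_FD[OF cformD(2)[OF assms(2) that] z]] by (simp add: o_def)
  qed
next
  fix us :: "'a list" assume "length us = Suc k"
  then show "smooth_on (\<lambda>z. d_along P F z us) S"
    unfolding d_along_def
    by (intro smooth_on_sum smooth_on_mult smooth_on_const smooth_on_FD cformD(2)[OF assms(2)] assms(1))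
      (auto simp: length_omit)
qed

text \<open>The derivative sees F only at the shortened lists of the given tuple. Hence forms that
  agree merely on the kernel of dt may be exchanged as long as the tuple lies in that
  kernel.\<close>

lemma d_along_cong:
  assumes "open S" "z \<in> S" "\<And>y i. y \<in> S \<Longrightarrow> i < length vs \<Longrightarrow> F y (omit i vs) = G y (omit i vs)"
  shows "d_along P F z vs = d_along P G z vs"
  unfolding d_along_def by (intro sum.cong refl arg_cong2[where f = "(*)"] fun_cong[OF FD_cong_open[OF assms(1,2)]] assms(3)) auto

text \<open>For coinciding entries i and m the summands with P in a third slot vanish, and those
  with P in slot i or m differ by a transposition.\<close>

lemma alternating_i_along:
  assumes f: "alternating k f" and P: "linear P" shows "alternating k (i_along P f)"
  unfolding alternating_def
proof (intro conjI allI impI)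
  fix us :: "'a list" and i v w a b
  assume us: "length us = k" and i: "i < k"
  have "f (us[i := a *\<^sub>R v + b *\<^sub>R w, l := P (us[i := a *\<^sub>R v + b *\<^sub>R w] ! l)]) =
      a * f (us[i := v, l := P (us[i := v] ! l)]) + b * f (us[i := w, l := P (us[i := w] ! l)])"
    if l: "l < k" for l
  proof (cases "l = i")
    case True
    then show ?thesis
      using us i alternating_lin[OF f us i, of a "P v" b "P w"] by (simp add: linear_add[OF P] linear_scale[OF P])
  next
    case False
    then show ?thesis
      using us i alternating_lin[OF f _ i, of "us[l := P (us ! l)]" a v b w] by (simp add: list_update_swap)
  qed
  then show "i_along P f (us[i := a *\<^sub>R v + b *\<^sub>R w]) = a * i_along P f (us[i := v]) + b * i_along P f (us[i := w])"
    by (simp add: i_along_def us sum_distrib_left sum.distrib)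
next
  fix us :: "'a list" and i m
  assume us: "length us = k" and im: "i < m" "m < k" and eq: "us ! i = us ! m"
  have z: "f (us[l := P (us ! l)]) = 0" if l: "l < k" "l \<noteq> i" "l \<noteq> m" for l
    using us im eq l by (intro alternating_alt[OF f, of _ i m]) auto
  have "i_along P f us = (\<Sum>l\<in>{i, m}. f (us[l := P (us ! l)]))"
    unfolding i_along_def using im z us by (intro sum.mono_neutral_right) auto
  also have "\<dots> = f (us[i := P (us ! i)]) + f (us[m := P (us ! i)])" using im eq by simp
  also have "us[i := P (us ! i)] = us[i := P (us ! i), m := us ! i]" using im eq by (metis list_update_id nat_neq_iff nth_list_update_neq)
  also have "us[m := P (us ! i)] = us[i := us ! i, m := P (us ! i)]" by simp
  finally show "i_along P f us = 0"
    using alternating_swap[OF f us, of i m "us ! i" "P (us ! i)"] im by simp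
qed

lemma slots_expand:
  fixes F :: "'e::fin_dim_inner list \<Rightarrow> real"
  assumes "alternating k F" "length xs + length us + 1 = k"
  shows "F (xs @ v # us) = (\<Sum>b\<in>onb. (v \<bullet> b) * F (xs @ b # us))"
  using alternating_expand[OF assms(1), of "xs @ v # us" "length xs" v] assms(2)
  by (simp add: list_update_append)

text \<open>Multilinearity turns arguments that move with z into scalar coefficients. The moving
  slots form an initial segment and are expanded from its end, so that each basis vector joins the
  constant tail \<open>us\<close>.\<close>

lemma smooth_on_slots:
  fixes F :: "'a::real_normed_vector \<Rightarrow> 'e::fin_dim_inner list \<Rightarrow> real"
  assumes S: "open S" and F: "local_form k S F"
    and len: "length hs + length us = k" and hs: "\<And>h. h \<in> set hs \<Longrightarrow> smooth_on h S"
  shows "smooth_on (\<lambda>z. F z (map (\<lambda>h. h z) hs @ us)) S"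
  using len hs
proof (induction hs arbitrary: us rule: rev_induct)
  case Nil
  then show ?case using cformD(2)[OF F] by simp
next
  case (snoc h hs)
  have sm: "smooth_on (\<lambda>z. \<Sum>b\<in>onb. (h z \<bullet> b) * F z (map (\<lambda>h. h z) hs @ b # us)) S"
    using snoc.prems
    by (intro smooth_on_sum[OF S] smooth_on_mult[OF S] snoc.IH
        smooth_on_linear_compose[OF S bounded_linear_inner_left]) auto
  have "F z (map (\<lambda>h. h z) (hs @ [h]) @ us) = (\<Sum>b\<in>onb. (h z \<bullet> b) * F z (map (\<lambda>h. h z) hs @ b # us))"
    if "z \<in> S" for z
    using slots_expand[OF cformD(1)[OF F that], of "map (\<lambda>h. h z) hs" us "h z"] snoc.prems(1) by simp
  then show ?case by (intro smooth_on_cong[OF S _ sm]) simp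
qed

text \<open>The product rule applied to the expansion of the last moving slot; summing over
  \<open>onb\<close> reassembles one term for the coefficients of F and one for each slot.\<close>

lemma has_derivative_slots:
  fixes F :: "'a::real_normed_vector \<Rightarrow> 'e::fin_dim_inner list \<Rightarrow> real"
  assumes S: "open S" and F: "local_form k S F" and x: "x \<in> S"
    and len: "length hs + length us = k" and hs: "\<And>h. h \<in> set hs \<Longrightarrow> smooth_on h S"
  shows "((\<lambda>z. F z (map (\<lambda>h. h z) hs @ us)) has_derivative
    (\<lambda>w. FD (\<lambda>z. F z (map (\<lambda>h. h x) hs @ us)) x w +
      (\<Sum>l<length hs. F x ((map (\<lambda>h. h x) hs @ us)[l := FD (hs ! l) x w])))) (at x)"
  using len hs
proof (induction hs arbitrary: us rule: rev_induct)
  case Nil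
  then show ?case using smooth_on_FDERIV[OF cformD(2)[OF F] x] by simp
next
  case (snoc h hs)
  define L where "L = length hs"
  define ys where "ys = map (\<lambda>h. h x) hs"
  have Lys: "length ys = L" by (simp add: ys_def L_def)
  have k: "L + length us + 1 = k" using snoc.prems(1) by (simp add: L_def)
  define E where "E b w = FD (\<lambda>z. F z (ys @ b # us)) x w +
      (\<Sum>l<L. F x ((ys @ b # us)[l := FD (hs ! l) x w]))" for b w
  have IH: "((\<lambda>z. F z (map (\<lambda>h. h z) hs @ b # us)) has_derivative E b) (at x)" for b
    unfolding E_def ys_def L_def using snoc.prems by (intro snoc.IH) auto
  have h: "((\<lambda>z. h z \<bullet> b) has_derivative (\<lambda>w. FD h x w \<bullet> b)) (at x)" for b
    using snoc.prems(2)
    by (intro bounded_linear.has_derivative[OF bounded_linear_inner_left] smooth_on_FDERIV[OF _ x]) auto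
  have D: "((\<lambda>z. \<Sum>b\<in>onb. (h z \<bullet> b) * F z (map (\<lambda>h. h z) hs @ b # us)) has_derivative
      (\<lambda>w. \<Sum>b\<in>onb. (h x \<bullet> b) * E b w + (FD h x w \<bullet> b) * F x (ys @ b # us))) (at x)"
    unfolding ys_def by (intro has_derivative_sum has_derivative_mult h IH)
  have eq: "F z (map (\<lambda>h. h z) (hs @ [h]) @ us) = (\<Sum>b\<in>onb. (h z \<bullet> b) * F z (map (\<lambda>h. h z) hs @ b # us))"
    if "z \<in> S" for z
    using slots_expand[OF cformD(1)[OF F that], of "map (\<lambda>h. h z) hs" us "h z"] k by (simp add: L_def)
  have "(\<Sum>b\<in>onb. (h x \<bullet> b) * E b w + (FD h x w \<bullet> b) * F x (ys @ b # us)) =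
      FD (\<lambda>z. F z (ys @ h x # us)) x w +
      (\<Sum>l<L. F x ((ys @ h x # us)[l := FD (hs ! l) x w])) + F x (ys @ FD h x w # us)" for w
  proof -
    have "(\<Sum>b\<in>onb. (FD h x w \<bullet> b) * F x (ys @ b # us)) = F x (ys @ FD h x w # us)"
      using slots_expand[OF cformD(1)[OF F x], of ys us "FD h x w"] k Lys by simp
    moreover have "(\<Sum>b\<in>onb. (h x \<bullet> b) * FD (\<lambda>z. F z (ys @ b # us)) x w) = FD (\<lambda>z. F z (ys @ h x # us)) x w"
      using slots_expand[OF local_form_FD[OF S F x], of ys us "h x" w] k Lys by simp
    moreover have "(\<Sum>b\<in>onb. (h x \<bullet> b) * F x ((ys @ b # us)[l := FD (hs ! l) x w])) =
        F x ((ys @ h x # us)[l := FD (hs ! l) x w])" if "l < L" for l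
      using slots_expand[OF cformD(1)[OF F x], of "ys[l := FD (hs ! l) x w]" us "h x"] k Lys that
      by (simp add: list_update_append)
    ultimately show ?thesis
      by (simp add: E_def sum.distrib distrib_left sum_distrib_left sum.swap[of _ "{..<L}" onb])
  qed
  moreover have "FD (\<lambda>z. F z (map (\<lambda>h. h x) (hs @ [h]) @ us)) x w +
      (\<Sum>l<length (hs @ [h]). F x ((map (\<lambda>h. h x) (hs @ [h]) @ us)[l := FD ((hs @ [h]) ! l) x w])) =
      FD (\<lambda>z. F z (ys @ h x # us)) x w +
      (\<Sum>l<L. F x ((ys @ h x # us)[l := FD (hs ! l) x w])) + F x (ys @ FD h x w # us)" for w
    using Lys by (simp add: nth_append list_update_append flip: ys_def L_def)
  ultimately show ?case
    using has_derivative_transform_within_open[OF D S x] eq by simp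
qed

lemma local_form_compose:
  fixes G :: "'b::fin_dim_inner \<Rightarrow> 'e::real_vector list \<Rightarrow> real"
  assumes "open S" "open T" "smooth_on \<Phi> S" "\<Phi> ` S \<subseteq> T" "local_form k T G"
  shows "local_form k S (\<lambda>z. G (\<Phi> z))"
  using assms(4) smooth_on_compose[OF assms(1,2,3) cformD(2)[OF assms(5)] assms(4)] cformD(1)[OF assms(5)]
  by (auto simp: local_form_def)

text \<open>
  Antisymmetrized derivatives along \<open>P\<close> are natural under a map \<open>\<Phi>\<close> whose differential commutes with
  \<open>P\<close>: the second derivatives of \<open>\<Phi>\<close> enter through \<open>D\<^sup>2\<Phi>(P v, w) = P D\<^sup>2\<Phi>(v, w)\<close>, which is symmetric.
\<close>

lemma d_along_pullback:
  fixes \<Phi> :: "'e::fin_dim_inner \<Rightarrow> 'e"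
  assumes S: "open S" and T: "open T" and \<Phi>: "smooth_on \<Phi> S" "\<Phi> ` S \<subseteq> T" and G: "local_form k T G"
    and F: "\<And>z us. z \<in> S \<Longrightarrow> length us = k \<Longrightarrow> set us \<subseteq> K \<Longrightarrow> F z us = G (\<Phi> z) (map (FD \<Phi> z) us)"
    and P: "linear P" and comm: "\<And>z v. z \<in> S \<Longrightarrow> v \<in> K \<Longrightarrow> FD \<Phi> z (P v) = P (FD \<Phi> z v)"
    and x: "x \<in> S" and vs: "length vs = Suc k" "set vs \<subseteq> K"
  shows "d_along P F x vs = d_along P G (\<Phi> x) (map (FD \<Phi> x) vs)"
proof -
  define ws where "ws = map (FD \<Phi> x) vs"
  define D2 where "D2 v w = FD (\<lambda>z. FD \<Phi> z v) x w" for v w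
  have D2c: "D2 v w = D2 w v" for v w
    unfolding D2_def by (rule FD_FD_commute[OF S \<Phi>(1) x])
  \<comment> \<open>Differentiate the commutation relation at fixed v; it holds on all of S, and the
    bounded linear map P passes through the derivative.\<close>
  have D2P: "D2 w (P v) = P (D2 v w)" if "v \<in> K" for v w
  proof -
    have "D2 (P v) w = FD (\<lambda>z. P (FD \<Phi> z v)) x w"
      unfolding D2_def by (rule fun_cong[OF FD_cong_open[OF S x]]) (rule comm[OF _ that])
    also have "\<dots> = P (D2 v w)"
      unfolding D2_def
      by (rule fun_cong[OF FD_eqI[OF bounded_linear.has_derivative[OF linear_imp_bounded[OF P]
                smooth_on_FDERIV[OF smooth_on_FD[OF \<Phi>(1)] x]]]])
    finally show ?thesis using D2c by simp
  qed
  have vK: "vs ! i \<in> K" if "i < Suc k" for i using vs that by auto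
  \<comment> \<open>The vector that the product rule puts into slot m when the derivative is taken
    along P v_i. It is 0 out of range because \<open>alt_sum_symmetric_zero\<close> asks for
    symmetry in all pairs of indices.\<close>
  define X where "X i m = (if i < Suc k \<and> m < Suc k then D2 (vs ! m) (P (vs ! i)) else 0)" for i m
  have X: "X i m = X m i" for i m
    using D2P vK D2c by (simp add: X_def)
  have G': "local_form k S (\<lambda>z. G (\<Phi> z))" by (rule local_form_compose[OF S T \<Phi> G])
  have term_eq: "FD (\<lambda>z. F z (omit i vs)) x (P (vs ! i)) = FD (\<lambda>y. G y (omit i ws)) (\<Phi> x) (P (ws ! i)) +
      (\<Sum>m\<in>{..<Suc k} - {i}. G (\<Phi> x) (omit i (ws[m := X i m])))" if i: "i < Suc k" for i
  proof -
    define us where "us = omit i vs"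
    have us: "length us = k" "set us \<subseteq> K"
      using vs i set_omit[of i vs] by (auto simp: us_def length_omit)
    define hs where "hs = map (\<lambda>u z. FD \<Phi> z u) us"
    have hs: "map (\<lambda>h. h z) hs = map (FD \<Phi> z) us" for z by (simp add: hs_def)
    have ows: "map (FD \<Phi> x) us = omit i ws" by (simp add: us_def ws_def map_omit)
    have "FD (\<lambda>z. F z us) x = FD (\<lambda>z. G (\<Phi> z) (map (\<lambda>h. h z) hs @ [])) x"
      by (rule FD_cong_open[OF S x]) (simp add: F us hs)
    also have "\<dots> = (\<lambda>w. FD (\<lambda>z. G (\<Phi> z) (map (\<lambda>h. h x) hs @ [])) x w +
      (\<Sum>l<length hs. G (\<Phi> x) ((map (\<lambda>h. h x) hs @ [])[l := FD (hs ! l) x w])))"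
      by (rule FD_eqI, rule has_derivative_slots[OF S G' x])
        (auto simp: hs_def us intro: smooth_on_FD[OF \<Phi>(1)])
    also have "\<dots> = (\<lambda>w. FD (\<lambda>z. G (\<Phi> z) (omit i ws)) x w +
      (\<Sum>l<k. G (\<Phi> x) ((omit i ws)[l := D2 (us ! l) w])))"
      unfolding hs by (simp add: ows hs_def us D2_def)
    finally have "FD (\<lambda>z. F z us) x (P (vs ! i)) = FD (\<lambda>z. G (\<Phi> z) (omit i ws)) x (P (vs ! i)) +
      (\<Sum>l<k. G (\<Phi> x) ((omit i ws)[l := D2 (us ! l) (P (vs ! i))]))" by simp
    also have "FD (\<lambda>z. G (\<Phi> z) (omit i ws)) x (P (vs ! i)) = FD (\<lambda>y. G y (omit i ws)) (\<Phi> x) (FD \<Phi> x (P (vs ! i)))"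
      using \<Phi>(2) x i vs
      by (intro FD_chain[OF \<Phi>(1) x cformD(2)[OF G]]) (auto simp: length_omit ws_def)
    also have "FD \<Phi> x (P (vs ! i)) = P (ws ! i)" using comm[OF x vK[OF i]] i vs by (simp add: ws_def)
    also have "(\<Sum>l<k. G (\<Phi> x) ((omit i ws)[l := D2 (us ! l) (P (vs ! i))])) =
        (\<Sum>l<k. G (\<Phi> x) (omit i (ws[skip i l := X i (skip i l)])))"
    proof (intro sum.cong refl)
      fix l assume "l \<in> {..<k}"
      then have l: "l < k" by simp
      then have "skip i l < Suc k" "us ! l = vs ! skip i l"
        using i vs by (auto simp: skip_def us_def nth_omit)
      then show "G (\<Phi> x) ((omit i ws)[l := D2 (us ! l) (P (vs ! i))]) = G (\<Phi> x) (omit i (ws[skip i l := X i (skip i l)]))"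
        using omit_update[of i ws l] i l vs by (simp add: X_def ws_def)
    qed
    also have "\<dots> = (\<Sum>m\<in>{..<Suc k} - {i}. G (\<Phi> x) (omit i (ws[m := X i m])))"
      using i by (intro sum_skip) simp
    finally show ?thesis by (simp add: us_def)
  qed
  have "d_along P F x vs = (\<Sum>i<Suc k. (- 1) ^ i * FD (\<lambda>y. G y (omit i ws)) (\<Phi> x) (P (ws ! i))) +
      (\<Sum>i<Suc k. (- 1) ^ i * (\<Sum>m\<in>{..<Suc k} - {i}. G (\<Phi> x) (omit i (ws[m := X i m]))))"
    unfolding d_along_def vs sum.distrib[symmetric]
    by (intro sum.cong refl) (simp add: term_eq distrib_left)
  also have "(\<Sum>i<Suc k. (- 1) ^ i * (\<Sum>m\<in>{..<Suc k} - {i}. G (\<Phi> x) (omit i (ws[m := X i m])))) = 0"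
    using \<Phi>(2) x vs by (intro alt_sum_symmetric_zero cformD(1)[OF G] X) (auto simp: ws_def)
  finally show ?thesis by (simp add: d_along_def ws_def vs)
qed

text \<open>As for d d = 0: leaving out entries i and m in either order gives the same list with
  opposite signs, and derivatives along the constant vectors P v_i and P v_m commute.\<close>

lemma d_along_d_along_zero:
  fixes F :: "'e::fin_dim_inner \<Rightarrow> 'e list \<Rightarrow> real"
  assumes S: "open S" and F: "local_form k S F" and x: "x \<in> S" and vs: "length vs = Suc (Suc k)"
  shows "d_along P (d_along P F) x vs = 0"
proof -
  \<comment> \<open>Indexed by positions in the full list: once entry i is gone, entry m stands at m
    or at m - 1.\<close>
  define T where "T i m = (- 1) ^ i * ((- 1) ^ (if m < i then m else m - 1) *
      FD (\<lambda>z. FD (\<lambda>z. F z (omit (if m < i then m else m - 1) (omit i vs))) z (P (vs ! m))) x (P (vs ! i)))" for i m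
  have sm: "smooth_on (\<lambda>z. FD (\<lambda>z. F z (omit l (omit i vs))) z v) S" if "i < Suc (Suc k)" "l < Suc k" for i l v
    using that vs by (intro smooth_on_FD cformD(2)[OF F]) (simp add: length_omit)
  have inner_eq: "(- 1) ^ i * FD (\<lambda>z. d_along P F z (omit i vs)) x (P (vs ! i)) = (\<Sum>m\<in>{..<Suc (Suc k)} - {i}. T i m)"
    if i: "i < Suc (Suc k)" for i
  proof -
    have lo: "length (omit i vs) = Suc k" using i vs by (simp add: length_omit)
    have "((\<lambda>z. d_along P F z (omit i vs)) has_derivative (\<lambda>w. \<Sum>l<Suc k. (- 1) ^ l *
        FD (\<lambda>z. FD (\<lambda>z. F z (omit l (omit i vs))) z (P (omit i vs ! l))) x w)) (at x)"
      unfolding d_along_def lo using i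
      by (intro has_derivative_sum has_derivative_mult_right smooth_on_FDERIV[OF sm x]) auto
    then have "FD (\<lambda>z. d_along P F z (omit i vs)) x (P (vs ! i)) = (\<Sum>l<Suc k. (- 1) ^ l *
        FD (\<lambda>z. FD (\<lambda>z. F z (omit l (omit i vs))) z (P (omit i vs ! l))) x (P (vs ! i)))"
      by (simp only: FD_eqI)
    also have "(- 1) ^ i * \<dots> = (\<Sum>l<Suc k. T i (skip i l))"
      unfolding sum_distrib_left
      by (intro sum.cong refl) (use i vs in \<open>auto simp: T_def nth_omit skip_def\<close>)
    also have "\<dots> = (\<Sum>m\<in>{..<Suc (Suc k)} - {i}. T i m)"
      using i by (intro sum_skip) simp
    finally show ?thesis .
  qed
  have "T i m = - T m i" if im: "i < m" "m < Suc (Suc k)" for i m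
  proof -
    have o: "omit (m - 1) (omit i vs) = omit i (omit m vs)" using im vs by (intro omit_omit) auto
    have sgn: "(- 1 :: real) ^ m = - ((- 1) ^ (m - 1))" using im by (cases m) auto
    have "FD (\<lambda>z. FD (\<lambda>z. F z (omit i (omit m vs))) z (P (vs ! m))) x (P (vs ! i)) =
        FD (\<lambda>z. FD (\<lambda>z. F z (omit i (omit m vs))) z (P (vs ! i))) x (P (vs ! m))"
      using im vs by (intro FD_FD_commute[OF S _ x] cformD(2)[OF F]) (simp add: length_omit)
    then show ?thesis using im by (simp add: T_def o sgn del: One_nat_def)
  qed
  then have "(\<Sum>i<Suc (Suc k). \<Sum>m\<in>{..<Suc (Suc k)} - {i}. T i m) = 0" by (rule antisym_sum_zero)
  moreover have "d_along P (d_along P F) x vs = (\<Sum>i<Suc (Suc k). \<Sum>m\<in>{..<Suc (Suc k)} - {i}. T i m)"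
    unfolding d_along_def[of P "d_along P F"] vs by (intro sum.cong refl inner_eq) simp
  ultimately show ?thesis by simp
qed

text \<open>In i_P d the vector hit by P is either the direction of differentiation or an argument
  of F. The terms of the second kind are exactly those of d i_P, since P does not depend on the
  point; those of the first kind make up \<open>d_along P\<close>.\<close>

lemma commutator_eq_d_along:
  fixes F :: "'e::fin_dim_inner \<Rightarrow> 'e list \<Rightarrow> real"
  assumes S: "open S" and F: "local_form k S F" and x: "x \<in> S" and vs: "length vs = Suc k"
  shows "i_along P (d_along (\<lambda>v. v) F x) vs - d_along (\<lambda>v. v) (\<lambda>z. i_along P (F z)) x vs = d_along P F x vs"
proof -
  define T where "T m i = (- 1) ^ m * FD (\<lambda>z. F z (omit m (vs[i := P (vs ! i)]))) x (vs ! m)" for m i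
  have "d_along (\<lambda>v. v) F x (vs[i := P (vs ! i)]) =
      (- 1) ^ i * FD (\<lambda>z. F z (omit i vs)) x (P (vs ! i)) + (\<Sum>m\<in>{..<Suc k} - {i}. T m i)"
    if i: "i < Suc k" for i
    unfolding d_along_def using i vs
    by (simp add: sum.remove[of "{..<Suc k}" i] omit_update_same T_def del: sum.lessThan_Suc)
  then have "i_along P (d_along (\<lambda>v. v) F x) vs = d_along P F x vs + (\<Sum>i<Suc k. \<Sum>m\<in>{..<Suc k} - {i}. T m i)"
    unfolding i_along_def by (simp add: vs sum.distrib d_along_def del: sum.lessThan_Suc)
  moreover have "d_along (\<lambda>v. v) (\<lambda>z. i_along P (F z)) x vs = (\<Sum>m<Suc k. \<Sum>i\<in>{..<Suc k} - {m}. T m i)"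
    unfolding d_along_def vs
  proof (intro sum.cong refl)
    fix m assume "m \<in> {..<Suc k}"
    then have m: "m < Suc k" by simp
    have lo: "length (omit m vs) = k" using m vs by (simp add: length_omit)
    have "((\<lambda>z. i_along P (F z) (omit m vs)) has_derivative
        (\<lambda>w. \<Sum>l<k. FD (\<lambda>z. F z ((omit m vs)[l := P (omit m vs ! l)])) x w)) (at x)"
      unfolding i_along_def lo
      by (intro has_derivative_sum smooth_on_FDERIV[OF cformD(2)[OF F] x]) (simp add: lo)
    then have "FD (\<lambda>z. i_along P (F z) (omit m vs)) x (vs ! m) =
        (\<Sum>l<k. FD (\<lambda>z. F z ((omit m vs)[l := P (omit m vs ! l)])) x (vs ! m))"
      by (simp only: FD_eqI)
    also have "(- 1) ^ m * \<dots> = (\<Sum>l<k. T m (skip m l))"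
      unfolding sum_distrib_left
      by (intro sum.cong refl) (use m vs in \<open>simp add: T_def nth_omit omit_update\<close>)
    also have "\<dots> = (\<Sum>i\<in>{..<Suc k} - {m}. T m i)"
      using m by (intro sum_skip) simp
    finally show "(- 1) ^ m * FD (\<lambda>z. i_along P (F z) (omit m vs)) x (vs ! m) = (\<Sum>i\<in>{..<Suc k} - {m}. T m i)" .
  qed
  moreover have "(\<Sum>i<Suc k. \<Sum>m\<in>{..<Suc k} - {i}. T m i) = (\<Sum>m<Suc k. \<Sum>i\<in>{..<Suc k} - {m}. T m i)"
  proof -
    have "(\<Sum>i<n. \<Sum>m\<in>{..<n} - {i}. T m i) = (\<Sum>i<n. \<Sum>m<n. if i = m then 0 else T m i)" for n
      by (intro sum.cong refl sum.mono_neutral_cong_left) auto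
    moreover have "(\<Sum>m<n. \<Sum>i\<in>{..<n} - {m}. T m i) = (\<Sum>m<n. \<Sum>i<n. if i = m then 0 else T m i)" for n
      by (intro sum.cong refl sum.mono_neutral_cong_left) auto
    ultimately show ?thesis using sum.swap[of "\<lambda>i m. if i = m then 0 else T m i" "{..<Suc k}" "{..<Suc k}"]
      by (simp del: sum.lessThan_Suc)
  qed
  ultimately show ?thesis by simp
qed

section \<open>Integrals depending on a parameter\<close>

lemma FD_slice:
  assumes "smooth_on g W" "(z, s) \<in> W"
  shows "((\<lambda>z. g (z, s)) has_derivative (\<lambda>v. FD g (z, s) (v, 0))) (at z)"
proof -
  have "((\<lambda>z. (z, s)) has_derivative (\<lambda>v. (v, 0))) (at z)"
    by (auto intro!: derivative_eq_intros)
  from has_derivative_compose[OF this smooth_on_FDERIV[OF assms]] show ?thesis .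
qed

lemma continuous_on_slice:
  assumes "continuous_on W g" "\<And>s. s \<in> T \<Longrightarrow> (z, s) \<in> W"
  shows "continuous_on T (\<lambda>s. g (z, s))"
  by (rule continuous_on_compose2[OF assms(1)]) (use assms(2) in \<open>auto intro!: continuous_intros\<close>)

text \<open>W may exceed S x [0,1], so that g can be differentiable in a full neighbourhood of the
  endpoints s = 0 and s = 1. The remainder is bounded for each s by the mean value inequality,
  uniformly in s by compactness, and then integrated.\<close>

lemma has_derivative_integral_param:
  fixes g :: "'e::fin_dim_inner \<times> real \<Rightarrow> real"
  assumes g: "smooth_on g W" and S: "open S" and W: "S \<times> {0..1} \<subseteq> W" and x: "x \<in> S"
  shows "((\<lambda>z. integral {0..1} (\<lambda>s. g (z, s))) has_derivative
    (\<lambda>v. integral {0..1} (\<lambda>s. FD g (x, s) (v, 0)))) (at x)"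
proof -
  define D where "D z s v = FD g (z, s) (v, 0)" for z s v
  have inW: "(z, s) \<in> W" if "z \<in> S" "0 \<le> s" "s \<le> 1" for z s using W that by auto
  have linD: "linear (D z s)" if "z \<in> S" "0 \<le> s" "s \<le> 1" for z s
    using has_derivative_linear[OF FD_slice[OF g inW[OF that]]] by (simp add: D_def[abs_def])
  have contD: "continuous_on W (\<lambda>p. FD g p v)" for v
    by (rule smooth_imp_continuous_on[OF smooth_on_FD[OF g]])
  have intD: "(\<lambda>s. D z s v) integrable_on {0..1}" if "z \<in> S" for z v
    unfolding D_def using that inW
    by (intro integrable_continuous_interval continuous_on_slice[OF contD]) auto
  have intg: "(\<lambda>s. g (z, s)) integrable_on {0..1}" if "z \<in> S" for z
    using that inW
    by (intro integrable_continuous_interval continuous_on_slice[OF smooth_imp_continuous_on[OF g]]) auto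
  have blin: "bounded_linear (\<lambda>v. integral {0..1} (\<lambda>s. D x s v))"
  proof (rule linear_imp_bounded, rule linearI)
    fix v w
    have "integral {0..1} (\<lambda>s. D x s (v + w)) = integral {0..1} (\<lambda>s. D x s v + D x s w)"
      by (intro integral_cong) (simp add: linear_add[OF linD[OF x]])
    also have "\<dots> = integral {0..1} (\<lambda>s. D x s v) + integral {0..1} (\<lambda>s. D x s w)"
      by (rule integral_add[OF intD[OF x] intD[OF x]])
    finally show "integral {0..1} (\<lambda>s. D x s (v + w)) = integral {0..1} (\<lambda>s. D x s v) + integral {0..1} (\<lambda>s. D x s w)" .
  next
    fix c v
    have "integral {0..1} (\<lambda>s. D x s (c *\<^sub>R v)) = integral {0..1} (\<lambda>s. c *\<^sub>R D x s v)"
      by (intro integral_cong) (simp add: linear_scale[OF linD[OF x]])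
    then show "integral {0..1} (\<lambda>s. D x s (c *\<^sub>R v)) = c *\<^sub>R integral {0..1} (\<lambda>s. D x s v)"
      by simp
  qed
  \<comment> \<open>Dominates the operator norm of the difference between the derivatives at (z, s)
    and (x, s) by finitely many continuous functions; it vanishes at z = x.\<close>
  define H where "H p = (\<Sum>b\<in>onb. \<bar>D (fst p) (snd p) b - D x (snd p) b\<bar> * norm (b::'e))" for p
  have contH: "continuous_on (S \<times> {0..1}) H"
  proof -
    have 1: "continuous_on (S \<times> {0..1}) (\<lambda>p. D (fst p) (snd p) b)" for b
      unfolding D_def using continuous_on_subset[OF contD[of "(b, 0)"] W] by simp
    have 2: "continuous_on (S \<times> {0..1}) (\<lambda>p. D x (snd p) b)" for b
      unfolding D_def
      by (rule continuous_on_compose2[OF contD]) (use inW[OF x] in \<open>auto intro!: continuous_intros\<close>)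
    show ?thesis unfolding H_def by (intro continuous_intros 1 2)
  qed
  have est: "\<exists>d>0. \<forall>y. norm (y - x) < d \<longrightarrow>
      norm (integral {0..1} (\<lambda>s. g (y, s)) - integral {0..1} (\<lambda>s. g (x, s)) -
        integral {0..1} (\<lambda>s. D x s (y - x))) \<le> e * norm (y - x)" if e: "e > 0" for e
  proof -
    obtain X where X: "x \<in> X" "open X" "\<forall>z\<in>X \<inter> S. \<forall>s\<in>{0..1}. dist (H (z, s)) (H (x, s)) \<le> e"
      by (rule continuous_on_prod_compactE[OF contH compact_Icc x e])
    obtain d where d: "d > 0" "ball x d \<subseteq> X \<inter> S"
      using X(1,2) S x openE[of "X \<inter> S" x] by auto
    have "norm (integral {0..1} (\<lambda>s. g (y, s)) - integral {0..1} (\<lambda>s. g (x, s)) -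
        integral {0..1} (\<lambda>s. D x s (y - x))) \<le> e * norm (y - x)" if y: "norm (y - x) < d" for y
    proof -
      have yb: "y \<in> ball x d" using y by (simp add: dist_norm norm_minus_commute)
      have yS: "y \<in> S" using yb d by auto
      have pt: "norm (g (y, s) - g (x, s) - D x s (y - x)) \<le> e * norm (y - x)" if s: "s \<in> {0..1}" for s
      proof -
        have s': "0 \<le> s" "s \<le> 1" using s by auto
        have "norm ((g (y, s) - D x s y) - (g (x, s) - D x s x)) \<le> e * norm (y - x)"
        proof (rule differentiable_bound[of "ball x d" _ "\<lambda>z v. D z s v - D x s v"])
          fix z assume z: "z \<in> ball x d"
          then have zS: "z \<in> S" and zX: "z \<in> X" using d by auto
          have "((\<lambda>z. g (z, s)) has_derivative D z s) (at z)"
            using FD_slice[OF g inW[OF zS s']] by (simp add: D_def[abs_def])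
          moreover have "(D x s has_derivative D x s) (at z)"
            by (rule bounded_linear_imp_has_derivative[OF linear_imp_bounded[OF linD[OF x s']]])
          ultimately have "((\<lambda>z. g (z, s) - D x s z) has_derivative (\<lambda>v. D z s v - D x s v)) (at z)"
            by (rule has_derivative_diff)
          then show "((\<lambda>z. g (z, s) - D x s z) has_derivative (\<lambda>v. D z s v - D x s v)) (at z within ball x d)"
            by (rule has_derivative_at_withinI)
          show "onorm (\<lambda>v. D z s v - D x s v) \<le> e"
          proof (rule onorm_bound)
            fix v
            have "D z s v - D x s v = (\<Sum>b\<in>onb. (v \<bullet> b) * (D z s b - D x s b))"
              using linear_onb_expansion[OF linD[OF zS s'], of v] linear_onb_expansion[OF linD[OF x s'], of v]
              by (simp add: sum_subtractf right_diff_distrib)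
            also have "norm \<dots> \<le> (\<Sum>b\<in>onb. norm ((v \<bullet> b) * (D z s b - D x s b)))" by (rule norm_sum)
            also have "\<dots> \<le> (\<Sum>b\<in>onb. norm v * norm b * \<bar>D z s b - D x s b\<bar>)"
              by (intro sum_mono) (simp add: abs_mult Cauchy_Schwarz_ineq2 mult_right_mono)
            also have "\<dots> = H (z, s) * norm v"
              by (simp add: H_def sum_distrib_right sum_distrib_left mult_ac)
            also have "\<dots> \<le> e * norm v"
            proof (rule mult_right_mono)
              have "\<bar>H (z, s) - H (x, s)\<bar> \<le> e" using X(3) zX zS s by (auto simp: dist_real_def)
              moreover have "H (x, s) = 0" by (simp add: H_def)
              ultimately show "H (z, s) \<le> e" by simp
            qed simp
            finally show "norm (D z s v - D x s v) \<le> e * norm v" .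
          qed (use e in simp)
        qed (use d yb in auto)
        then show ?thesis by (simp add: linear_diff[OF linD[OF x s']] algebra_simps)
      qed
      have "((\<lambda>s. g (y, s) - g (x, s) - D x s (y - x)) has_integral
          (integral {0..1} (\<lambda>s. g (y, s)) - integral {0..1} (\<lambda>s. g (x, s)) -
            integral {0..1} (\<lambda>s. D x s (y - x)))) (cbox 0 1)"
        unfolding cbox_interval
        by (intro has_integral_diff integrable_integral intg intD x yS)
      from has_integral_bound[OF _ this] pt e show ?thesis by simp
    qed
    then show ?thesis using d(1) by blast
  qed
  show ?thesis
    unfolding has_derivative_at_alt using blin est by (simp add: D_def)
qed

text \<open>Directional derivatives are integrals of the same kind, with g replaced by its
  derivative in the direction (v, 0); hence the induction runs over all g.\<close>

lemma smooth_on_integral_param: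
  fixes g :: "'e::fin_dim_inner \<times> real \<Rightarrow> real"
  assumes g: "smooth_on g W" and S: "open S" and W: "S \<times> {0..1} \<subseteq> W"
  shows "smooth_on (\<lambda>z. integral {0..1} (\<lambda>s. g (z, s))) S"
proof (rule smooth_onI)
  fix k show "Ck_on k (\<lambda>z. integral {0..1} (\<lambda>s. g (z, s))) S"
    using g
  proof (induction k arbitrary: g)
    case 0
    have "continuous_on (S \<times> cbox 0 1) (\<lambda>(z, s). g (z, s))"
      using continuous_on_subset[OF smooth_imp_continuous_on[OF 0] W] by (simp add: case_prod_unfold)
    from integral_continuous_on_param[OF this] show ?case by simp
  next
    case (Suc k)
    show ?case
      by (rule Ck_on_SucI[OF S has_derivative_integral_param[OF Suc.prems S W] Suc.IH[OF smooth_on_FD[OF Suc.prems]]])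
  qed
qed

section \<open>The Poincare lemma along the fibres\<close>

type_synonym 'v jcoord = "real \<times> 'v \<times> 'v"

text \<open>J on the kernel of dt, extended to all vectors by dropping the dt component. Unlike J it
  has constant components.\<close>

definition vert :: "'v jcoord \<Rightarrow> real \<times> 'v \<times> 'v::real_vector" where
  "vert u = (0, 0, fst (snd u))"

lemma linear_vert: "linear vert"
  by (rule linearI) (simp_all add: vert_def)

lemma alternating_Cons:
  assumes "alternating (Suc m) f" shows "alternating m (\<lambda>us. f (v # us))"
  unfolding alternating_def
proof (intro conjI allI impI)
  fix us :: "'a list" and i x w a b
  assume "length us = m" "i < m"
  then show "f (v # us[i := a *\<^sub>R x + b *\<^sub>R w]) = a * f (v # us[i := x]) + b * f (v # us[i := w])"
    using alternating_lin[OF assms, of "v # us" "Suc i" a x b w] by simp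
next
  fix us :: "'a list" and i j
  assume "length us = m" "i < j" "j < m" "us ! i = us ! j"
  then show "f (v # us) = 0"
    using alternating_alt[OF assms, of "v # us" "Suc i" "Suc j"] by simp
qed

lemma alternating_front:
  assumes "alternating (Suc m) f" "length vs = Suc m" "i < Suc m"
  shows "f ((vs ! i) # omit i vs) = (- 1) ^ i * f vs"
  using alternating_move[OF assms(1), of "[]" "take i vs" "drop (Suc i) vs" "vs ! i"] assms(2,3)
    id_take_nth_drop[of i vs, symmetric]
  by (simp add: omit_def)

context
  fixes F :: "real \<times> 'v \<times> 'v::fin_dim_inner \<Rightarrow> 'v jcoord list \<Rightarrow> real"
    and S :: "'v jcoord set" and m :: nat and y0 :: 'v
  assumes S: "open S" and F: "local_form (Suc m) S F"
    and star: "\<And>t x y s. (t, x, y) \<in> S \<Longrightarrow> 0 \<le> s \<Longrightarrow> s \<le> 1 \<Longrightarrow> (t, x, y0 + s *\<^sub>R (y - y0)) \<in> S"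
    and basic: "\<And>z us i. z \<in> S \<Longrightarrow> length us = Suc m \<Longrightarrow> i < Suc m \<Longrightarrow> us ! i \<in> range vert \<Longrightarrow> F z us = 0"
    and closed: "\<And>z us. z \<in> S \<Longrightarrow> length us = Suc (Suc m) \<Longrightarrow> \<forall>u\<in>set us. fst u = 0 \<Longrightarrow> d_along vert F z us = 0"
begin

definition shrink :: "real \<Rightarrow> 'v jcoord \<Rightarrow> 'v jcoord" where
  "shrink s z = (fst z, fst (snd z), y0 + s *\<^sub>R (snd (snd z) - y0))"

text \<open>Not the radial field itself but a preimage of it under \<open>vert\<close>: y - y0 sits
  in the x slot. A semi-basic form vanishes on vertical vectors, so fibre directions enter it only
  through their counterparts in the x slot.\<close>

definition radial :: "'v jcoord \<Rightarrow> 'v jcoord" where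
  "radial z = (0, snd (snd z) - y0, 0)"

text \<open>The radial homotopy operator. Usually the power of s comes from pulling m fibre vectors
  back along the contraction; here the vectors standing for fibre directions lie in the x slot,
  which the contraction does not scale, so the power is written out.\<close>

definition primitive :: "'v jcoord \<Rightarrow> 'v jcoord list \<Rightarrow> real" where
  "primitive z us = integral {0..1} (\<lambda>s. s ^ m * F (shrink s z) (radial z # us))"

lemma shrink_in: "z \<in> S \<Longrightarrow> 0 \<le> s \<Longrightarrow> s \<le> 1 \<Longrightarrow> shrink s z \<in> S"
  using star[of "fst z" "fst (snd z)" "snd (snd z)" s] by (simp add: shrink_def)

lemma smooth_on_shrink: "open T \<Longrightarrow> smooth_on (\<lambda>p. shrink (snd p) (fst p)) T"
  unfolding shrink_def
  by (intro smooth_on_Pair smooth_on_add smooth_on_scaleR smooth_on_diff smooth_on_fst smooth_on_snd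
      smooth_on_const smooth_on_ident)

lemma smooth_on_radial: "open T \<Longrightarrow> smooth_on radial T"
  unfolding radial_def[abs_def]
  by (intro smooth_on_Pair smooth_on_diff smooth_on_snd smooth_on_const smooth_on_ident)

text \<open>An open set around S x [0,1] in which s may leave the unit interval, so that the
  integrand is differentiable at s = 0 and s = 1.\<close>

definition param_dom :: "('v jcoord \<times> real) set" where
  "param_dom = {p. fst p \<in> S \<and> shrink (snd p) (fst p) \<in> S}"

lemma open_param_dom: "open param_dom"
proof -
  have "continuous_on UNIV (\<lambda>p. shrink (snd p) (fst p))"
    by (rule smooth_imp_continuous_on[OF smooth_on_shrink]) simp
  then have "open ((\<lambda>p. shrink (snd p) (fst p)) -` S)" using S open_vimage by blast
  moreover have "open (fst -` S :: ('v jcoord \<times> real) set)"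
    using S by (intro open_vimage continuous_intros)
  moreover have "param_dom = (\<lambda>p. shrink (snd p) (fst p)) -` S \<inter> fst -` S"
    by (auto simp: param_dom_def)
  ultimately show ?thesis by (simp only: open_Int)
qed

lemma param_dom_sub: "S \<times> {0..1} \<subseteq> param_dom"
  using shrink_in by (auto simp: param_dom_def)

text \<open>The parameter s belongs to the base point while the slots stay in the coordinate space;
  this is why \<open>local_form\<close> keeps the two types apart.\<close>

lemma local_form_shrink: "local_form (Suc m) param_dom (\<lambda>p. F (shrink (snd p) (fst p)))"
  by (rule local_form_compose[OF open_param_dom S smooth_on_shrink[OF open_param_dom] _ F])
    (auto simp: param_dom_def)

lemma smooth_integrand:
  assumes "length us = m"
  shows "smooth_on (\<lambda>p. snd p ^ m * F (shrink (snd p) (fst p)) (radial (fst p) # us)) param_dom"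
proof (intro smooth_on_mult[OF open_param_dom] smooth_on_power[OF open_param_dom])
  have "smooth_on (\<lambda>p. F (shrink (snd p) (fst p)) (map (\<lambda>h. h p) [\<lambda>p. radial (fst p)] @ us)) param_dom"
    using assms
    by (intro smooth_on_slots[OF open_param_dom local_form_shrink])
      (auto intro!: smooth_on_compose[OF open_param_dom open_UNIV _ smooth_on_radial]
        smooth_on_fst[OF open_param_dom] smooth_on_ident open_param_dom)
  then show "smooth_on (\<lambda>p. F (shrink (snd p) (fst p)) (radial (fst p) # us)) param_dom" by simp
  show "smooth_on (\<lambda>p. snd p) param_dom"
    by (intro smooth_on_snd smooth_on_ident open_param_dom)
qed

lemma integrable_integrand:
  assumes "length us = m" "z \<in> S"
  shows "(\<lambda>s. s ^ m * F (shrink s z) (radial z # us)) integrable_on {0..1}"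
proof -
  have "(z, s) \<in> param_dom" if "s \<in> {0..1}" for s using that assms(2) param_dom_sub by auto
  from continuous_on_slice[OF smooth_imp_continuous_on[OF smooth_integrand[OF assms(1)]] this, of "{0..1}"]
  show ?thesis by (intro integrable_continuous_interval) simp
qed

lemma local_form_primitive: "local_form m S primitive"
  unfolding local_form_def
proof (intro conjI ballI allI impI)
  fix us :: "'v jcoord list" assume us: "length us = m"
  show "smooth_on (\<lambda>z. primitive z us) S"
    using smooth_on_integral_param[OF smooth_integrand[OF us] S param_dom_sub]
    by (simp add: primitive_def)
next
  fix z assume z: "z \<in> S"
  have A: "alternating m (\<lambda>us. s ^ m * F (shrink s z) (radial z # us))" if "s \<in> {0..1}" for s
    using that by (intro alternating_scale alternating_Cons cformD(1)[OF F] shrink_in z) auto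
  show "alternating m (primitive z)"
    unfolding alternating_def
  proof (intro conjI allI impI)
    fix us :: "'v jcoord list" and i v w and a b :: real
    assume us: "length us = m" and i: "i < m"
    have "primitive z (us[i := a *\<^sub>R v + b *\<^sub>R w]) = integral {0..1} (\<lambda>s.
        a * (s ^ m * F (shrink s z) (radial z # us[i := v])) + b * (s ^ m * F (shrink s z) (radial z # us[i := w])))"
      unfolding primitive_def by (intro integral_cong alternating_lin[OF A us i])
    also have "\<dots> = a * primitive z (us[i := v]) + b * primitive z (us[i := w])"
      unfolding primitive_def
      by (subst integral_add) (auto intro!: integrable_on_mult_right integrable_integrand simp: us z)
    finally show "primitive z (us[i := a *\<^sub>R v + b *\<^sub>R w]) = a * primitive z (us[i := v]) + b * primitive z (us[i := w])" .
  next
    fix us :: "'v jcoord list" and i j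
    assume us: "length us = m" and ij: "i < j" "j < m" "us ! i = us ! j"
    have "s ^ m * F (shrink s z) (radial z # us) = 0" if "s \<in> {0..1}" for s
      using alternating_alt[OF A[OF that] us, of i j] ij by simp
    then have "primitive z us = integral {0..1} (\<lambda>s::real. 0)"
      unfolding primitive_def by (rule integral_cong)
    then show "primitive z us = 0" by simp
  qed
qed

lemma FD_shrink:
  "(shrink s has_derivative (\<lambda>v. (fst v, fst (snd v), s *\<^sub>R snd (snd v)))) (at z)"
  unfolding shrink_def[abs_def] by (auto intro!: derivative_eq_intros)

lemma FD_radial: "(radial has_derivative (\<lambda>v. (0, snd (snd v), 0))) (at z)"
  unfolding radial_def[abs_def] by (auto intro!: derivative_eq_intros)

text \<open>Moving z along \<open>vert v\<close> moves the contracted point by s times that vector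
  and moves \<open>radial z\<close> by the x part of v. As v has no dt component, that x part
  differs from v by a vertical vector, which F annihilates; so v itself appears in the second
  term.\<close>

lemma FD_integrand:
  assumes z: "z \<in> S" and s: "0 \<le> s" "s \<le> 1" and us: "length us = m" and v: "fst v = 0"
  shows "FD (\<lambda>p. snd p ^ m * F (shrink (snd p) (fst p)) (radial (fst p) # us)) (z, s) (vert v, 0) =
    s ^ m * (s * FD (\<lambda>y. F y (radial z # us)) (shrink s z) (vert v) + F (shrink s z) (v # us))"
proof -
  have zs: "shrink s z \<in> S" by (rule shrink_in[OF z s])
  define Ss where "Ss = S \<inter> shrink s -` S"
  have cont: "continuous_on UNIV (shrink s)"
    unfolding shrink_def[abs_def] by (intro continuous_intros)
  then have Ss: "open Ss" unfolding Ss_def using S open_vimage by blast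
  have zSs: "z \<in> Ss" using z zs by (simp add: Ss_def)
  have smS: "smooth_on (shrink s) Ss"
    unfolding shrink_def[abs_def]
    by (intro smooth_on_Pair smooth_on_add smooth_on_scaleR smooth_on_diff smooth_on_fst smooth_on_snd
        smooth_on_const smooth_on_ident Ss)
  have cS: "local_form (Suc m) Ss (\<lambda>z. F (shrink s z))"
    by (rule local_form_compose[OF Ss S smS _ F]) (auto simp: Ss_def)
  define A where "A w = FD (\<lambda>z. F (shrink s z) (radial z # us)) z w" for w
  have "((\<lambda>z. F (shrink s z) (map (\<lambda>h. h z) [radial] @ us)) has_derivative
     (\<lambda>w. FD (\<lambda>y. F (shrink s y) (map (\<lambda>h. h z) [radial] @ us)) z w +
      (\<Sum>l<length [radial]. F (shrink s z) ((map (\<lambda>h. h z) [radial] @ us)[l := FD ([radial] ! l) z w])))) (at z)"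
    using us by (intro has_derivative_slots[OF Ss cS zSs]) (auto intro: smooth_on_radial Ss)
  then have D: "((\<lambda>z. F (shrink s z) (radial z # us)) has_derivative
     (\<lambda>w. FD (\<lambda>y. F (shrink s y) (radial z # us)) z w + F (shrink s z) (FD radial z w # us))) (at z)"
    by simp
  have "FD (\<lambda>y. F (shrink s y) (radial z # us)) z (vert v) =
      FD (\<lambda>y. F y (radial z # us)) (shrink s z) (FD (shrink s) z (vert v))"
    using us by (intro FD_chain[OF smS zSs cformD(2)[OF F] zs]) simp
  also have "FD (shrink s) z (vert v) = s *\<^sub>R vert v"
    by (simp add: FD_eqI[OF FD_shrink] vert_def)
  also have "FD (\<lambda>y. F y (radial z # us)) (shrink s z) (s *\<^sub>R vert v) =
      s * FD (\<lambda>y. F y (radial z # us)) (shrink s z) (vert v)"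
    using us by (simp add: linear_scale[OF linear_FD[OF cformD(2)[OF F] zs]])
  finally have 1: "FD (\<lambda>y. F (shrink s y) (radial z # us)) z (vert v) =
    s * FD (\<lambda>y. F y (radial z # us)) (shrink s z) (vert v)" .
  have 2: "F (shrink s z) (FD radial z (vert v) # us) = F (shrink s z) (v # us)"
  proof -
    have "v = 1 *\<^sub>R (0, fst (snd v), 0) + 1 *\<^sub>R (0, 0, snd (snd v))"
      using v by (simp add: prod_eq_iff)
    then have "F (shrink s z) (v # us) = F (shrink s z) ((v # us)[0 := 1 *\<^sub>R (0, fst (snd v), 0) + 1 *\<^sub>R (0, 0, snd (snd v))])"
      by simp
    also have "\<dots> = F (shrink s z) ((0, fst (snd v), 0) # us) + F (shrink s z) ((0, 0, snd (snd v)) # us)"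
      using alternating_lin[OF cformD(1)[OF F zs], of "v # us" 0 1 "(0, fst (snd v), 0)" 1 "(0, 0, snd (snd v))"] us by simp
    also have "F (shrink s z) ((0, 0, snd (snd v)) # us) = 0"
      using us by (intro basic[OF zs, of _ 0]) (auto simp: vert_def image_iff)
    finally show ?thesis by (simp add: FD_eqI[OF FD_radial] vert_def)
  qed
  have "((\<lambda>z. s ^ m * F (shrink s z) (radial z # us)) has_derivative
     (\<lambda>w. s ^ m * (FD (\<lambda>y. F (shrink s y) (radial z # us)) z w + F (shrink s z) (FD radial z w # us)))) (at z)"
    by (intro has_derivative_mult_right D)
  moreover have "((\<lambda>z. s ^ m * F (shrink s z) (radial z # us)) has_derivative
      (\<lambda>w. FD (\<lambda>p. snd p ^ m * F (shrink (snd p) (fst p)) (radial (fst p) # us)) (z, s) (w, 0))) (at z)"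
  proof -
    have "(z, s) \<in> param_dom" using param_dom_sub z s by auto
    from FD_slice[OF smooth_integrand[OF us] this] show ?thesis by simp
  qed
  ultimately have "(\<lambda>w. FD (\<lambda>p. snd p ^ m * F (shrink (snd p) (fst p)) (radial (fst p) # us)) (z, s) (w, 0)) =
     (\<lambda>w. s ^ m * (FD (\<lambda>y. F (shrink s y) (radial z # us)) z w + F (shrink s z) (FD radial z w # us)))"
    using has_derivative_unique by blast
  from fun_cong[OF this, of "vert v"] show ?thesis by (simp only: 1 2)
qed

text \<open>Summing \<open>FD_integrand\<close> over the tuple gives m + 1 copies of F at
  \<open>vs\<close> and an alternating sum that closedness converts into the derivative of F along
  the radial field. The integrand becomes the s-derivative of s ^ (m + 1) times F at the contracted
  point.\<close>

lemma d_along_primitive: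
  assumes z: "z \<in> S" and vs: "length vs = Suc m" "\<forall>v\<in>set vs. fst v = 0"
  shows "d_along vert primitive z vs = F z vs"
proof -
  define g where "g i p = snd p ^ m * F (shrink (snd p) (fst p)) (radial (fst p) # omit i vs)" for i p
  have lo: "length (omit i vs) = m" if "i < Suc m" for i using that vs by (simp add: length_omit)
  have sg: "smooth_on (g i) param_dom" if "i < Suc m" for i
    unfolding g_def[abs_def] by (rule smooth_integrand[OF lo[OF that]])
  have FDp: "FD (\<lambda>z. primitive z (omit i vs)) z (vert (vs ! i)) =
      integral {0..1} (\<lambda>s. FD (g i) (z, s) (vert (vs ! i), 0))" if "i < Suc m" for i
    using FD_eqI[OF has_derivative_integral_param[OF sg[OF that] S param_dom_sub z]]
    by (simp add: primitive_def g_def)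
  have int: "(\<lambda>s. FD (g i) (z, s) (v, 0)) integrable_on {0..1}" if "i < Suc m" for i v
  proof -
    have "(z, s) \<in> param_dom" if "s \<in> {0..1}" for s using that z param_dom_sub by auto
    from continuous_on_slice[OF smooth_imp_continuous_on[OF smooth_on_FD[OF sg[OF that]]] this, of "{0..1}" "(v, 0)"]
    show ?thesis by (intro integrable_continuous_interval) blast
  qed
  have "d_along vert primitive z vs = (\<Sum>i<Suc m. integral {0..1} (\<lambda>s. (- 1) ^ i * FD (g i) (z, s) (vert (vs ! i), 0)))"
    unfolding d_along_def vs by (intro sum.cong refl) (simp add: FDp)
  also have "\<dots> = integral {0..1} (\<lambda>s. \<Sum>i<Suc m. (- 1) ^ i * FD (g i) (z, s) (vert (vs ! i), 0))"
    by (intro integral_sum[symmetric] integrable_on_mult_right int) auto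
  also have "\<dots> = integral {0..1} (\<lambda>s. s ^ Suc m * FD (\<lambda>y. F y vs) (shrink s z) (vert (radial z)) +
      real (Suc m) * s ^ m * F (shrink s z) vs)"
  proof (rule integral_cong)
    fix s :: real assume "s \<in> {0..1}"
    then have s: "0 \<le> s" "s \<le> 1" by auto
    have zs: "shrink s z \<in> S" by (rule shrink_in[OF z s])
    define G where "G i = FD (\<lambda>y. F y (radial z # omit i vs)) (shrink s z) (vert (vs ! i))" for i
    \<comment> \<open>Closedness for the tuple with \<open>radial z\<close> in front: the first
      summand is the derivative along \<open>vert (radial z)\<close>, and the position shift gives
      all others the opposite sign.\<close>
    have "d_along vert F (shrink s z) (radial z # vs) = 0"
      using vs by (intro closed zs) (auto simp: radial_def)
    then have G: "(\<Sum>i<Suc m. (- 1) ^ i * G i) = FD (\<lambda>y. F y vs) (shrink s z) (vert (radial z))"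
      by (simp add: d_along_def vs sum.lessThan_Suc_shift[of _ "Suc m"] omit_def G_def sum_negf del: sum.lessThan_Suc)
    have "(- 1) ^ i * FD (g i) (z, s) (vert (vs ! i), 0) = s ^ Suc m * ((- 1) ^ i * G i) + s ^ m * F (shrink s z) vs"
      if i: "i < Suc m" for i
    proof -
      have "FD (g i) (z, s) (vert (vs ! i), 0) = s ^ m * (s * G i + F (shrink s z) ((vs ! i) # omit i vs))"
        unfolding g_def[abs_def] G_def using i vs by (intro FD_integrand z s lo) auto
      moreover have "F (shrink s z) ((vs ! i) # omit i vs) = (- 1) ^ i * F (shrink s z) vs"
        by (rule alternating_front[OF cformD(1)[OF F zs] vs(1) i])
      moreover have "(- 1 :: real) ^ i * (- 1) ^ i = 1" by (simp flip: power_mult_distrib)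
      ultimately show ?thesis by (simp add: algebra_simps)
    qed
    then have "(\<Sum>i<Suc m. (- 1) ^ i * FD (g i) (z, s) (vert (vs ! i), 0)) =
        s ^ Suc m * (\<Sum>i<Suc m. (- 1) ^ i * G i) + real (Suc m) * (s ^ m * F (shrink s z) vs)"
      by (simp add: sum.distrib sum_distrib_left del: sum.lessThan_Suc power_Suc)
    then show "(\<Sum>i<Suc m. (- 1) ^ i * FD (g i) (z, s) (vert (vs ! i), 0)) =
        s ^ Suc m * FD (\<lambda>y. F y vs) (shrink s z) (vert (radial z)) + real (Suc m) * s ^ m * F (shrink s z) vs"
      by (simp only: G mult.assoc)
  qed
  also have "\<dots> = F z vs"
  proof -
    \<comment> \<open>The lower boundary term disappears because the exponent m + 1 is positive, and
      \<open>shrink 1\<close> is the identity.\<close>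
    have "((\<lambda>s. s ^ Suc m * FD (\<lambda>y. F y vs) (shrink s z) (vert (radial z)) +
        real (Suc m) * s ^ m * F (shrink s z) vs) has_integral
        (1 ^ Suc m * F (shrink 1 z) vs - 0 ^ Suc m * F (shrink 0 z) vs)) {0..1}"
    proof (rule fundamental_theorem_of_calculus)
      fix s :: real assume "s \<in> {0..1}"
      then have zs: "shrink s z \<in> S" using shrink_in[OF z] by auto
      have "((\<lambda>s. shrink s z) has_derivative (\<lambda>r. r *\<^sub>R vert (radial z))) (at s)"
        unfolding shrink_def vert_def radial_def by (auto intro!: derivative_eq_intros)
      from has_derivative_compose[OF this smooth_on_FDERIV[OF cformD(2)[OF F vs(1)] zs]]
      have "((\<lambda>s. F (shrink s z) vs) has_real_derivative FD (\<lambda>y. F y vs) (shrink s z) (vert (radial z))) (at s)"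
        unfolding has_field_derivative_def
        by (rule has_derivative_eq_rhs)
          (simp add: fun_eq_iff linear_scale[OF linear_FD[OF cformD(2)[OF F vs(1)] zs]])
      then have "((\<lambda>s. s ^ Suc m * F (shrink s z) vs) has_real_derivative
          s ^ Suc m * FD (\<lambda>y. F y vs) (shrink s z) (vert (radial z)) + real (Suc m) * s ^ m * F (shrink s z) vs) (at s)"
        by (auto intro!: derivative_eq_intros simp del: power_Suc)
      then show "((\<lambda>s. s ^ Suc m * F (shrink s z) vs) has_vector_derivative
          s ^ Suc m * FD (\<lambda>y. F y vs) (shrink s z) (vert (radial z)) + real (Suc m) * s ^ m * F (shrink s z) vs) (at s within {0..1})"
        by (simp add: has_real_derivative_iff_has_vector_derivative has_vector_derivative_at_within)
    qed simp
    then show ?thesis by (simp add: shrink_def integral_unique)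
  qed
  finally show ?thesis .
qed

end

section \<open>Charts of the maximal atlas\<close>

abbreviation overlap :: "('p, 'e) chart \<Rightarrow> ('p, 'e) chart \<Rightarrow> 'e set" where
  "overlap c d \<equiv> snd c ` (fst c \<inter> fst d)"

abbreviation trn :: "('p, 'e) chart \<Rightarrow> ('p, 'e) chart \<Rightarrow> 'e \<Rightarrow> 'e" where
  "trn c d \<equiv> snd d \<circ> chart_inv c"

lemma compatible_sym: "compatible c d \<Longrightarrow> compatible d c"
  by (simp add: compatible_def Int_commute)

lemma compatible_openD: "compatible c d \<Longrightarrow> open (overlap c d)"
  and compatible_smoothD: "compatible c d \<Longrightarrow> smooth_on (trn c d) (overlap c d)"
  by (simp_all add: compatible_def)

lemma chart_inv_chart: "inj_on (snd c) (fst c) \<Longrightarrow> p \<in> fst c \<Longrightarrow> chart_inv c (snd c p) = p"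
  by (rule inv_into_f_f)

lemma chart_chart_inv: "z \<in> snd c ` fst c \<Longrightarrow> snd c (chart_inv c z) = z"
  by (rule f_inv_into_f)

lemma chart_inv_in: "z \<in> snd c ` fst c \<Longrightarrow> chart_inv c z \<in> fst c"
  by (rule inv_into_into)

lemma open_preimage:
  assumes "continuous_on S f" "open S" "open T" shows "open {x \<in> S. f x \<in> T}"
proof -
  have "open (f -` T \<inter> S)"
    using continuous_on_open_vimage[OF assms(2)] assms(1,3) by blast
  moreover have "f -` T \<inter> S = {x \<in> S. f x \<in> T}" by auto
  ultimately show ?thesis by simp
qed

text \<open>On the triple intersection the transition from c to d factors through a; injectivity of
  the charts identifies the image as the preimage of an open set under the transition from c to
  a.\<close>

lemma compatible_through:
  fixes c a d :: "('p, 'e::fin_dim_inner) chart"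
  assumes inj: "inj_on (snd c) (fst c)" "inj_on (snd a) (fst a)" and ca: "compatible c a" and ad: "compatible a d"
  defines "W \<equiv> snd c ` (fst c \<inter> fst a \<inter> fst d)"
  shows "open W" "smooth_on (trn c d) W"
proof -
  have W: "W = {z \<in> overlap c a. trn c a z \<in> overlap a d}"
    by (auto simp: W_def chart_inv_chart[OF inj(1)] dest: inj_onD[OF inj(2)])
  show 1: "open W"
    unfolding W
    by (rule open_preimage[OF smooth_imp_continuous_on[OF compatible_smoothD[OF ca]]
          compatible_openD[OF ca] compatible_openD[OF ad]])
  have "smooth_on (\<lambda>z. (trn a d) (trn c a z)) W"
    by (rule smooth_on_compose[OF 1 compatible_openD[OF ad] smooth_on_subset[OF compatible_smoothD[OF ca]]
          compatible_smoothD[OF ad]]) (auto simp: W)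
  then show "smooth_on (trn c d) W"
    by (rule smooth_on_cong[OF 1, rotated]) (auto simp: W_def chart_inv_chart[OF inj(1)] chart_inv_chart[OF inj(2)])
qed

lemma maximal_atlas_inj: "c \<in> maximal_atlas A \<Longrightarrow> inj_on (snd c) (fst c)"
  and maximal_atlas_points: "c \<in> maximal_atlas A \<Longrightarrow> fst c \<subseteq> points A"
  and maximal_atlas_compatible: "c \<in> maximal_atlas A \<Longrightarrow> a \<in> A \<Longrightarrow> compatible c a"
  by (simp_all add: maximal_atlas_def)

lemma maximal_atlas_open: "c \<in> maximal_atlas A \<Longrightarrow> open (snd c ` fst c)"
  using compatible_openD[of c c] by (simp add: maximal_atlas_def)

lemma atlas_subset_maximal: "smooth_atlas A \<Longrightarrow> A \<subseteq> maximal_atlas A"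
  by (auto simp: smooth_atlas_def maximal_atlas_def points_def)

text \<open>Members of the maximal atlas are compared with charts of A only. The latter cover the
  overlap, and openness and smoothness are local.\<close>

lemma maximal_atlas_compatible_charts:
  fixes A :: "('p, 'e::fin_dim_inner) chart set"
  assumes A: "smooth_atlas A" and c: "c \<in> maximal_atlas A" and d: "d \<in> maximal_atlas A"
  shows "compatible c d"
proof -
  have *: "open (overlap c d)" "smooth_on (trn c d) (overlap c d)"
    if c: "c \<in> maximal_atlas A" and d: "d \<in> maximal_atlas A" for c d
  proof -
    define W where "W a = snd c ` (fst c \<inter> fst a \<inter> fst d)" for a :: "('p, 'e) chart"
    have W: "open (W a)" "smooth_on (trn c d) (W a)" if a: "a \<in> A" for a
      unfolding W_def using a A
      by (intro compatible_through maximal_atlas_inj[OF c] maximal_atlas_compatible[OF c]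
          compatible_sym[OF maximal_atlas_compatible[OF d]]; simp add: smooth_atlas_def)+
    have U: "overlap c d = (\<Union>a\<in>A. W a)"
      using maximal_atlas_points[OF c] by (auto simp: W_def points_def)
    show "open (overlap c d)" unfolding U using W(1) by blast
    show "smooth_on (trn c d) (overlap c d)"
    proof (rule smooth_on_local)
      fix z assume "z \<in> overlap c d"
      then obtain a where a: "a \<in> A" "z \<in> W a" using U by auto
      then show "\<exists>T. open T \<and> z \<in> T \<and> smooth_on (trn c d) (overlap c d \<inter> T)"
        using W[OF a(1)] by (intro exI[of _ "W a"]) (auto intro: smooth_on_subset)
    qed
  qed
  show ?thesis
    unfolding compatible_def using *[OF c d] *[OF d c] by (simp add: Int_commute)
qed

text \<open>The transitions of the new chart are those of c, preceded by \<psi> or followed by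
  \<phi>. This is how \<pi> is made a coordinate.\<close>

lemma maximal_atlas_reparam:
  fixes A :: "('p, 'e::fin_dim_inner) chart set"
  assumes A: "smooth_atlas A" and c: "c \<in> maximal_atlas A" and W: "open W" "W \<subseteq> snd c ` fst c"
    and \<phi>: "smooth_on \<phi> W" "open (\<phi> ` W)"
    and \<psi>: "smooth_on \<psi> (\<phi> ` W)" "\<And>z. z \<in> W \<Longrightarrow> \<psi> (\<phi> z) = z"
  shows "({p \<in> fst c. snd c p \<in> W}, \<phi> \<circ> snd c) \<in> maximal_atlas A"
proof -
  define c' where "c' = ({p \<in> fst c. snd c p \<in> W}, \<phi> \<circ> snd c)"
  have f: "fst c' = {p \<in> fst c. snd c p \<in> W}" "\<And>p. snd c' p = \<phi> (snd c p)" by (simp_all add: c'_def)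
  note injc = maximal_atlas_inj[OF c]
  have inj: "inj_on (snd c') (fst c')"
  proof (rule inj_onI)
    fix p q assume "p \<in> fst c'" "q \<in> fst c'" "snd c' p = snd c' q"
    then have "snd c p = snd c q" using \<psi>(2) by (metis (mono_tags, lifting) f mem_Collect_eq)
    then show "p = q" using \<open>p \<in> fst c'\<close> \<open>q \<in> fst c'\<close> injc by (auto simp: f inj_on_def)
  qed
  have inv: "chart_inv c' (\<phi> (snd c p)) = p" if "p \<in> fst c'" for p
    using chart_inv_chart[OF inj that] by (simp add: f)
  have im: "snd c' ` fst c' = \<phi> ` W" using W(2) by (force simp: f)
  have "compatible c' d" if d: "d \<in> A" for d
  proof -
    note cd = maximal_atlas_compatible[OF c d]
    define V where "V = overlap c d"
    have V: "open V" unfolding V_def by (rule compatible_openD[OF cd])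
    have 1: "snd c' ` (fst c' \<inter> fst d) = {y \<in> \<phi> ` W. \<psi> y \<in> V}"
    proof
      show "snd c' ` (fst c' \<inter> fst d) \<subseteq> {y \<in> \<phi> ` W. \<psi> y \<in> V}"
        using \<psi>(2) by (auto simp: f V_def)
      show "{y \<in> \<phi> ` W. \<psi> y \<in> V} \<subseteq> snd c' ` (fst c' \<inter> fst d)"
      proof
        fix y assume "y \<in> {y \<in> \<phi> ` W. \<psi> y \<in> V}"
        then obtain z where z: "z \<in> W" "y = \<phi> z" "z \<in> V" using \<psi>(2) by auto
        then obtain p where "p \<in> fst c \<inter> fst d" "z = snd c p" by (auto simp: V_def)
        then show "y \<in> snd c' ` (fst c' \<inter> fst d)" using z by (intro image_eqI[of _ _ p]) (auto simp: f)
      qed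
    qed
    have o1: "open (snd c' ` (fst c' \<inter> fst d))"
      unfolding 1 by (rule open_preimage[OF smooth_imp_continuous_on[OF \<psi>(1)] \<phi>(2) V])
    have "smooth_on (\<lambda>y. trn c d (\<psi> y)) (snd c' ` (fst c' \<inter> fst d))"
      by (rule smooth_on_compose[OF o1 V smooth_on_subset[OF \<psi>(1)]])
        (use compatible_smoothD[OF cd] in \<open>auto simp: 1 V_def o_def\<close>)
    then have s1: "smooth_on (trn c' d) (snd c' ` (fst c' \<inter> fst d))"
    proof (rule smooth_on_cong[OF o1, rotated])
      fix y assume "y \<in> snd c' ` (fst c' \<inter> fst d)"
      then obtain p where p: "p \<in> fst c'" "y = \<phi> (snd c p)" by (auto simp: f)
      then show "trn c d (\<psi> y) = trn c' d y"
        using inv[OF p(1)] by (simp add: f \<psi>(2) chart_inv_chart[OF injc])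
    qed
    have 2: "snd d ` (fst d \<inter> fst c') = {w \<in> overlap d c. trn d c w \<in> W}"
      if "inj_on (snd d) (fst d)" by (auto simp: f chart_inv_chart[OF that])
    show ?thesis
    proof (cases "inj_on (snd d) (fst d)")
      case injd: True
      note dc = compatible_sym[OF cd]
      have o2: "open (snd d ` (fst d \<inter> fst c'))"
        unfolding 2[OF injd]
        by (rule open_preimage[OF smooth_imp_continuous_on[OF compatible_smoothD[OF dc]] compatible_openD[OF dc] W(1)])
      have "smooth_on (\<lambda>w. \<phi> (trn d c w)) (snd d ` (fst d \<inter> fst c'))"
        by (rule smooth_on_compose[OF o2 W(1) smooth_on_subset[OF compatible_smoothD[OF dc]] \<phi>(1)])
          (auto simp: 2[OF injd])
      then have s2: "smooth_on (trn d c') (snd d ` (fst d \<inter> fst c'))"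
        by (rule smooth_on_cong[OF o2, rotated]) (simp add: f)
      show ?thesis unfolding compatible_def using o1 s1 o2 s2 by (simp add: Int_commute)
    qed (use A d in \<open>simp add: smooth_atlas_def\<close>)
  qed
  moreover have "compatible c' c'"
  proof -
    have "smooth_on (trn c' c') (\<phi> ` W)"
      by (rule smooth_on_cong[OF \<phi>(2) _ smooth_on_ident[OF \<phi>(2)]])
        (use chart_chart_inv[of _ c'] in \<open>simp add: im\<close>)
    then show ?thesis using \<phi>(2) by (simp add: compatible_def im)
  qed
  ultimately show ?thesis
    using inj maximal_atlas_points[OF c] unfolding c'_def[symmetric] maximal_atlas_def by (auto simp: f)
qed

section \<open>An implicit function theorem in one unknown\<close>

text \<open>The map from z to (g z, snd z) alters one real coordinate, strictly monotonically.
  Monotonicity gives injectivity and the intermediate value theorem gives openness, so the inverse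
  is continuous; its differentiability follows from the triangular shape of the derivative.\<close>

lemma straighten_pos:
  fixes g :: "real \<times> 'v::fin_dim_inner \<Rightarrow> real"
  assumes O: "open O'" "z0 \<in> O'" and g: "smooth_on g O'" and pos: "FD g z0 (1, 0) > 0"
  shows "\<exists>W H. open W \<and> z0 \<in> W \<and> W \<subseteq> O' \<and> open ((\<lambda>z. (g z, snd z)) ` W) \<and>
    smooth_on H ((\<lambda>z. (g z, snd z)) ` W) \<and> (\<forall>z\<in>W. H (g z, snd z) = z)"
proof -
  define G where "G z = (g z, snd z)" for z
  have "open {z \<in> O'. FD g z (1, 0) \<in> {0<..}}"
    by (rule open_preimage[OF smooth_imp_continuous_on[OF smooth_on_FD[OF g]] O(1)]) simp
  moreover have "z0 \<in> {z \<in> O'. FD g z (1, 0) \<in> {0<..}}" using O pos by simp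
  ultimately obtain I B where IB: "open I" "open B" "z0 \<in> I \<times> B" "I \<times> B \<subseteq> {z \<in> O'. FD g z (1, 0) \<in> {0<..}}"
    by (rule open_prod_elim)
  obtain r where r: "r > 0" "ball (fst z0) r \<subseteq> I" using IB(1,3) openE by (metis mem_Times_iff)
  \<comment> \<open>The first factor is an interval, so the segment between two points of W with the
    same second coordinate stays in W.\<close>
  define W where "W = ball (fst z0) r \<times> B"
  have sub: "W \<subseteq> {z \<in> O'. FD g z (1, 0) \<in> {0<..}}"
    using IB(4) r(2) unfolding W_def by blast
  then have W: "open W" "z0 \<in> W" "W \<subseteq> O'"
    using IB(2,3) r(1) by (simp_all add: W_def open_Times mem_Times_iff) blast
  have Wpos: "FD g z (1, 0) > 0" if "z \<in> W" for z using sub that by auto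
  have gW: "smooth_on g W" by (rule smooth_on_subset[OF g W(3)])
  have slice: "((\<lambda>s. g (s, x)) has_real_derivative FD g (s, x) (1, 0)) (at s)" if "(s, x) \<in> W" for s x
  proof -
    have "((\<lambda>s. (s, x)) has_derivative (\<lambda>r. (r, 0))) (at s)" by (auto intro!: derivative_eq_intros)
    note D = has_derivative_compose[OF this smooth_on_FDERIV[OF gW that]]
    have "FD g (s, x) (r, 0) = FD g (s, x) (1, 0) * r" for r
      using linear_scale[OF linear_FD[OF gW that], of r "(1, 0)"] by simp
    then show ?thesis
      unfolding has_field_derivative_def by (intro has_derivative_eq_rhs[OF D] ext)
  qed
  have conv: "(s, x) \<in> W" if "(s1, x) \<in> W" "(s2, x) \<in> W" "s1 \<le> s" "s \<le> s2" for s s1 s2 x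
    using that by (auto simp: W_def dist_real_def)
  have mono: "g (s1, x) < g (s2, x)" if "(s1, x) \<in> W" "(s2, x) \<in> W" "s1 < s2" for s1 s2 x
    using slice Wpos conv[OF that(1,2)] by (intro DERIV_pos_imp_increasing[OF that(3)]) blast
  have injG: "inj_on G W"
  proof (rule inj_onI)
    fix z w assume "z \<in> W" "w \<in> W" "G z = G w"
    then have *: "(fst z, snd z) \<in> W" "(fst w, snd z) \<in> W" "g (fst z, snd z) = g (fst w, snd z)" "snd z = snd w"
      by (cases z; cases w; auto simp: G_def)+
    have "fst z = fst w"
      using mono[OF *(1,2)] mono[OF *(2,1)] *(3) by (cases "fst z" "fst w" rule: linorder_cases) auto
    then show "z = w" using *(4) by (simp add: prod_eq_iff)
  qed
  have openG: "open (G ` V)" if V: "open V" "V \<subseteq> W" for V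
  proof (subst open_subopen, intro ballI)
    fix y assume "y \<in> G ` V"
    then obtain s x where sx: "(s, x) \<in> V" "y = (g (s, x), x)" by (auto simp: G_def)
    obtain J B' where JB: "open J" "open B'" "(s, x) \<in> J \<times> B'" "J \<times> B' \<subseteq> V"
      by (rule open_prod_elim[OF V(1) sx(1)])
    obtain e where e: "e > 0" "ball s e \<subseteq> J" using JB(1,3) openE by (metis mem_Sigma_iff)
    define d where "d = e / 2"
    have d: "d > 0" "\<And>s'. s - d \<le> s' \<Longrightarrow> s' \<le> s + d \<Longrightarrow> s' \<in> J"
      using e by (auto simp: d_def dist_real_def subset_iff)
    have inV: "(s', x') \<in> V" "(s', x') \<in> W" if "s - d \<le> s'" "s' \<le> s + d" "x' \<in> B'" for s' x'
      using d(2) that JB(4) V(2) by auto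
    have cont: "continuous_on (UNIV \<times> B') (\<lambda>p. g (s', snd p))" if "s - d \<le> s'" "s' \<le> s + d" for s'
      by (rule continuous_on_compose2[OF smooth_imp_continuous_on[OF gW]])
        (use inV(2)[OF that] in \<open>auto intro!: continuous_intros\<close>)
    have op: "open (UNIV \<times> B' :: (real \<times> 'v) set)" using JB(2) by (simp add: open_Times)
    \<comment> \<open>The points (t, x') with t strictly between the values of g at the two ends of
      the segment over x'; each such t is attained on that segment.\<close>
    define N where "N = {p \<in> UNIV \<times> B'. fst p - g (s - d, snd p) \<in> {0<..}} \<inter>
        {p \<in> UNIV \<times> B'. g (s + d, snd p) - fst p \<in> {0<..}}"
    have "open N"
      unfolding N_def using d(1)
      by (intro open_Int open_preimage[OF _ op] continuous_intros cont) auto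
    moreover have "y \<in> N"
      using JB(3) d(1) sx mono[OF inV(2) inV(2), of "s - d" x s] mono[OF inV(2) inV(2), of s x "s + d"]
      by (auto simp: N_def)
    moreover have "N \<subseteq> G ` V"
    proof
      fix p assume "p \<in> N"
      then obtain t x' where p: "p = (t, x')" "x' \<in> B'" "g (s - d, x') < t" "t < g (s + d, x')"
        by (cases p) (auto simp: N_def)
      have "\<exists>s'\<ge>s - d. s' \<le> s + d \<and> g (s', x') = t"
      proof (rule IVT')
        show "continuous_on {s - d..s + d} (\<lambda>s'. g (s', x'))"
          by (rule continuous_on_compose2[OF smooth_imp_continuous_on[OF gW]])
            (use inV(2) p(2) in \<open>auto intro!: continuous_intros\<close>)
      qed (use p d(1) in auto)
      then obtain s' where "s - d \<le> s'" "s' \<le> s + d" "g (s', x') = t" by blast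
      then show "p \<in> G ` V" using inV(1) p by (intro image_eqI[of _ _ "(s', x')"]) (auto simp: G_def)
    qed
    ultimately show "\<exists>T. open T \<and> y \<in> T \<and> T \<subseteq> G ` V" by blast
  qed
  define H where "H = inv_into W G"
  have HG: "H (G z) = z" if "z \<in> W" for z unfolding H_def by (rule inv_into_f_f[OF injG that])
  have GH: "G (H y) = y" "H y \<in> W" if "y \<in> G ` W" for y
    using that by (auto simp: H_def f_inv_into_f inv_into_into)
  have oGW: "open (G ` W)" by (rule openG[OF W(1) order_refl])
  have contH: "continuous_on (G ` W) H"
  proof (subst continuous_on_open_vimage[OF oGW], intro allI impI)
    fix V :: "(real \<times> 'v) set" assume "open V"
    moreover have "H -` V \<inter> G ` W = G ` (V \<inter> W)" using HG by auto
    ultimately show "open (H -` V \<inter> G ` W)" using openG[of "V \<inter> W"] W(1) by auto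
  qed
  \<comment> \<open>The inverse of the triangular derivative: the row of D g is solved for the first
    component.\<close>
  define H' where "H' y v = (inverse (FD g (H y) (1, 0)) * (fst v - FD g (H y) (0, snd v)), snd v)" for y v
  have derH: "(H has_derivative H' y) (at y)" if y: "y \<in> G ` W" for y
  proof (rule has_derivative_inverse_basic[OF _ _ _ _ oGW y])
    note Hy = GH(2)[OF y]
    note lin = linear_FD[OF gW Hy]
    show "(G has_derivative (\<lambda>v. (FD g (H y) v, snd v))) (at (H y))"
      unfolding G_def[abs_def]
      by (intro has_derivative_Pair smooth_on_FDERIV[OF gW Hy] has_derivative_snd has_derivative_ident)
    have "FD g (H y) (0, a + b) = FD g (H y) (0, a) + FD g (H y) (0, b)" for a b
      using linear_add[OF lin, of "(0, a)" "(0, b)"] by simp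
    moreover have "FD g (H y) (0, r *\<^sub>R a) = r * FD g (H y) (0, a)" for r a
      using linear_scale[OF lin, of r "(0, a)"] by simp
    ultimately show "bounded_linear (H' y)"
      by (intro linear_imp_bounded linearI) (simp_all add: H'_def algebra_simps)
    have "H' y (FD g (H y) v, snd v) = v" for v
    proof -
      have "FD g (H y) v - FD g (H y) (0, snd v) = fst v * FD g (H y) (1, 0)"
        using linear_add[OF lin, of "fst v *\<^sub>R (1, 0)" "(0, snd v)"] linear_scale[OF lin, of "fst v" "(1, 0)"] by simp
      then show ?thesis using Wpos[OF Hy] by (simp add: H'_def prod_eq_iff)
    qed
    then show "H' y \<circ> (\<lambda>v. (FD g (H y) v, snd v)) = id" by (simp add: fun_eq_iff)
    show "continuous (at y) H" using contH y unfolding continuous_on_eq_continuous_at[OF oGW] by blast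
    show "G (H w) = w" if "w \<in> G ` W" for w using GH(1)[OF that] .
  qed
  \<comment> \<open>Bootstrapping: the derivative of H is an algebraic expression in derivatives of
    g composed with H, so class k of H gives class k + 1.\<close>
  have "Ck_on k H (G ` W)" for k
  proof (induction k)
    case 0
    then show ?case using contH by simp
  next
    case (Suc k)
    show ?case
    proof (rule Ck_on_SucI[OF oGW derH])
      fix v
      have "Ck_on k (\<lambda>y. FD g (H y) u) (G ` W)" for u
        by (rule Ck_on_compose[OF oGW W(1) Suc.IH smooth_onD[OF smooth_on_FD[OF gW]]])
          (use GH(2) in blast)
      then show "Ck_on k (\<lambda>y. H' y v) (G ` W)"
        unfolding H'_def using Wpos GH(2)
        by (intro Ck_on_Pair Ck_on_mult Ck_on_inverse Ck_on_diff Ck_on_const oGW) (auto simp: less_imp_neq[symmetric])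
    qed
  qed
  then have "smooth_on H (G ` W)" by (rule smooth_onI)
  then show ?thesis
    using W oGW HG unfolding G_def by blast
qed

text \<open>Replacing g by -g makes the derivative positive; the reflection \<open>N\<close> of the
  first coordinate undoes this on the image.\<close>

lemma straighten:
  fixes g :: "real \<times> 'v::fin_dim_inner \<Rightarrow> real"
  assumes O: "open O'" "z0 \<in> O'" and g: "smooth_on g O'" and ne: "FD g z0 (1, 0) \<noteq> 0"
  shows "\<exists>W H. open W \<and> z0 \<in> W \<and> W \<subseteq> O' \<and> open ((\<lambda>z. (g z, snd z)) ` W) \<and>
    smooth_on H ((\<lambda>z. (g z, snd z)) ` W) \<and> (\<forall>z\<in>W. H (g z, snd z) = z)"
proof (cases "FD g z0 (1, 0) > 0")
  case True
  then show ?thesis by (rule straighten_pos[OF O g])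
next
  case False
  have sm: "smooth_on (\<lambda>z. - g z) O'"
    using smooth_on_linear_compose[OF O(1) bounded_linear_minus[OF bounded_linear_ident] g] .
  have "FD (\<lambda>z. - g z) z0 = (\<lambda>v. - FD g z0 v)"
    by (intro FD_eqI has_derivative_minus smooth_on_FDERIV[OF g O(2)])
  then have "FD (\<lambda>z. - g z) z0 (1, 0) > 0" using False ne by simp
  from straighten_pos[OF O sm this] obtain W H where W: "open W" "z0 \<in> W" "W \<subseteq> O'"
    "open ((\<lambda>z. (- g z, snd z)) ` W)" "smooth_on H ((\<lambda>z. (- g z, snd z)) ` W)" "\<forall>z\<in>W. H (- g z, snd z) = z"
    by blast
  define N :: "real \<times> 'v \<Rightarrow> real \<times> 'v" where "N p = (- fst p, snd p)" for p
  have N: "bounded_linear N"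
    unfolding N_def[abs_def] by (intro linear_imp_bounded linearI) auto
  have im: "(\<lambda>z. (g z, snd z)) ` W = N -` ((\<lambda>z. (- g z, snd z)) ` W)"
    by (force simp: N_def)
  have o: "open ((\<lambda>z. (g z, snd z)) ` W)"
    unfolding im using W(4) linear_continuous_on[OF N] by (intro open_vimage) auto
  have "smooth_on (\<lambda>p. H (N p)) ((\<lambda>z. (g z, snd z)) ` W)"
    by (rule smooth_on_compose[OF o W(4) smooth_on_bounded_linear[OF o N] W(5)]) (auto simp: im)
  then show ?thesis
    using W o by (intro exI[of _ W] exI[of _ "\<lambda>p. H (N p)"]) (auto simp: N_def)
qed

section \<open>Jets of local sections\<close>

locale fibred =
  fixes A :: "('p, real \<times> 'v::fin_dim_inner) chart set" and \<pi> :: "'p \<Rightarrow> real"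
  assumes fibred: "fibred_manifold A \<pi>"
begin

abbreviation "jets \<equiv> jet_space A \<pi>"
abbreviation "sect \<equiv> local_section A \<pi>"
abbreviation "jet \<equiv> jet1 A \<pi>"
abbreviation "dJ \<equiv> d_J A \<pi>"
abbreviation "wedge_dt \<alpha> \<equiv> wedge_1form \<alpha> (dt_form A \<pi>)"
abbreviation "M \<equiv> maximal_atlas A"
abbreviation "FC \<equiv> fibred_charts A \<pi>"
abbreviation "JC \<equiv> jet_chart A \<pi>"
abbreviation vel :: "('p, real \<times> 'v) chart \<Rightarrow> (real \<Rightarrow> 'p) \<Rightarrow> real \<Rightarrow> real \<times> 'v" where
  "vel c \<gamma> t \<equiv> vector_derivative (snd c \<circ> \<gamma>) (at t)"

section \<open>Fibred charts from the submersion condition\<close>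

lemma atlas: "smooth_atlas A"
  using fibred by (simp add: fibred_manifold_def smooth_manifold_def)

lemma atlas_inj: "c \<in> A \<Longrightarrow> inj_on (snd c) (fst c)"
  using atlas by (simp add: smooth_atlas_def)

lemma atlas_maximal: "c \<in> A \<Longrightarrow> c \<in> M"
  using atlas_subset_maximal[OF atlas] by blast

lemma maximal_compatible: "c \<in> M \<Longrightarrow> d \<in> M \<Longrightarrow> compatible c d"
  by (rule maximal_atlas_compatible_charts[OF atlas])

lemma FC_M: "c \<in> FC \<Longrightarrow> c \<in> M" and FC_fst: "c \<in> FC \<Longrightarrow> p \<in> fst c \<Longrightarrow> fst (snd c p) = \<pi> p"
  by (simp_all add: fibred_charts_def)

lemma smooth_on_trans: "c \<in> M \<Longrightarrow> d \<in> M \<Longrightarrow> smooth_on (trn c d) (overlap c d)"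
  and open_overlap: "c \<in> M \<Longrightarrow> d \<in> M \<Longrightarrow> open (overlap c d)"
  using maximal_compatible by (simp_all add: compatible_smoothD compatible_openD)

lemma inv_chart: "c \<in> M \<Longrightarrow> p \<in> fst c \<Longrightarrow> chart_inv c (snd c p) = p"
  by (rule chart_inv_chart[OF maximal_atlas_inj])

lemma points_chart: "p \<in> points A \<Longrightarrow> \<exists>a\<in>A. p \<in> fst a"
  by (auto simp: points_def)

text \<open>
  A shear of the model space makes \<open>\<partial>f/\<partial>s\<close> nonzero for the coordinate expression \<open>f\<close> of \<open>\<pi>\<close>;
  then \<open>f\<close> can be taken as the first coordinate.
\<close>

lemma fibred_chart_exists:
  assumes p: "p \<in> points A" shows "\<exists>c\<in>FC. p \<in> fst c"
proof -
  obtain a where a: "a \<in> A" "p \<in> fst a" using points_chart[OF p] by blast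
  note aM = atlas_maximal[OF a(1)]
  define U where "U = snd a ` fst a"
  have U: "open U" unfolding U_def by (rule maximal_atlas_open[OF aM])
  define f where "f = \<pi> \<circ> chart_inv a"
  have f: "smooth_on f U" "surj (FD f (snd a p))"
    using fibred a by (simp_all add: fibred_manifold_def U_def f_def)
  have pU: "snd a p \<in> U" using a by (simp add: U_def)
  note lin = linear_FD[OF f(1) pU]
  \<comment> \<open>Otherwise all vectors (1, x), and with them their linear combinations, lie in
    the kernel, against surjectivity.\<close>
  have "\<exists>x. FD f (snd a p) (1, x) \<noteq> 0"
  proof (rule ccontr)
    assume "\<not> ?thesis"
    then have z: "FD f (snd a p) (1, x) = 0" for x by blast
    have "FD f (snd a p) (s, x) = 0" for s x
    proof -
      have "(s, x) = (s - 1) *\<^sub>R (1, 0) + (1, x)" by simp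
      then have "FD f (snd a p) (s, x) = (s - 1) *\<^sub>R FD f (snd a p) (1, 0) + FD f (snd a p) (1, x)"
        by (metis linear_add[OF lin] linear_scale[OF lin])
      then show ?thesis by (simp add: z)
    qed
    then have "range (FD f (snd a p)) \<subseteq> {0}" by auto
    then show False using f(2) by (metis UNIV_I singletonD subsetD zero_neq_one)
  qed
  then obtain x1 where x1: "FD f (snd a p) (1, x1) \<noteq> 0" by blast
  \<comment> \<open>The shear takes (1, 0) to (1, x1), a direction in which f has nonzero
    derivative.\<close>
  define T :: "real \<times> 'v \<Rightarrow> real \<times> 'v" where "T z = (fst z, snd z + fst z *\<^sub>R x1)" for z
  define T' :: "real \<times> 'v \<Rightarrow> real \<times> 'v" where "T' z = (fst z, snd z - fst z *\<^sub>R x1)" for z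
  have T: "bounded_linear T" "bounded_linear T'" and TT: "T (T' z) = z" "T' (T z) = z" for z
    unfolding T_def[abs_def] T'_def[abs_def]
    by (intro linear_imp_bounded linearI; simp add: algebra_simps)+ (simp_all add: T_def T'_def)
  define V where "V = T -` U"
  have V: "open V" unfolding V_def using U linear_continuous_on[OF T(1)] by (intro open_vimage) auto
  define g where "g z = f (T z)" for z
  have g: "smooth_on g V"
    unfolding g_def[abs_def]
    by (rule smooth_on_compose[OF V U smooth_on_bounded_linear[OF V T(1)] f(1)]) (auto simp: V_def)
  define z0 where "z0 = T' (snd a p)"
  have z0: "z0 \<in> V" "T z0 = snd a p" using pU by (simp_all add: z0_def V_def TT)
  have "FD g z0 (1, 0) = FD f (T z0) (FD T z0 (1, 0))"
    unfolding g_def[abs_def] using z0 pU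
    by (intro FD_chain[OF smooth_on_bounded_linear[OF V T(1)] z0(1) f(1)]) simp
  also have "\<dots> = FD f (snd a p) (1, x1)"
    using FD_eqI[OF bounded_linear_imp_has_derivative[OF T(1)]] by (simp add: z0(2)) (simp add: T_def)
  finally have "FD g z0 (1, 0) \<noteq> 0" using x1 by simp
  from straighten[OF V z0(1) g this] obtain W H where W: "open W" "z0 \<in> W" "W \<subseteq> V"
    and GW: "open ((\<lambda>z. (g z, snd z)) ` W)" and H: "smooth_on H ((\<lambda>z. (g z, snd z)) ` W)"
    "\<forall>z\<in>W. H (g z, snd z) = z"
    by blast
  define W' where "W' = T' -` W"
  \<comment> \<open>The straightening map written in the original coordinates of a; on points of the
    manifold its first component is \<pi>.\<close>
  define \<phi> where "\<phi> z = (f z, snd (T' z))" for z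
  have W': "open W'" unfolding W'_def using W(1) linear_continuous_on[OF T(2)] by (intro open_vimage) auto
  have W'U: "W' \<subseteq> U" using W(3) TT(1) by (force simp: W'_def V_def)
  have \<phi>W: "\<phi> ` W' = (\<lambda>z. (g z, snd z)) ` W"
  proof -
    have "\<phi> = (\<lambda>z. (g z, snd z)) \<circ> T'" by (simp add: \<phi>_def g_def TT fun_eq_iff)
    moreover have "T' ` W' = W"
      unfolding W'_def by (rule surj_image_vimage_eq[OF surjI[of T' T]]) (rule TT(2))
    ultimately show ?thesis by (simp only: image_comp[symmetric])
  qed
  have \<phi>: "smooth_on \<phi> W'"
    unfolding \<phi>_def[abs_def]
    by (intro smooth_on_Pair smooth_on_snd smooth_on_bounded_linear T W' smooth_on_subset[OF f(1) W'U])
  have T'eq: "H (\<phi> z) = T' z" if "z \<in> W'" for z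
  proof -
    have "T' z \<in> W" using that by (simp add: W'_def)
    then have "H (g (T' z), snd (T' z)) = T' z" using H(2) by blast
    then show ?thesis by (simp add: \<phi>_def g_def TT)
  qed
  have \<psi>: "smooth_on (\<lambda>y. T (H y)) (\<phi> ` W')"
    using GW H(1) by (simp add: \<phi>W smooth_on_linear_compose[OF _ T(1)])
  define c where "c = ({q \<in> fst a. snd a q \<in> W'}, \<phi> \<circ> snd a)"
  have "c \<in> M"
    unfolding c_def using GW W'U
    by (intro maximal_atlas_reparam[OF atlas aM W' _ \<phi> _ \<psi>]) (auto simp: U_def \<phi>W T'eq TT)
  moreover have "fst (snd c q) = \<pi> q" if "q \<in> fst c" for q
    using that by (simp add: c_def \<phi>_def f_def inv_chart[OF aM])
  moreover have "p \<in> fst c" using a(2) W(2) by (simp add: c_def W'_def z0_def)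
  ultimately show ?thesis unfolding fibred_charts_def by blast
qed

text \<open>Smoothness of a section is postulated in the charts of A; composition with a transition
  map carries it to any chart of the maximal atlas near t.\<close>

lemma section_in_chart:
  assumes \<gamma>: "sect t \<gamma>" and c: "c \<in> M" "\<gamma> t \<in> fst c"
  shows "\<exists>T. open T \<and> t \<in> T \<and> (\<forall>s\<in>T. \<gamma> s \<in> fst c \<and> \<pi> (\<gamma> s) = s) \<and> smooth_on (snd c \<circ> \<gamma>) T"
proof -
  obtain I where I: "open I" "t \<in> I" "\<gamma> ` I \<subseteq> points A" "\<forall>s\<in>I. \<pi> (\<gamma> s) = s"
    "\<forall>a\<in>A. open {s \<in> I. \<gamma> s \<in> fst a} \<and> smooth_on (snd a \<circ> \<gamma>) {s \<in> I. \<gamma> s \<in> fst a}"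
    using \<gamma> unfolding local_section_def by blast
  obtain a where a: "a \<in> A" "\<gamma> t \<in> fst a" using I points_chart by blast
  note aM = atlas_maximal[OF a(1)]
  define T0 where "T0 = {s \<in> I. \<gamma> s \<in> fst a}"
  have T0: "open T0" "smooth_on (snd a \<circ> \<gamma>) T0" using I(5) a(1) by (simp_all add: T0_def)
  define V where "V = overlap a c"
  have V: "open V" unfolding V_def by (rule open_overlap[OF aM c(1)])
  define T where "T = {s \<in> T0. (snd a \<circ> \<gamma>) s \<in> V}"
  have T: "open T" unfolding T_def by (rule open_preimage[OF smooth_imp_continuous_on[OF T0(2)] T0(1) V])
  have tT: "t \<in> T" using I(2) a(2) c(2) by (simp add: T_def T0_def V_def)
  have in_c: "\<gamma> s \<in> fst c" if "s \<in> T" for s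
  proof -
    from that obtain q where q: "q \<in> fst a" "q \<in> fst c" "snd a (\<gamma> s) = snd a q" "\<gamma> s \<in> fst a"
      by (auto simp: T_def T0_def V_def)
    then have "\<gamma> s = q" using inj_onD[OF atlas_inj[OF a(1)]] by blast
    then show ?thesis using q by simp
  qed
  have "smooth_on (\<lambda>s. trn a c ((snd a \<circ> \<gamma>) s)) T"
    by (rule smooth_on_compose[OF T V smooth_on_subset[OF T0(2)]])
      (use smooth_on_trans[OF aM c(1)] in \<open>auto simp: T_def V_def o_def\<close>)
  then have "smooth_on (snd c \<circ> \<gamma>) T"
    by (rule smooth_on_cong[OF T, rotated]) (simp add: inv_chart[OF aM] T_def T0_def)
  then show ?thesis using T tT in_c I(4) by (intro exI[of _ T]) (auto simp: T_def T0_def)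
qed

section \<open>Velocities of sections and equality of jets\<close>

lemma section_target: "sect t \<gamma> \<Longrightarrow> \<gamma> t \<in> points A \<and> \<pi> (\<gamma> t) = t"
  unfolding local_section_def by blast

lemma vel_derivative:
  assumes \<gamma>: "sect t \<gamma>" and c: "c \<in> M" "\<gamma> t \<in> fst c"
  shows "((snd c \<circ> \<gamma>) has_derivative (\<lambda>r. r *\<^sub>R vel c \<gamma> t)) (at t)"
proof -
  obtain T where "t \<in> T" "smooth_on (snd c \<circ> \<gamma>) T" using section_in_chart[OF assms] by blast
  then have "(snd c \<circ> \<gamma>) differentiable (at t)"
    using smooth_on_FDERIV differentiableI by blast
  then show ?thesis
    unfolding vector_derivative_works has_vector_derivative_def .
qed

lemma vel_change:
  assumes \<gamma>: "sect t \<gamma>" and c: "c \<in> M" "\<gamma> t \<in> fst c" and d: "d \<in> M" "\<gamma> t \<in> fst d"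
  shows "vel d \<gamma> t = FD (trn c d) (snd c (\<gamma> t)) (vel c \<gamma> t)"
proof -
  obtain T where T: "open T" "t \<in> T" "\<forall>s\<in>T. \<gamma> s \<in> fst c" using section_in_chart[OF \<gamma> c] by blast
  have z: "snd c (\<gamma> t) \<in> overlap c d" using c d by blast
  note sm = smooth_on_trans[OF c(1) d(1)]
  have "((\<lambda>s. trn c d ((snd c \<circ> \<gamma>) s)) has_derivative
      (\<lambda>r. FD (trn c d) ((snd c \<circ> \<gamma>) t) (r *\<^sub>R vel c \<gamma> t))) (at t)"
    using z by (intro has_derivative_compose[OF vel_derivative[OF \<gamma> c]] smooth_on_FDERIV[OF sm]) simp
  then have "((\<lambda>s. trn c d ((snd c \<circ> \<gamma>) s)) has_derivative
      (\<lambda>r. r *\<^sub>R FD (trn c d) (snd c (\<gamma> t)) (vel c \<gamma> t))) (at t)"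
    by (simp add: linear_scale[OF linear_FD[OF sm z]])
  then have "((snd d \<circ> \<gamma>) has_derivative (\<lambda>r. r *\<^sub>R FD (trn c d) (snd c (\<gamma> t)) (vel c \<gamma> t))) (at t)"
    by (rule has_derivative_transform_within_open[OF _ T(1,2)]) (simp add: inv_chart[OF c(1)] T(3))
  then show ?thesis
    by (intro vector_derivative_at) (simp add: has_vector_derivative_def)
qed

text \<open>The first fibred coordinate along a section is \<pi> along the section, that is, the
  identity of the line.\<close>

lemma fst_vel:
  assumes \<gamma>: "sect t \<gamma>" and c: "c \<in> FC" "\<gamma> t \<in> fst c"
  shows "fst (vel c \<gamma> t) = 1"
proof -
  note cM = FC_M[OF c(1)]
  obtain T where T: "open T" "t \<in> T" "\<forall>s\<in>T. \<gamma> s \<in> fst c \<and> \<pi> (\<gamma> s) = s"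
    using section_in_chart[OF \<gamma> cM c(2)] by blast
  have "((\<lambda>s. fst ((snd c \<circ> \<gamma>) s)) has_derivative (\<lambda>r. fst (r *\<^sub>R vel c \<gamma> t))) (at t)"
    by (rule has_derivative_fst[OF vel_derivative[OF \<gamma> cM c(2)]])
  then have "((\<lambda>s. s) has_derivative (\<lambda>r. fst (r *\<^sub>R vel c \<gamma> t))) (at t)"
    by (rule has_derivative_transform_within_open[OF _ T(1,2)]) (simp add: FC_fst[OF c(1)] T(3))
  then have "(\<lambda>r. fst (r *\<^sub>R vel c \<gamma> t)) = (\<lambda>r. r)"
    using has_derivative_unique has_derivative_ident by blast
  from fun_cong[OF this, of 1] show ?thesis by simp
qed

text \<open>\<open>jet1\<close> compares velocities in the charts of A, induced coordinates read
  them in fibred charts. Velocities in different charts determine each other, so a single chart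
  decides.\<close>

lemma jet1_eqI:
  assumes \<gamma>: "sect t \<gamma>" and \<eta>: "sect t \<eta>" and eq: "\<gamma> t = \<eta> t"
    and c: "c \<in> M" "\<gamma> t \<in> fst c" and v: "vel c \<gamma> t = vel c \<eta> t"
  shows "jet t \<gamma> = jet t \<eta>"
proof -
  have "vel a \<gamma> t = vel a \<eta> t" if "a \<in> charts_at A (\<eta> t)" for a
    using vel_change[OF \<gamma> c atlas_maximal, of a] vel_change[OF \<eta> c(1) _ atlas_maximal, of a] that c(2) v eq
    by (simp add: charts_at_def)
  then show ?thesis unfolding jet1_def eq by auto
qed

text \<open>The converse passage, needed because \<open>jet_chart\<close> reads the velocity off a
  representative chosen by \<open>SOME\<close>.\<close>

lemma jet1_class_vel:
  assumes \<gamma>: "sect t \<gamma>" and \<eta>: "\<eta> \<in> snd (jet t \<gamma>)" and c: "c \<in> M" "\<gamma> t \<in> fst c"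
  shows "vel c \<eta> t = vel c \<gamma> t"
proof -
  have e: "sect t \<eta>" "\<eta> t = \<gamma> t" "\<And>a. a \<in> charts_at A (\<gamma> t) \<Longrightarrow> vel a \<eta> t = vel a \<gamma> t"
    using \<eta> by (auto simp: jet1_def)
  obtain a where a: "a \<in> A" "\<gamma> t \<in> fst a" using section_target[OF \<gamma>] points_chart by blast
  then show ?thesis
    using vel_change[OF \<gamma> atlas_maximal[OF a(1)] a(2) c] vel_change[OF e(1) atlas_maximal[OF a(1)] _ c(1)] e(2,3) c(2)
    by (simp add: charts_at_def)
qed

lemma jet_chart_jet1:
  assumes \<gamma>: "sect t \<gamma>" and c: "c \<in> FC" "\<gamma> t \<in> fst c"
  shows "snd (JC c) (jet t \<gamma>) = (t, snd (snd c (\<gamma> t)), snd (vel c \<gamma> t))"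
proof -
  have "\<gamma> \<in> snd (jet t \<gamma>)" using \<gamma> by (simp add: jet1_def)
  then have "(SOME \<eta>. \<eta> \<in> snd (jet t \<gamma>)) \<in> snd (jet t \<gamma>)"
    by (rule someI[of "\<lambda>\<eta>. \<eta> \<in> snd (jet t \<gamma>)"])
  from jet1_class_vel[OF \<gamma> this FC_M[OF c(1)] c(2)] section_target[OF \<gamma>]
  show ?thesis by (simp add: jet_chart_def Let_def) (simp add: jet1_def)
qed

lemma fst_jet1: "fst (jet t \<gamma>) = \<gamma> t"
  by (simp add: jet1_def)

text \<open>For z = (t, x, y) this curve is affine in the chart c, passing through (t, x) with slope
  y: an explicit representative of the jet with coordinates z.\<close>

definition line :: "('p, real \<times> 'v) chart \<Rightarrow> 'v jcoord \<Rightarrow> real \<Rightarrow> 'p" where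
  "line c z s = chart_inv c (s, fst (snd z) + (s - fst z) *\<^sub>R snd (snd z))"

abbreviation base :: "'v jcoord \<Rightarrow> real \<times> 'v" where
  "base z \<equiv> (fst z, fst (snd z))"

lemma line:
  assumes c: "c \<in> FC" and z: "base z \<in> snd c ` fst c"
  shows "sect (fst z) (line c z)" "line c z (fst z) = chart_inv c (base z)"
    "vel c (line c z) (fst z) = (1, snd (snd z))"
proof -
  note cM = FC_M[OF c]
  define l where "l s = (s, fst (snd z) + (s - fst z) *\<^sub>R snd (snd z))" for s
  have line: "line c z s = chart_inv c (l s)" for s by (simp add: line_def l_def)
  have sm: "smooth_on l S" if "open S" for S
    unfolding l_def[abs_def] by (intro smooth_on_Pair smooth_on_add smooth_on_scaleR smooth_on_diff
        smooth_on_const smooth_on_ident that)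
  define I where "I = {s. l s \<in> snd c ` fst c}"
  have pre: "open {s. l s \<in> V}" if "open V" for V
    using open_preimage[OF smooth_imp_continuous_on[OF sm[OF open_UNIV]] open_UNIV that] by simp
  have I: "open I" unfolding I_def by (rule pre[OF maximal_atlas_open[OF cM]])
  have lz: "l (fst z) = base z" by (simp add: l_def)
  have tI: "fst z \<in> I" using z by (simp add: I_def lz)
  have in_c: "line c z s \<in> fst c" and coord: "snd c (line c z s) = l s" if "s \<in> I" for s
    using that by (simp_all add: line I_def chart_inv_in chart_chart_inv)
  have pi: "\<pi> (line c z s) = s" if "s \<in> I" for s
    using FC_fst[OF c in_c[OF that]] coord[OF that] by (simp add: l_def)
  have "open {s \<in> I. line c z s \<in> fst a} \<and> smooth_on (snd a \<circ> line c z) {s \<in> I. line c z s \<in> fst a}"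
    if a: "a \<in> A" for a
  proof -
    have eq: "{s \<in> I. line c z s \<in> fst a} = {s. l s \<in> overlap c a}"
    proof (intro equalityI subsetI)
      fix s assume "s \<in> {s \<in> I. line c z s \<in> fst a}"
      then have s: "s \<in> I" "line c z s \<in> fst a" by auto
      then show "s \<in> {s. l s \<in> overlap c a}"
        using coord[OF s(1), symmetric] in_c[OF s(1)] by auto
    next
      fix s assume "s \<in> {s. l s \<in> overlap c a}"
      then obtain q where "q \<in> fst c" "q \<in> fst a" "l s = snd c q" by auto
      then show "s \<in> {s \<in> I. line c z s \<in> fst a}"
        by (simp add: line I_def inv_chart[OF cM])
    qed
    have o: "open {s \<in> I. line c z s \<in> fst a}"
      unfolding eq by (rule pre[OF open_overlap[OF cM atlas_maximal[OF a]]])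
    have "smooth_on (\<lambda>s. trn c a (l s)) {s \<in> I. line c z s \<in> fst a}"
      by (rule smooth_on_compose[OF o open_overlap[OF cM atlas_maximal[OF a]] sm[OF o] smooth_on_trans[OF cM atlas_maximal[OF a]]])
        (auto simp: eq)
    then show ?thesis using o by (simp add: o_def line)
  qed
  then show ls: "sect (fst z) (line c z)"
    unfolding local_section_def using I tI in_c maximal_atlas_points[OF cM] pi
    by (intro exI[of _ I]) auto
  show "line c z (fst z) = chart_inv c (base z)" by (simp add: line lz)
  have "(l has_derivative (\<lambda>r. r *\<^sub>R (1, snd (snd z)))) (at (fst z))"
    unfolding l_def[abs_def] by (auto intro!: derivative_eq_intros)
  then have "((snd c \<circ> line c z) has_derivative (\<lambda>r. r *\<^sub>R (1, snd (snd z)))) (at (fst z))"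
    by (rule has_derivative_transform_within_open[OF _ I tI]) (simp add: coord)
  then show "vel c (line c z) (fst z) = (1, snd (snd z))"
    by (intro vector_derivative_at) (simp add: has_vector_derivative_def)
qed

section \<open>Induced charts and their transition maps\<close>

lemma fst_JC: "fst (JC c) = {j \<in> jets. fst j \<in> fst c}"
  by (simp add: jet_chart_def)

lemma jet_cases:
  assumes "j \<in> jets" obtains t \<gamma> where "sect t \<gamma>" "j = jet t \<gamma>"
  using assms by (auto simp: jet_space_def)

lemma JC_base:
  assumes c: "c \<in> FC" and j: "j \<in> fst (JC c)" shows "base (snd (JC c) j) = snd c (fst j)"
proof -
  obtain t \<gamma> where \<gamma>: "sect t \<gamma>" "j = jet t \<gamma>" "\<gamma> t \<in> fst c"
    using j by (auto simp: fst_JC fst_jet1 elim!: jet_cases)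
  show ?thesis
    unfolding \<gamma>(2) fst_jet1 jet_chart_jet1[OF \<gamma>(1) c \<gamma>(3)]
    using FC_fst[OF c \<gamma>(3)] section_target[OF \<gamma>(1)] by (simp add: prod_eq_iff)
qed

text \<open>The coordinates record only the second component of the velocity; the first is always 1
  by \<open>fst_vel\<close>, so the full velocity, and with it the jet, is recovered.\<close>

lemma inj_on_JC:
  assumes c: "c \<in> FC" shows "inj_on (snd (JC c)) (fst (JC c))"
proof (rule inj_onI)
  fix j1 j2 assume j: "j1 \<in> fst (JC c)" "j2 \<in> fst (JC c)" and eq: "snd (JC c) j1 = snd (JC c) j2"
  obtain t1 \<gamma>1 where g1: "sect t1 \<gamma>1" "j1 = jet t1 \<gamma>1" "\<gamma>1 t1 \<in> fst c"
    using j(1) by (auto simp: fst_JC fst_jet1 elim!: jet_cases)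
  obtain t2 \<gamma>2 where g2: "sect t2 \<gamma>2" "j2 = jet t2 \<gamma>2" "\<gamma>2 t2 \<in> fst c"
    using j(2) by (auto simp: fst_JC fst_jet1 elim!: jet_cases)
  note e1 = jet_chart_jet1[OF g1(1) c g1(3)] and e2 = jet_chart_jet1[OF g2(1) c g2(3)]
  have t: "t1 = t2" using e1 e2 eq g1(2) g2(2) by simp
  have "snd c (\<gamma>1 t1) = snd c (\<gamma>2 t2)"
    using JC_base[OF c j(1)] JC_base[OF c j(2)] eq by (simp add: g1(2) g2(2) fst_jet1)
  then have p: "\<gamma>1 t1 = \<gamma>2 t1"
    using inj_onD[OF maximal_atlas_inj[OF FC_M[OF c]]] g1(3) g2(3) t by blast
  have "vel c \<gamma>1 t1 = vel c \<gamma>2 t1"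
    using e1 e2 eq g1(2) g2(2) t fst_vel[OF g1(1) c g1(3)] fst_vel[OF g2(1) c g2(3)] by (simp add: prod_eq_iff)
  then show "j1 = j2"
    using jet1_eqI[OF g1(1) g2(1)[folded t] p FC_M[OF c] g1(3)] g1(2) g2(2) t by simp
qed

text \<open>The slope y of a line is arbitrary, so the image of an induced chart consists of whole
  fibres. The radial homotopy can therefore run inside a single chart.\<close>

lemma jet_of_line:
  assumes c: "c \<in> FC" and z: "base z \<in> snd c ` fst c"
  shows "jet (fst z) (line c z) \<in> fst (JC c)" "snd (JC c) (jet (fst z) (line c z)) = z"
proof -
  note l = line[OF assms]
  have inc: "line c z (fst z) \<in> fst c" using l(2) chart_inv_in[OF z] by simp
  show "jet (fst z) (line c z) \<in> fst (JC c)"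
    using l(1) inc by (auto simp: fst_JC jet_space_def fst_jet1)
  show "snd (JC c) (jet (fst z) (line c z)) = z"
    using jet_chart_jet1[OF l(1) c inc] l(2,3) chart_chart_inv[OF z] by (simp add: prod_eq_iff)
qed

lemma JC_image_overlap:
  assumes c: "c \<in> FC" and d: "d \<in> FC"
  shows "overlap (JC c) (JC d) = {z. base z \<in> overlap c d}"
proof (intro equalityI subsetI)
  fix z assume "z \<in> overlap (JC c) (JC d)"
  then obtain j where j: "j \<in> fst (JC c)" "j \<in> fst (JC d)" "z = snd (JC c) j" by auto
  then show "z \<in> {z. base z \<in> overlap c d}"
    using JC_base[OF c j(1)] by (auto simp: fst_JC)
next
  fix z assume "z \<in> {z. base z \<in> overlap c d}"
  then have z: "base z \<in> overlap c d" by simp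
  then have z': "base z \<in> snd c ` fst c" by blast
  have "chart_inv c (base z) \<in> fst d" using z inv_chart[OF FC_M[OF c]] by auto
  then have "jet (fst z) (line c z) \<in> fst (JC d)"
    using jet_of_line(1)[OF c z'] line(2)[OF c z'] by (simp add: fst_JC fst_jet1)
  then show "z \<in> overlap (JC c) (JC d)"
    using jet_of_line[OF c z'] by (intro image_eqI[of _ _ "jet (fst z) (line c z)"]) auto
qed

lemma JC_inv:
  assumes c: "c \<in> FC" and z: "base z \<in> snd c ` fst c"
  shows "chart_inv (JC c) z = jet (fst z) (line c z)"
  using chart_inv_chart[OF inj_on_JC[OF c] jet_of_line(1)[OF assms]] jet_of_line(2)[OF assms] by simp

text \<open>The prolonged coordinate change: y' is the total derivative of x', that is,
  \<partial>x'/\<partial>t + (\<partial>x'/\<partial>x) y.\<close>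

definition jtrans :: "('p, real \<times> 'v) chart \<Rightarrow> ('p, real \<times> 'v) chart \<Rightarrow> 'v jcoord \<Rightarrow> 'v jcoord" where
  "jtrans c d z = (fst z, snd (trn c d (base z)), snd (FD (trn c d) (base z) (1, snd (snd z))))"

lemma JC_trans:
  assumes c: "c \<in> FC" and d: "d \<in> FC" and z: "base z \<in> overlap c d"
  shows "snd (JC d) (chart_inv (JC c) z) = jtrans c d z"
proof -
  have z': "base z \<in> snd c ` fst c" using z by blast
  note l = line[OF c z']
  have inc: "line c z (fst z) \<in> fst c" using l(2) chart_inv_in[OF z'] by simp
  have ind: "line c z (fst z) \<in> fst d" using l(2) z inv_chart[OF FC_M[OF c]] by auto
  show ?thesis
    unfolding JC_inv[OF c z'] jet_chart_jet1[OF l(1) d ind] jtrans_def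
    using vel_change[OF l(1) FC_M[OF c] inc FC_M[OF d] ind] l(2,3) chart_chart_inv[OF z'] by simp
qed

lemma open_base:
  assumes "open V" shows "open {z :: real \<times> 'v \<times> 'v. base z \<in> V}"
  using open_vimage[OF assms, of base] by (simp add: vimage_def continuous_intros)

lemma smooth_on_base: "open S \<Longrightarrow> smooth_on base S"
  by (intro smooth_on_Pair smooth_on_fst smooth_on_snd smooth_on_ident)

lemma smooth_on_jtrans:
  assumes c: "c \<in> FC" and d: "d \<in> FC"
  shows "smooth_on (jtrans c d) {z. base z \<in> overlap c d}"
proof -
  note cd = open_overlap[OF FC_M[OF c] FC_M[OF d]] smooth_on_trans[OF FC_M[OF c] FC_M[OF d]]
  note o = open_base[OF cd(1)]
  show ?thesis
    unfolding jtrans_def[abs_def]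
    by (intro smooth_on_Pair[OF o] smooth_on_snd[OF o] smooth_on_fst[OF o] smooth_on_ident[OF o] smooth_on_const
        smooth_on_compose[OF o cd(1) smooth_on_base[OF o] cd(2)]
        smooth_on_FD_apply[OF o cd(1) cd(2) smooth_on_base[OF o]]) auto
qed

lemma compatible_JC:
  assumes c: "c \<in> FC" and d: "d \<in> FC" shows "compatible (JC c) (JC d)"
proof -
  have *: "open (overlap (JC c) (JC d)) \<and>
      smooth_on (snd (JC d) \<circ> chart_inv (JC c)) (overlap (JC c) (JC d))"
    if c: "c \<in> FC" and d: "d \<in> FC" for c d
  proof
    note o = open_base[OF open_overlap[OF FC_M[OF c] FC_M[OF d]]]
    show "open (overlap (JC c) (JC d))" unfolding JC_image_overlap[OF c d] by (rule o)
    show "smooth_on (snd (JC d) \<circ> chart_inv (JC c)) (overlap (JC c) (JC d))"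
      unfolding JC_image_overlap[OF c d]
      by (rule smooth_on_cong[OF o _ smooth_on_jtrans[OF c d]]) (simp add: JC_trans[OF c d])
  qed
  show ?thesis unfolding compatible_def using *[OF c d] *[OF d c] by (simp add: Int_commute)
qed

lemma smooth_jet_atlas: "smooth_atlas (jet_atlas A \<pi>)"
  unfolding smooth_atlas_def jet_atlas_def using inj_on_JC compatible_JC by blast

lemma jet_chart_exists:
  assumes "j \<in> jets" shows "\<exists>c\<in>FC. j \<in> fst (JC c)"
proof -
  have "fst j \<in> points A" using assms section_target by (auto simp: fst_jet1 elim!: jet_cases)
  then show ?thesis using fibred_chart_exists assms by (auto simp: fst_JC)
qed

lemma jet_atlas_points: "points (jet_atlas A \<pi>) = jets"
  using jet_chart_exists by (auto simp: points_def jet_atlas_def fst_JC)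

end

section \<open>Tangent vectors and forms in charts\<close>

locale atlas_loc =
  fixes B :: "('q, 'e::fin_dim_inner) chart set"
  assumes B: "smooth_atlas B"
begin

abbreviation "tv \<equiv> tangent_vector B"
abbreviation "comps c vs \<equiv> map (\<lambda>v. v c) vs"

definition lrep :: "('q, 'e) chart \<Rightarrow> ('q, 'e) form \<Rightarrow> 'e \<Rightarrow> 'e list \<Rightarrow> real" where
  "lrep c \<omega> z us = \<omega> (chart_inv c z) (map (tv c (chart_inv c z)) us)"

lemma compat: "c \<in> B \<Longrightarrow> d \<in> B \<Longrightarrow> compatible c d"
  and inj: "c \<in> B \<Longrightarrow> inj_on (snd c) (fst c)"
  using B by (simp_all add: smooth_atlas_def)

lemma inv_eq: "c \<in> B \<Longrightarrow> p \<in> fst c \<Longrightarrow> chart_inv c (snd c p) = p"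
  using inj chart_inv_chart by metis

lemma smooth_on_trn: "c \<in> B \<Longrightarrow> d \<in> B \<Longrightarrow> smooth_on (trn c d) (overlap c d)"
  and open_ov: "c \<in> B \<Longrightarrow> d \<in> B \<Longrightarrow> open (overlap c d)"
  using compat by (simp_all add: compatible_smoothD compatible_openD)

lemma charts_atD: "c \<in> charts_at B p \<Longrightarrow> c \<in> B" "c \<in> charts_at B p \<Longrightarrow> p \<in> fst c"
  by (simp_all add: charts_at_def)

lemma some_chart_in: "p \<in> points B \<Longrightarrow> some_chart B p \<in> charts_at B p"
  unfolding some_chart_def by (rule someI_ex) (auto simp: points_def charts_at_def)

lemma in_overlap: "c \<in> charts_at B p \<Longrightarrow> d \<in> charts_at B p \<Longrightarrow> snd c p \<in> overlap c d"
  by (auto simp: charts_at_def)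

lemma linear_FD_trn: "c \<in> charts_at B p \<Longrightarrow> d \<in> charts_at B p \<Longrightarrow> linear (FD (trn c d) (snd c p))"
  using linear_FD[OF smooth_on_trn in_overlap] charts_atD by blast

lemma FD_trn_self: "c \<in> charts_at B p \<Longrightarrow> FD (trn c c) (snd c p) u = u"
proof -
  assume c: "c \<in> charts_at B p"
  note cB = charts_atD(1)[OF c]
  have "FD (trn c c) (snd c p) = FD (\<lambda>z. z) (snd c p)"
    by (rule FD_cong_open[OF open_ov[OF cB cB] in_overlap[OF c c]]) (auto simp: inv_eq[OF cB])
  then show ?thesis by simp
qed

lemma FD_trn_cocycle:
  assumes c: "c \<in> charts_at B p" and d: "d \<in> charts_at B p" and e: "e \<in> charts_at B p"
  shows "FD (trn c e) (snd c p) u = FD (trn d e) (snd d p) (FD (trn c d) (snd c p) u)"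
proof -
  note cB = charts_atD(1)[OF c] and dB = charts_atD(1)[OF d] and eB = charts_atD(1)[OF e]
  have v: "trn c d (snd c p) = snd d p" using c by (simp add: inv_eq charts_at_def)
  define W where "W = snd c ` (fst c \<inter> fst d \<inter> fst e)"
  have W: "open W" unfolding W_def by (rule compatible_through(1)[OF inj[OF cB] inj[OF dB] compat[OF cB dB] compat[OF dB eB]])
  have "FD (trn c e) (snd c p) u = FD (\<lambda>z. trn d e (trn c d z)) (snd c p) u"
    by (rule fun_cong[OF FD_cong_open[OF W]])
      (use c d e in \<open>auto simp: W_def charts_at_def inv_eq[OF cB] inv_eq[OF dB]\<close>)
  also have "FD (\<lambda>z. trn d e (trn c d z)) (snd c p) u = FD (trn d e) (trn c d (snd c p)) (FD (trn c d) (snd c p) u)"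
    using in_overlap[OF d e]
    by (intro FD_chain[OF smooth_on_trn[OF cB dB] in_overlap[OF c d] smooth_on_trn[OF dB eB]]) (simp only: v)
  finally show ?thesis by (simp only: v)
qed

lemma tv_comp: "c \<in> charts_at B p \<Longrightarrow> d \<in> charts_at B p \<Longrightarrow> tv c p u d = FD (trn c d) (snd c p) u"
  by (simp add: tangent_vector_def)

lemma tv_comp_self: "c \<in> charts_at B p \<Longrightarrow> tv c p u c = u"
  by (simp add: tv_comp FD_trn_self)

lemma tv_in: "c \<in> charts_at B p \<Longrightarrow> tv c p u \<in> tangent_space B p"
  by (auto simp: tangent_space_def tangent_vector_def intro: FD_trn_cocycle)

lemma tspace_trans:
  "v \<in> tangent_space B p \<Longrightarrow> c \<in> charts_at B p \<Longrightarrow> d \<in> charts_at B p \<Longrightarrow> v d = FD (trn c d) (snd c p) (v c)"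
  unfolding tangent_space_def by blast

lemma tspace_eq_tv: "v \<in> tangent_space B p \<Longrightarrow> c \<in> charts_at B p \<Longrightarrow> tv c p (v c) = v"
proof
  fix d
  assume v: "v \<in> tangent_space B p" and c: "c \<in> charts_at B p"
  show "tv c p (v c) d = v d"
  proof (cases "d \<in> charts_at B p")
    case True
    show ?thesis unfolding tv_comp[OF c True] by (rule tspace_trans[OF v c True, symmetric])
  next
    case False
    then have "v d = 0" using v unfolding tangent_space_def by blast
    then show ?thesis using False by (simp add: tangent_vector_def)
  qed
qed

lemma tv_lin:
  "c \<in> charts_at B p \<Longrightarrow> tv c p (a *\<^sub>R u + b *\<^sub>R w) = (\<lambda>d. a *\<^sub>R tv c p u d + b *\<^sub>R tv c p w d)"
proof
  fix d
  assume c: "c \<in> charts_at B p"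
  show "tv c p (a *\<^sub>R u + b *\<^sub>R w) d = a *\<^sub>R tv c p u d + b *\<^sub>R tv c p w d"
  proof (cases "d \<in> charts_at B p")
    case True
    note lin = linear_FD_trn[OF c True]
    show ?thesis unfolding tv_comp[OF c True] linear_add[OF lin] linear_scale[OF lin] ..
  next
    case False
    then show ?thesis by (simp add: tangent_vector_def)
  qed
qed

lemma tv_change: "c \<in> charts_at B p \<Longrightarrow> d \<in> charts_at B p \<Longrightarrow> tv c p u = tv d p (FD (trn c d) (snd c p) u)"
proof
  fix e
  assume c: "c \<in> charts_at B p" and d: "d \<in> charts_at B p"
  show "tv c p u e = tv d p (FD (trn c d) (snd c p) u) e"
  proof (cases "e \<in> charts_at B p")
    case True
    show ?thesis unfolding tv_comp[OF c True] tv_comp[OF d True] by (rule FD_trn_cocycle[OF c d True])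
  next
    case False
    then show ?thesis by (simp add: tangent_vector_def)
  qed
qed

lemma tuple_comps:
  assumes "vs \<in> tangent_tuples B k p" "c \<in> charts_at B p"
  shows "map (tv c p) (comps c vs) = vs" "length (comps c vs) = k"
proof -
  have "map (\<lambda>v. tv c p (v c)) vs = vs"
    by (rule map_idI) (use assms in \<open>auto simp: tangent_tuples_def intro!: tspace_eq_tv\<close>)
  then show "map (tv c p) (comps c vs) = vs" by (simp add: o_def)
  show "length (comps c vs) = k" using assms(1) by (simp add: tangent_tuples_def)
qed

lemma map_tv_tuple: "c \<in> charts_at B p \<Longrightarrow> length us = k \<Longrightarrow> map (tv c p) us \<in> tangent_tuples B k p"
  by (auto simp: tangent_tuples_def tv_in)

lemma comps_map_tv: "c \<in> charts_at B p \<Longrightarrow> comps c (map (tv c p) us) = us"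
  by (simp add: tv_comp_self map_idI o_def)

section \<open>Forms in coordinates\<close>

lemma k_form_lin:
  assumes "k_form B k U \<omega>" "p \<in> U" "vs \<in> tangent_tuples B k p" "i < k"
    "v \<in> tangent_space B p" "w \<in> tangent_space B p"
  shows "\<omega> p (vs[i := (\<lambda>c. a *\<^sub>R v c + b *\<^sub>R w c)]) = a * \<omega> p (vs[i := v]) + b * \<omega> p (vs[i := w])"
  by (rule conjunct1[OF assms(1)[unfolded k_form_def], rule_format, OF assms(2-6)])

lemma k_form_alt:
  assumes "k_form B k U \<omega>" "p \<in> U" "vs \<in> tangent_tuples B k p" "i < j" "j < k" "vs ! i = vs ! j"
  shows "\<omega> p vs = 0"
  by (rule conjunct1[OF conjunct2[OF assms(1)[unfolded k_form_def]], rule_format, OF assms(2,3)])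
    (use assms(4-6) in blast)

lemma k_form_smooth:
  assumes "k_form B k U \<omega>" "c \<in> B" "length us = k"
  shows "smooth_on (\<lambda>z. lrep c \<omega> z us) (snd c ` (U \<inter> fst c))"
  unfolding lrep_def
  by (rule conjunct2[OF conjunct2[OF assms(1)[unfolded k_form_def]], rule_format, OF assms(2,3)])

lemma alternating_k_form:
  assumes \<omega>: "k_form B k U \<omega>" and p: "p \<in> U" and c: "c \<in> charts_at B p"
  shows "alternating k (\<lambda>us. \<omega> p (map (tv c p) us))"
  unfolding alternating_def
proof (intro conjI allI impI)
  fix us :: "'e list" and i v w and a b :: real
  assume us: "length us = k" and i: "i < k"
  show "\<omega> p (map (tv c p) (us[i := a *\<^sub>R v + b *\<^sub>R w])) =
      a * \<omega> p (map (tv c p) (us[i := v])) + b * \<omega> p (map (tv c p) (us[i := w]))"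
    unfolding map_update tv_lin[OF c]
    by (rule k_form_lin[OF \<omega> p map_tv_tuple[OF c us] i tv_in[OF c] tv_in[OF c]])
next
  fix us :: "'e list" and i j
  assume us: "length us = k" and ij: "i < j" "j < k" "us ! i = us ! j"
  show "\<omega> p (map (tv c p) us) = 0"
    by (rule k_form_alt[OF \<omega> p map_tv_tuple[OF c us] ij(1,2)]) (use us ij in simp)
qed

lemma local_form_lrep:
  assumes \<omega>: "k_form B k U \<omega>" and c: "c \<in> B"
  shows "local_form k (snd c ` (U \<inter> fst c)) (lrep c \<omega>)"
  unfolding local_form_def
proof (intro conjI ballI allI impI)
  fix z assume "z \<in> snd c ` (U \<inter> fst c)"
  then obtain p where p: "p \<in> U" "p \<in> fst c" "z = snd c p" by auto
  then have "c \<in> charts_at B p" using c by (simp add: charts_at_def)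
  from alternating_k_form[OF \<omega> p(1) this] show "alternating k (lrep c \<omega> z)"
    by (simp add: lrep_def[abs_def] p(3) inv_eq[OF c p(2)])
next
  fix us :: "'e list" assume "length us = k"
  then show "smooth_on (\<lambda>z. lrep c \<omega> z us) (snd c ` (U \<inter> fst c))"
    by (rule k_form_smooth[OF \<omega> c])
qed

lemma lrep_at: "c \<in> charts_at B p \<Longrightarrow> lrep c \<omega> (snd c p) us = \<omega> p (map (tv c p) us)"
  by (simp add: lrep_def inv_eq charts_at_def)

text \<open>Both sides evaluate the form at the same tangent vectors at the same point, so the law
  holds for every function of the type of forms.\<close>

lemma lrep_change:
  assumes c: "c \<in> B" and d: "d \<in> B" and z: "z \<in> overlap c d"
  shows "lrep c \<omega> z us = lrep d \<omega> (trn c d z) (map (FD (trn c d) z) us)"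
proof -
  obtain p where p: "p \<in> fst c" "p \<in> fst d" "z = snd c p" using z by auto
  then have ch: "c \<in> charts_at B p" "d \<in> charts_at B p" using c d by (simp_all add: charts_at_def)
  have "trn c d z = snd d p" by (simp add: p(3) inv_eq[OF c p(1)])
  moreover have "map (tv c p) us = map (tv d p) (map (FD (trn c d) (snd c p)) us)"
    unfolding map_map by (rule map_cong[OF refl], simp only: o_apply, rule tv_change[OF ch])
  ultimately show ?thesis
    unfolding p(3) by (simp only: lrep_at[OF ch(1)] lrep_at[OF ch(2)])
qed

text \<open>Components are prescribed in one chart, but \<open>k_form\<close> demands smoothness in
  every chart d of the atlas. There they are those of W composed with the transition map, with
  arguments moved by its derivative, which \<open>smooth_on_slots\<close> handles.\<close>

lemma k_form_from_chart:
  assumes c: "c \<in> B" and U: "U \<subseteq> fst c" "atlas_open B U" and W: "local_form k (snd c ` U) W"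
  defines "\<omega> \<equiv> \<lambda>p vs. W (snd c p) (comps c vs)"
  shows "k_form B k U \<omega>" and "z \<in> snd c ` U \<Longrightarrow> lrep c \<omega> z us = W z us"
proof -
  have oc: "open (snd c ` U)"
    using U c by (metis Int_absorb2 atlas_open_def)
  have ch: "c \<in> charts_at B p" if "p \<in> U" for p using that c U(1) by (auto simp: charts_at_def)
  have lr: "lrep c \<omega> z us = W z us" if z: "z \<in> snd c ` U" for z us
  proof -
    obtain p where p: "p \<in> U" "z = snd c p" using z by auto
    show ?thesis unfolding p(2) lrep_at[OF ch[OF p(1)]] by (simp only: \<omega>_def comps_map_tv[OF ch[OF p(1)]])
  qed
  then show "z \<in> snd c ` U \<Longrightarrow> lrep c \<omega> z us = W z us" .
  have sm: "smooth_on (\<lambda>z. lrep d \<omega> z us) (snd d ` (U \<inter> fst d))"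
    if d: "d \<in> B" and us: "length us = k" for d us
  proof -
    define V where "V = snd d ` (U \<inter> fst d)"
    have V: "open V" using U(2) d by (simp add: V_def atlas_open_def)
    have sub: "V \<subseteq> overlap d c" using U(1) by (auto simp: V_def)
    have sT: "smooth_on (trn d c) V" by (rule smooth_on_subset[OF smooth_on_trn[OF d c] sub])
    have im: "trn d c ` V \<subseteq> snd c ` U" by (auto simp: V_def inv_eq[OF d])
    have "smooth_on (\<lambda>z. W (trn d c z) (map (\<lambda>h. h z) (map (\<lambda>u z. FD (trn d c) z u) us) @ [])) V"
      using us by (intro smooth_on_slots[OF V local_form_compose[OF V oc sT im W]]) (auto intro: smooth_on_FD[OF sT])
    then show ?thesis
      unfolding V_def[symmetric]
    proof (rule smooth_on_cong[OF V, rotated])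
      fix z assume z: "z \<in> V"
      have "lrep d \<omega> z us = W (trn d c z) (map (FD (trn d c) z) us)"
        using lrep_change[OF d c subsetD[OF sub z]] lr im z by auto
      then show "W (trn d c z) (map (\<lambda>h. h z) (map (\<lambda>u z. FD (trn d c) z u) us) @ []) = lrep d \<omega> z us"
        by (simp add: o_def)
    qed
  qed
  have A: "alternating k (W (snd c p))" if "p \<in> U" for p using cformD(1)[OF W] that by blast
  show "k_form B k U \<omega>"
    unfolding k_form_def
  proof (intro conjI ballI allI impI)
    fix p vs i v w and a b :: real
    assume "p \<in> U" "vs \<in> tangent_tuples B k p" "i < k"
    then show "\<omega> p (vs[i := (\<lambda>c. a *\<^sub>R v c + b *\<^sub>R w c)]) = a * \<omega> p (vs[i := v]) + b * \<omega> p (vs[i := w])"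
      using alternating_lin[OF A, of p "comps c vs" i a "v c" b "w c"]
      by (simp add: \<omega>_def map_update tangent_tuples_def)
  next
    fix p vs i j
    assume "p \<in> U" "vs \<in> tangent_tuples B k p" "i < j \<and> j < k \<and> vs ! i = vs ! j"
    then show "\<omega> p vs = 0"
      using alternating_alt[OF A, of p "comps c vs" i j] by (simp add: \<omega>_def tangent_tuples_def)
  next
    fix d us assume "d \<in> B" "length (us :: 'e list) = k"
    from sm[OF this] show "smooth_on (\<lambda>z. \<omega> (chart_inv d z) (map (tv d (chart_inv d z)) us)) (snd d ` (U \<inter> fst d))"
      by (simp add: lrep_def)
  qed
qed

text \<open>Tied to the chart that \<open>some_chart\<close> assigns to p; the passage to other
  charts is deferred to \<open>d_J_chart\<close>.\<close>

lemma ext_deriv_d_along: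
  assumes "c = some_chart B p"
  shows "ext_deriv B \<omega> p vs = d_along (\<lambda>v. v) (lrep c \<omega>) (snd c p) (comps c vs)"
  by (simp add: ext_deriv_def d_along_def lrep_def assms Let_def map_omit[symmetric] o_def)

end

section \<open>The operator \<open>d\<^sub>J\<close> modulo \<open>dt\<close> in induced charts\<close>

definition endo_at :: "'v jcoord \<Rightarrow> 'v jcoord \<Rightarrow> real \<times> 'v \<times> 'v::real_vector" where
  "endo_at z u = (0, 0, fst (snd u) - fst u *\<^sub>R snd (snd z))"

lemma linear_endo_at: "linear (endo_at z)"
  by (rule linearI) (simp_all add: endo_at_def algebra_simps)

lemma endo_at_vert: "fst u = 0 \<Longrightarrow> endo_at z u = vert u"
  by (simp add: endo_at_def vert_def)

context fibred
begin

abbreviation "JA \<equiv> jet_atlas A \<pi>"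

sublocale J: atlas_loc JA
  by unfold_locales (rule smooth_jet_atlas)

lemma JA_cases: assumes "C \<in> JA" obtains c where "c \<in> FC" "C = JC c"
  using assms by (auto simp: jet_atlas_def)

lemma J_some_chart: "j \<in> jets \<Longrightarrow> some_chart JA j \<in> charts_at JA j"
  by (rule J.some_chart_in) (simp add: jet_atlas_points)

lemma JA_fst_sub: "C \<in> JA \<Longrightarrow> fst C \<subseteq> jets"
  by (auto simp: jet_atlas_def fst_JC)

text \<open>The third component of a coordinate change is affine in \<open>y\<close>, with the linear part of \<open>D\<phi>\<close>.\<close>

lemma FD_jtrans:
  assumes c: "c \<in> FC" and d: "d \<in> FC" and z: "base z \<in> overlap c d"
  shows "fst (FD (jtrans c d) z u) = fst u"
    "fst (snd (FD (jtrans c d) z u)) = snd (FD (trn c d) (base z) (base u))"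
    "FD (jtrans c d) z (0, 0, \<eta>) = (0, 0, snd (FD (trn c d) (base z) (0, \<eta>)))"
proof -
  note cM = FC_M[OF c] and dM = FC_M[OF d]
  note sm = smooth_on_trans[OF cM dM]
  have D: "(jtrans c d has_derivative FD (jtrans c d) z) (at z)"
    using z by (intro smooth_on_FDERIV[OF smooth_on_jtrans[OF c d]]) simp
  have "((\<lambda>z. fst (jtrans c d z)) has_derivative (\<lambda>u. fst (FD (jtrans c d) z u))) (at z)"
    by (rule has_derivative_fst[OF D])
  moreover have "((\<lambda>z. fst (jtrans c d z)) has_derivative fst) (at z)"
    by (simp add: jtrans_def has_derivative_fst[OF has_derivative_ident, simplified])
  ultimately have "(\<lambda>u. fst (FD (jtrans c d) z u)) = fst" using has_derivative_unique by blast
  from fun_cong[OF this, of u] show "fst (FD (jtrans c d) z u) = fst u" .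
  have "((\<lambda>z. fst (snd (jtrans c d z))) has_derivative (\<lambda>u. fst (snd (FD (jtrans c d) z u)))) (at z)"
    by (intro has_derivative_fst has_derivative_snd D)
  moreover have "((\<lambda>z. fst (snd (jtrans c d z))) has_derivative (\<lambda>u. snd (FD (trn c d) (base z) (base u)))) (at z)"
  proof -
    have "(base has_derivative base) (at z)"
      by (intro has_derivative_Pair has_derivative_fst has_derivative_snd has_derivative_ident)
    from has_derivative_snd[OF has_derivative_compose[OF this smooth_on_FDERIV[OF sm z]]]
    show ?thesis by (simp add: jtrans_def o_def)
  qed
  ultimately have "(\<lambda>u. fst (snd (FD (jtrans c d) z u))) = (\<lambda>u. snd (FD (trn c d) (base z) (base u)))"
    using has_derivative_unique by blast
  from fun_cong[OF this, of u]
  show "fst (snd (FD (jtrans c d) z u)) = snd (FD (trn c d) (base z) (base u))" .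
  note lin = linear_FD[OF sm z]
  \<comment> \<open>Vertical directions are tested along a line in the fibre, on which the induced
    coordinate change is affine; no second derivative of \<open>trn c d\<close> has to be
    computed.\<close>
  define w where "w = (0 :: real, 0 :: 'v, snd (FD (trn c d) (base z) (0, \<eta>)))"
  have "FD (trn c d) (base z) (1, snd (snd z) + r *\<^sub>R \<eta>) =
      FD (trn c d) (base z) (1, snd (snd z)) + r *\<^sub>R FD (trn c d) (base z) (0, \<eta>)" for r
    using linear_add[OF lin, of "(1, snd (snd z))" "r *\<^sub>R (0, \<eta>)"] linear_scale[OF lin, of r "(0, \<eta>)"] by simp
  then have eq: "jtrans c d (z + r *\<^sub>R (0, 0, \<eta>)) = jtrans c d z + r *\<^sub>R w" for r
    by (simp add: jtrans_def w_def prod_eq_iff)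
  have l: "((\<lambda>r. z + r *\<^sub>R (0, 0, \<eta>)) has_derivative (\<lambda>r. r *\<^sub>R (0, 0, \<eta>))) (at 0)"
    by (auto intro!: derivative_eq_intros)
  have "((\<lambda>r. jtrans c d (z + r *\<^sub>R (0, 0, \<eta>))) has_derivative (\<lambda>r. FD (jtrans c d) z (r *\<^sub>R (0, 0, \<eta>)))) (at 0)"
    by (rule has_derivative_compose[OF l]) (use D in \<open>simp flip: zero_prod_def\<close>)
  moreover have "((\<lambda>r. jtrans c d (z + r *\<^sub>R (0, 0, \<eta>))) has_derivative (\<lambda>r. r *\<^sub>R w)) (at 0)"
    unfolding eq by (auto intro!: derivative_eq_intros)
  ultimately have "(\<lambda>r. FD (jtrans c d) z (r *\<^sub>R (0, 0, \<eta>))) = (\<lambda>r. r *\<^sub>R w)"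
    using has_derivative_unique by blast
  from fun_cong[OF this, of 1] show "FD (jtrans c d) z (0, 0, \<eta>) = (0, 0, snd (FD (trn c d) (base z) (0, \<eta>)))"
    by (simp add: w_def)
qed

text \<open>For the commutation with J: (0, \<xi> - \<tau> y) equals (\<tau>, \<xi>) - \<tau> (1,
  y), and the derivative of the fibred coordinate change maps (1, y) to a vector with second
  component y'. So \<delta>x transforms linearly, in the same way as vertical vectors do.\<close>

lemma FD_trn_J:
  assumes C: "C \<in> charts_at JA j" and D: "D \<in> charts_at JA j"
  shows "fst (FD (trn C D) (snd C j) u) = fst u"
    "\<exists>\<eta>'. FD (trn C D) (snd C j) (0, 0, \<eta>) = (0, 0, \<eta>')"
    "FD (trn C D) (snd C j) (endo_at (snd C j) u) = endo_at (snd D j) (FD (trn C D) (snd C j) u)"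
proof -
  obtain c d where c: "c \<in> FC" "C = JC c" and d: "d \<in> FC" "D = JC d"
    using C D J.charts_atD JA_cases by metis
  define z where "z = snd C j"
  have zO: "z \<in> overlap C D" unfolding z_def by (rule J.in_overlap[OF C D])
  have bz: "base z \<in> overlap c d"
    using zO JC_image_overlap[OF c(1) d(1)] by (simp add: c(2) d(2))
  have eq: "FD (trn C D) z = FD (jtrans c d) z"
  proof (rule FD_cong_open[OF J.open_ov zO])
    show "C \<in> JA" "D \<in> JA" using C D by (simp_all add: J.charts_atD)
    fix y assume "y \<in> overlap C D"
    then show "trn C D y = jtrans c d y"
      using JC_trans[OF c(1) d(1)] JC_image_overlap[OF c(1) d(1)] by (simp add: c(2) d(2))
  qed
  have zD: "snd D j = jtrans c d z"
    using JC_trans[OF c(1) d(1) bz] J.inv_eq[OF J.charts_atD[OF C]] by (simp add: z_def c(2) d(2))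
  note F = FD_jtrans[OF c(1) d(1) bz]
  show "fst (FD (trn C D) (snd C j) u) = fst u" using F(1) by (simp add: eq flip: z_def)
  show "\<exists>\<eta>'. FD (trn C D) (snd C j) (0, 0, \<eta>) = (0, 0, \<eta>')" using F(3) by (simp add: eq flip: z_def)
  note lin = linear_FD[OF smooth_on_trans[OF FC_M[OF c(1)] FC_M[OF d(1)]] bz]
  have "FD (trn c d) (base z) (0, fst (snd u) - fst u *\<^sub>R snd (snd z)) =
      FD (trn c d) (base z) (base u) - fst u *\<^sub>R FD (trn c d) (base z) (1, snd (snd z))"
    using linear_diff[OF lin, of "base u" "fst u *\<^sub>R (1, snd (snd z))"]
      linear_scale[OF lin, of "fst u" "(1, snd (snd z))"] by simp
  then show "FD (trn C D) (snd C j) (endo_at (snd C j) u) = endo_at (snd D j) (FD (trn C D) (snd C j) u)"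
    unfolding zD z_def[symmetric] eq by (simp add: endo_at_def F jtrans_def)
qed

lemma vert_endo_comp: "C \<in> charts_at JA j \<Longrightarrow> vert_endo A \<pi> j v C = endo_at (snd C j) (v C)"
  by (simp add: vert_endo_def endo_at_def split: prod.split)

text \<open>\<open>vert_endo\<close> is defined componentwise in all charts at once; commutation of
  J with the transition maps makes these the components of a single tangent vector.\<close>

lemma vert_endo_tv:
  assumes C: "C \<in> charts_at JA j"
  shows "vert_endo A \<pi> j (J.tv C j u) = J.tv C j (endo_at (snd C j) u)"
proof
  fix D
  show "vert_endo A \<pi> j (J.tv C j u) D = J.tv C j (endo_at (snd C j) u) D"
  proof (cases "D \<in> charts_at JA j")
    case True
    then show ?thesis
      by (simp add: vert_endo_comp J.tv_comp[OF C] FD_trn_J(3)[OF C True])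
  next
    case False
    then show ?thesis by (simp add: vert_endo_def tangent_vector_def)
  qed
qed

lemma i_J_tv:
  assumes C: "C \<in> charts_at JA j"
  shows "i_J A \<pi> \<omega> j (map (J.tv C j) us) = i_along (endo_at (snd C j)) (\<lambda>us. \<omega> j (map (J.tv C j) us)) us"
  unfolding i_J_def i_along_def by (intro sum.cong) (simp_all add: vert_endo_tv[OF C] map_update)

lemma lrep_i_J:
  assumes C: "C \<in> JA" and z: "z \<in> snd C ` fst C"
  shows "J.lrep C (i_J A \<pi> \<omega>) z us = i_along (endo_at z) (J.lrep C \<omega> z) us"
proof -
  obtain j where j: "j \<in> fst C" "z = snd C j" using z by auto
  then have ch: "C \<in> charts_at JA j" using C by (simp add: charts_at_def)
  show ?thesis unfolding j(2) J.lrep_at[OF ch] i_J_tv[OF ch] by (simp add: J.lrep_at[OF ch, abs_def])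
qed

text \<open>Both exterior derivatives use the same chart, as \<open>some_chart\<close> depends only
  on the point. In the second one J varies with the point under the derivative.\<close>

lemma d_J_some_chart:
  assumes j: "j \<in> jets" and C: "C = some_chart JA j"
  shows "dJ \<omega> j vs = i_along (endo_at (snd C j)) (d_along (\<lambda>v. v) (J.lrep C \<omega>) (snd C j)) (J.comps C vs) -
     d_along (\<lambda>v. v) (\<lambda>z. i_along (endo_at z) (J.lrep C \<omega> z)) (snd C j) (J.comps C vs)"
proof -
  have ch: "C \<in> charts_at JA j" using J_some_chart[OF j] C by simp
  note CJ = J.charts_atD[OF ch]
  have "i_J A \<pi> (ext_deriv JA \<omega>) j vs = i_along (endo_at (snd C j)) (d_along (\<lambda>v. v) (J.lrep C \<omega>) (snd C j)) (J.comps C vs)"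
    unfolding i_J_def i_along_def J.ext_deriv_d_along[OF C]
    by (intro sum.cong) (simp_all add: map_update vert_endo_comp[OF ch])
  moreover have "ext_deriv JA (i_J A \<pi> \<omega>) j vs =
      d_along (\<lambda>v. v) (\<lambda>z. i_along (endo_at z) (J.lrep C \<omega> z)) (snd C j) (J.comps C vs)"
    unfolding J.ext_deriv_d_along[OF C]
    by (rule d_along_cong[OF J.open_ov[OF CJ(1) CJ(1)] J.in_overlap[OF ch ch]])
      (use lrep_i_J[OF CJ(1)] in simp)
  ultimately show ?thesis by (simp add: d_J_def)
qed

lemma jet_open_image:
  assumes U: "openin (atlas_topology JA) U" and C: "C \<in> JA"
  shows "open (snd C ` (U \<inter> fst C))"
  using U C by (simp add: openin_atlas_topology[OF smooth_jet_atlas] atlas_open_def)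

text \<open>The working formula for d_J, in an arbitrary chart D at j and not just the one chosen
  there; only this lets it be used at all points of one chart domain. The commutator is evaluated in
  the chosen chart and then carried over to D by \<open>d_along_pullback\<close>, with K the kernel
  of dt.\<close>

lemma d_J_chart:
  assumes U: "openin (atlas_topology JA) U" and \<omega>: "k_form JA k U \<omega>" and j: "j \<in> U"
    and D: "D \<in> charts_at JA j" and vs: "vs \<in> tangent_tuples JA (Suc k) j" "\<forall>v\<in>set vs. fst (v D) = 0"
  shows "dJ \<omega> j vs = d_along vert (J.lrep D \<omega>) (snd D j) (J.comps D vs)"
proof -
  have jJ: "j \<in> jets"
    using U j by (auto simp: openin_atlas_topology[OF smooth_jet_atlas] atlas_open_def jet_atlas_points)
  define C where "C = some_chart JA j"
  have C: "C \<in> charts_at JA j" using J_some_chart[OF jJ] by (simp add: C_def)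
  note CJ = J.charts_atD[OF C] and DJ = J.charts_atD[OF D]
  define S where "S = snd C ` (U \<inter> fst C)"
  have S: "open S" unfolding S_def by (rule jet_open_image[OF U CJ(1)])
  have F: "local_form k S (J.lrep C \<omega>)" unfolding S_def by (rule J.local_form_lrep[OF \<omega> CJ(1)])
  have z: "snd C j \<in> S" using j CJ(2) by (simp add: S_def)
  define us where "us = J.comps C vs"
  have lus: "length us = Suc k" using J.tuple_comps(2)[OF vs(1) C] by (simp add: us_def)
  have tr: "v D = FD (trn C D) (snd C j) (v C)" if "v \<in> set vs" for v
    using J.tspace_trans[OF _ C D] that vs(1) by (auto simp: tangent_tuples_def)
  have "fst (v C) = 0" if "v \<in> set vs" for v
  proof -
    have "fst (v D) = 0" using vs(2) that by blast
    then show ?thesis unfolding tr[OF that] FD_trn_J(1)[OF C D] .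
  qed
  then have usK: "\<forall>u\<in>set us. fst u = 0" by (simp add: us_def)
  have "dJ \<omega> j vs = i_along vert (d_along (\<lambda>v. v) (J.lrep C \<omega>) (snd C j)) us -
      d_along (\<lambda>v. v) (\<lambda>z. i_along vert (J.lrep C \<omega> z)) (snd C j) us"
  proof -
    have i_along_eq: "i_along (endo_at z) f ws = i_along vert f ws" if "\<forall>u\<in>set ws. fst u = 0" for z f and ws :: "'v jcoord list"
      unfolding i_along_def using that by (intro sum.cong refl) (simp add: endo_at_vert)
    \<comment> \<open>J may be replaced by \<open>vert\<close> under the derivative: the shortened
      lists have constant components in the kernel of dt, at every point.\<close>
    have "\<forall>u\<in>set (omit i us). fst u = 0" for i using usK set_omit[of i us] by blast
    then have "d_along (\<lambda>v. v) (\<lambda>z. i_along (endo_at z) (J.lrep C \<omega> z)) (snd C j) us =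
        d_along (\<lambda>v. v) (\<lambda>z. i_along vert (J.lrep C \<omega> z)) (snd C j) us"
      by (intro d_along_cong[OF S z] i_along_eq)
    then show ?thesis
      using d_J_some_chart[OF jJ C_def, of \<omega> vs] unfolding us_def[symmetric] i_along_eq[OF usK] by simp
  qed
  also have "\<dots> = d_along vert (J.lrep C \<omega>) (snd C j) us" by (rule commutator_eq_d_along[OF S F z lus])
  also have "\<dots> = d_along vert (J.lrep D \<omega>) (trn C D (snd C j)) (map (FD (trn C D) (snd C j)) us)"
  proof (rule d_along_pullback[where K = "{u. fst u = 0}"])
    define S' where "S' = S \<inter> overlap C D"
    have S'D: "\<exists>p. p \<in> U \<and> p \<in> fst C \<and> p \<in> fst D \<and> y = snd C p" if "y \<in> S'" for y
    proof -
      have "y \<in> S" "y \<in> overlap C D" using that by (simp_all add: S'_def)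
      then obtain p q where pq: "p \<in> U" "p \<in> fst C" "y = snd C p" "q \<in> fst C" "q \<in> fst D" "y = snd C q"
        unfolding S_def by blast
      then have "p = q" using inj_onD[OF J.inj[OF CJ(1)]] by metis
      then show ?thesis using pq by blast
    qed
    show "open S'" unfolding S'_def using S J.open_ov[OF CJ(1) DJ(1)] by blast
    show "open (snd D ` (U \<inter> fst D))" by (rule jet_open_image[OF U DJ(1)])
    show "smooth_on (trn C D) S'"
      by (rule smooth_on_subset[OF J.smooth_on_trn[OF CJ(1) DJ(1)]]) (simp add: S'_def)
    show "trn C D ` S' \<subseteq> snd D ` (U \<inter> fst D)"
      using S'D by (fastforce simp: J.inv_eq[OF CJ(1)])
    show "local_form k (snd D ` (U \<inter> fst D)) (J.lrep D \<omega>)" by (rule J.local_form_lrep[OF \<omega> DJ(1)])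
    show "J.lrep C \<omega> y ws = J.lrep D \<omega> (trn C D y) (map (FD (trn C D) y) ws)" if "y \<in> S'" for y ws
      using that by (intro J.lrep_change[OF CJ(1) DJ(1)]) (simp add: S'_def)
    show "linear vert" by (rule linear_vert)
    show "FD (trn C D) y (vert v) = vert (FD (trn C D) y v)" if y: "y \<in> S'" and v: "v \<in> {u. fst u = 0}" for y v
    proof -
      obtain p where p: "p \<in> U" "p \<in> fst C" "p \<in> fst D" "y = snd C p" using S'D[OF y] by blast
      have ch: "C \<in> charts_at JA p" "D \<in> charts_at JA p" using p CJ DJ by (simp_all add: charts_at_def)
      show ?thesis
        using FD_trn_J(3)[OF ch, of v] FD_trn_J(1)[OF ch, of v] v by (simp add: p(4) endo_at_vert)
    qed
    show "snd C j \<in> S'" using z J.in_overlap[OF C D] by (simp add: S'_def)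
    show "length us = Suc k" by (rule lus)
    show "set us \<subseteq> {u. fst u = 0}" using usK by auto
  qed
  also have "trn C D (snd C j) = snd D j" by (simp add: J.inv_eq[OF CJ])
  also have "map (FD (trn C D) (snd C j)) us = J.comps D vs" using tr by (simp add: us_def o_def)
  finally show ?thesis .
qed

text \<open>Needed for arbitrary tangent vectors, since \<open>wedge_dt_form_eq_iff\<close> compares
  forms that are alternating on the whole tangent space. Off the kernel of dt, J varies with the
  point; \<open>smooth_on_slots\<close> absorbs the variable slot.\<close>

lemma alternating_d_J:
  assumes U: "openin (atlas_topology JA) U" and \<omega>: "k_form JA k U \<omega>" and j: "j \<in> U"
    and C: "C = some_chart JA j"
  shows "alternating (Suc k) (\<lambda>us. dJ \<omega> j (map (J.tv C j) us))"
proof -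
  have jJ: "j \<in> jets"
    using U j by (auto simp: openin_atlas_topology[OF smooth_jet_atlas] atlas_open_def jet_atlas_points)
  have ch: "C \<in> charts_at JA j" using J_some_chart[OF jJ] by (simp add: C)
  note CJ = J.charts_atD[OF ch]
  define S where "S = snd C ` (U \<inter> fst C)"
  have S: "open S" unfolding S_def by (rule jet_open_image[OF U CJ(1)])
  have F: "local_form k S (J.lrep C \<omega>)" unfolding S_def by (rule J.local_form_lrep[OF \<omega> CJ(1)])
  have z: "snd C j \<in> S" using j CJ(2) by (simp add: S_def)
  have lin: "linear (\<lambda>v :: real \<times> 'v \<times> 'v. v)" by (rule linearI) auto
  have "local_form k S (\<lambda>z. i_along (endo_at z) (J.lrep C \<omega> z))"
    unfolding local_form_def
  proof (intro conjI ballI allI impI)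
    show "alternating k (i_along (endo_at y) (J.lrep C \<omega> y))" if "y \<in> S" for y
      by (rule alternating_i_along[OF cformD(1)[OF F that] linear_endo_at])
    fix us :: "'v jcoord list" assume us: "length us = k"
    have "smooth_on (\<lambda>y. J.lrep C \<omega> y (us[l := endo_at y (us ! l)])) S" for l
    proof -
      have sJ: "smooth_on (\<lambda>y. endo_at y (us ! l)) S"
        unfolding endo_at_def by (intro smooth_on_Pair smooth_on_diff smooth_on_scaleR smooth_on_snd
            smooth_on_const smooth_on_ident S)
      have "smooth_on (\<lambda>y. J.lrep C \<omega> y (map (\<lambda>h. h y) ((map (\<lambda>u y. u) us)[l := \<lambda>y. endo_at y (us ! l)]) @ [])) S"
        using us set_update_subset_insert[of "map (\<lambda>u y. u) us" l "\<lambda>y. endo_at y (us ! l)"]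
        by (intro smooth_on_slots[OF S F]) (auto intro: sJ smooth_on_const)
      then show ?thesis by (simp add: map_update o_def)
    qed
    then show "smooth_on (\<lambda>y. i_along (endo_at y) (J.lrep C \<omega> y) us) S"
      unfolding i_along_def by (intro smooth_on_sum[OF S])
  qed
  from cformD(1)[OF local_form_d_along[OF S this lin] z]
  have "alternating (Suc k) (d_along (\<lambda>v. v) (\<lambda>z. i_along (endo_at z) (J.lrep C \<omega> z)) (snd C j))" .
  moreover have "alternating (Suc k) (i_along (endo_at (snd C j)) (d_along (\<lambda>v. v) (J.lrep C \<omega>) (snd C j)))"
    by (rule alternating_i_along[OF cformD(1)[OF local_form_d_along[OF S F lin] z] linear_endo_at])
  ultimately show ?thesis
    using alternating_diff unfolding d_J_some_chart[OF jJ C] J.comps_map_tv[OF ch] by blast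
qed

section \<open>Equality of forms modulo dt\<close>

lemma dt_form_comp:
  assumes j: "j \<in> jets" and C: "C = some_chart JA j"
  shows "dt_form A \<pi> j [v] = fst (v C)"
proof -
  have ch: "C \<in> charts_at JA j" using J_some_chart[OF j] by (simp add: C)
  note CJ = J.charts_atD[OF ch]
  obtain c where c: "c \<in> FC" "C = JC c" using JA_cases[OF CJ(1)] .
  have "\<pi> (fst (chart_inv C z)) = fst z" if z: "z \<in> snd C ` fst C" for z
  proof -
    obtain i where i: "i \<in> fst C" "z = snd C i" using z by auto
    have "fst z = fst (snd c (fst i))" using JC_base[OF c(1), of i] i by (simp add: c(2) prod_eq_iff)
    moreover have "chart_inv C z = i" using J.inv_eq[OF CJ(1) i(1)] by (simp add: i(2))
    ultimately show ?thesis using i(1) FC_fst[OF c(1)] by (simp add: c(2) fst_JC)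
  qed
  then have "FD (\<lambda>z. \<pi> (fst (chart_inv C z))) (snd C j) = FD fst (snd C j)"
    by (intro FD_cong_open[OF J.open_ov[OF CJ(1) CJ(1)] J.in_overlap[OF ch ch]]) simp
  also have "\<dots> = fst" by (rule FD_eqI) (rule has_derivative_fst[OF has_derivative_ident])
  finally show ?thesis by (simp add: dt_form_def ext_deriv_def Let_def C)
qed

lemma fst_comp_change:
  assumes "v \<in> tangent_space JA j" "C \<in> charts_at JA j" "D \<in> charts_at JA j"
  shows "fst (v D) = fst (v C)"
  using J.tspace_trans[OF assms] FD_trn_J(1)[OF assms(2,3)] by simp

lemma wedge_dt_form:
  assumes j: "j \<in> jets" and C: "C = some_chart JA j"
  shows "wedge_dt \<alpha> j vs =
    (\<Sum>i<length vs. (- 1) ^ (length vs - 1 - i) * \<alpha> j (omit i vs) * fst ((vs ! i) C))"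
  by (simp add: wedge_1form_def dt_form_comp[OF j C])

text \<open>One direction appends a vector with dt = 1 to a tuple in the kernel of dt; the other is
  \<open>wedge_zeroI\<close>. The kernel may be tested in any chart D, as the dt component is the
  same in all of them.\<close>

lemma wedge_dt_form_eq_iff:
  assumes j: "j \<in> jets" and D: "D \<in> charts_at JA j"
    and alt: "alternating k (\<lambda>us. \<alpha> j (map (J.tv (some_chart JA j) j) us))"
      "alternating k (\<lambda>us. \<beta> j (map (J.tv (some_chart JA j) j) us))"
  shows "(\<forall>vs\<in>tangent_tuples JA (Suc k) j.
      wedge_dt \<alpha> j vs = wedge_dt \<beta> j vs) \<longleftrightarrow>
    (\<forall>vs\<in>tangent_tuples JA k j. (\<forall>v\<in>set vs. fst (v D) = 0) \<longrightarrow> \<alpha> j vs = \<beta> j vs)"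
proof -
  define C where "C = some_chart JA j"
  have C: "C \<in> charts_at JA j" using J_some_chart[OF j] by (simp add: C_def)
  note w = wedge_dt_form[OF j C_def]
  have K: "fst (v D) = fst (v C)" if "vs \<in> tangent_tuples JA m j" "v \<in> set vs" for v vs m
    using that fst_comp_change[OF _ C D] by (auto simp: tangent_tuples_def)
  show ?thesis
  proof (intro iffI ballI impI)
    fix vs assume eq: "\<forall>vs\<in>tangent_tuples JA (Suc k) j.
      wedge_dt \<alpha> j vs = wedge_dt \<beta> j vs"
      and vs: "vs \<in> tangent_tuples JA k j" "\<forall>v\<in>set vs. fst (v D) = 0"
    \<comment> \<open>The coordinate vector of t in C. As last entry of the tuple it contributes the
      sign +1, and every other summand has a zero factor dt.\<close>
    define T where "T = J.tv C j (1, 0, 0)"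
    have T: "T \<in> tangent_space JA j" "fst (T C) = 1"
      by (simp_all add: T_def J.tv_in[OF C] J.tv_comp_self[OF C])
    have len: "length vs = k" using vs(1) by (simp add: tangent_tuples_def)
    have red: "wedge_dt \<gamma> j (vs @ [T]) = \<gamma> j vs" for \<gamma>
    proof -
      have "\<And>i. i < k \<Longrightarrow> fst (((vs @ [T]) ! i) C) = 0"
        using vs K len by (simp add: nth_append)
      moreover have "omit k (vs @ [T]) = vs" using len by (simp add: omit_def)
      moreover have "(vs @ [T]) ! k = T" using len by (metis nth_append_length)
      ultimately show ?thesis by (simp add: w len T(2))
    qed
    have "vs @ [T] \<in> tangent_tuples JA (Suc k) j" using vs(1) T(1) by (auto simp: tangent_tuples_def)
    then show "\<alpha> j vs = \<beta> j vs" using eq red by metis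
  next
    fix vs assume eq: "\<forall>vs\<in>tangent_tuples JA k j. (\<forall>v\<in>set vs. fst (v D) = 0) \<longrightarrow> \<alpha> j vs = \<beta> j vs"
      and vs: "vs \<in> tangent_tuples JA (Suc k) j"
    define us where "us = J.comps C vs"
    have us: "map (J.tv C j) us = vs" "length us = Suc k" using J.tuple_comps[OF vs C] by (simp_all add: us_def)
    define f where "f us = \<alpha> j (map (J.tv C j) us) - \<beta> j (map (J.tv C j) us)" for us
    have f: "alternating k f" unfolding f_def[abs_def] using alternating_diff[OF alt] by (simp add: C_def)
    have lin: "linear (fst :: 'v jcoord \<Rightarrow> real)" by (rule linearI) auto
    have "(\<Sum>i<Suc k. (- 1) ^ (k - i) * f (omit i us) * fst (us ! i)) = 0"
    proof (rule wedge_zeroI[OF f lin _ us(2)])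
      fix ws :: "'v jcoord list" assume ws: "length ws = k" "\<forall>u\<in>set ws. fst u = 0"
      have t: "map (J.tv C j) ws \<in> tangent_tuples JA k j" by (rule J.map_tv_tuple[OF C ws(1)])
      have "\<forall>v\<in>set (map (J.tv C j) ws). fst (v D) = 0"
        using K[OF t] ws(2) by (auto simp: J.tv_comp_self[OF C])
      then show "f ws = 0" using eq t by (simp add: f_def)
    qed
    moreover have "f (omit i us) = \<alpha> j (omit i vs) - \<beta> j (omit i vs)" for i
      by (simp add: f_def map_omit us(1))
    moreover have "fst (us ! i) = fst ((vs ! i) C)" if "i < Suc k" for i
      using that us(2) by (simp add: us_def)
    moreover have "length vs = Suc k" using vs by (simp add: tangent_tuples_def)
    ultimately show "wedge_dt \<alpha> j vs = wedge_dt \<beta> j vs"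
      by (simp add: w left_diff_distrib right_diff_distrib sum_subtractf del: sum.lessThan_Suc)
  qed
qed

lemma alternating_k_form_some:
  assumes "k_form JA k U \<alpha>" "p \<in> U" "p \<in> jets"
  shows "alternating k (\<lambda>us. \<alpha> p (map (J.tv (some_chart JA p) p) us))"
  by (rule J.alternating_k_form[OF assms(1,2) J_some_chart[OF assms(3)]])

text \<open>\<open>tangent_map\<close> uses the chart chosen at j, so the vector is first moved
  there, where it is again of the form (0, 0, \<eta>'). The projection factors through (t, x), and
  its derivative annihilates such vectors.\<close>

lemma vertical_tv:
  assumes j: "j \<in> jets" and C: "C \<in> charts_at JA j"
  shows "J.tv C j (0, 0, \<eta>) \<in> vertical A \<pi> j"
proof -
  define D where "D = some_chart JA j"
  have D: "D \<in> charts_at JA j" using J_some_chart[OF j] by (simp add: D_def)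
  note DJ = J.charts_atD[OF D]
  obtain d where d: "d \<in> FC" "D = JC d" using JA_cases[OF DJ(1)] .
  obtain \<eta>' where \<eta>': "J.tv C j (0, 0, \<eta>) D = (0, 0, \<eta>')"
    using FD_trn_J(2)[OF C D, of \<eta>] by (auto simp: J.tv_comp[OF C D])
  have "FD (snd e \<circ> fst \<circ> chart_inv D) (snd D j) (0, 0, \<eta>') = 0" if e: "e \<in> charts_at A (fst j)" for e
  proof -
    have eA: "e \<in> A" "fst j \<in> fst e" using e by (simp_all add: charts_at_def)
    have "base (snd D j) = snd d (fst j)" using JC_base[OF d(1)] DJ(2) by (simp add: d(2))
    then have bj: "base (snd D j) \<in> overlap d e" using eA DJ(2) by (simp add: d(2) fst_JC)
    note sm = smooth_on_trans[OF FC_M[OF d(1)] atlas_maximal[OF eA(1)]]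
    have "FD (snd e \<circ> fst \<circ> chart_inv D) (snd D j) = FD (\<lambda>z. trn d e (base z)) (snd D j)"
    proof (rule FD_cong_open[OF J.open_ov[OF DJ(1) DJ(1)] J.in_overlap[OF D D]])
      fix z assume "z \<in> overlap D D"
      then have z: "base z \<in> snd d ` fst d" using JC_image_overlap[OF d(1) d(1)] by (simp add: d(2))
      show "(snd e \<circ> fst \<circ> chart_inv D) z = trn d e (base z)"
        using JC_inv[OF d(1) z] line(2)[OF d(1) z] by (simp add: d(2) fst_jet1)
    qed
    also have "\<dots> = (\<lambda>u. FD (trn d e) (base (snd D j)) (base u))"
    proof (rule FD_eqI)
      have "(base has_derivative base) (at (snd D j))"
        by (intro has_derivative_Pair has_derivative_fst has_derivative_snd has_derivative_ident)
      from has_derivative_compose[OF this smooth_on_FDERIV[OF sm bj]]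
      show "((\<lambda>z. trn d e (base z)) has_derivative (\<lambda>u. FD (trn d e) (base (snd D j)) (base u))) (at (snd D j))" .
    qed
    finally show ?thesis
      using linear_0[OF linear_FD[OF sm bj]] by (simp flip: zero_prod_def)
  qed
  then show ?thesis
    using J.tv_in[OF C] by (auto simp: vertical_def tangent_map_def Let_def \<eta>' fun_eq_iff simp flip: D_def)
qed

lemma openin_jet_space: "openin (atlas_topology JA) (jets)"
  using J.open_ov JA_fst_sub
  by (auto simp: openin_atlas_topology[OF smooth_jet_atlas] atlas_open_def jet_atlas_points Int_absorb1)
     (metis Int_absorb)

lemma openin_chart_dom:
  assumes C: "C \<in> JA" shows "openin (atlas_topology JA) (fst C)"
  using J.open_ov[OF _ C] C
  by (auto simp: openin_atlas_topology[OF smooth_jet_atlas] atlas_open_def points_def Int_commute)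

text \<open>\<theta> and d_J \<omega> agree only on the kernel of dt, but there at all points. Hence
  \<open>d_along_cong\<close> permits the exchange under the outer derivative, in one fixed chart,
  and \<open>d_along_d_along_zero\<close> concludes.\<close>

theorem d_J_exact_imp_closed:
  assumes \<theta>: "k_form JA (Suc m) (jets) \<theta>" and \<omega>: "k_form JA m (jets) \<omega>"
    and ex: "d_J_primitive_mod_dt A \<pi> (Suc m) (jets) \<theta> \<omega>"
  shows "d_J_closed_mod_dt A \<pi> (Suc m) \<theta>"
proof -
  note op = openin_jet_space
  have eq: "\<theta> p ws = dJ \<omega> p ws"
    if p: "p \<in> jets" and D: "D \<in> charts_at JA p"
      and ws: "ws \<in> tangent_tuples JA (Suc m) p" "\<forall>v\<in>set ws. fst (v D) = 0" for p D ws
    using wedge_dt_form_eq_iff[where \<alpha> = \<theta> and \<beta> = "dJ \<omega>", OF p D alternating_k_form_some[OF \<theta> p p] alternating_d_J[OF op \<omega> p refl]] ex ws p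
    by (simp add: d_J_primitive_mod_dt_def form_eq_def)
  have "wedge_dt (dJ \<theta>) j vs = wedge_dt (\<lambda>_ _. 0) j vs"
    if j: "j \<in> jets" and vs: "vs \<in> tangent_tuples JA (Suc (Suc (Suc m))) j" for j vs
  proof -
    obtain C where C: "C \<in> charts_at JA j" using J_some_chart[OF j] by blast
    note CJ = J.charts_atD[OF C]
    have S: "snd C ` (jets \<inter> fst C) = snd C ` fst C" using JA_fst_sub[OF CJ(1)] by (simp add: Int_absorb1)
    have oS: "open (snd C ` fst C)" using jet_open_image[OF op CJ(1)] by (simp only: S)
    have F: "local_form m (snd C ` fst C) (J.lrep C \<omega>)" using J.local_form_lrep[OF \<omega> CJ(1)] by (simp only: S)
    have "dJ \<theta> j ws = 0"
      if ws: "ws \<in> tangent_tuples JA (Suc (Suc m)) j" "\<forall>v\<in>set ws. fst (v C) = 0" for ws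
    proof -
      have lw: "length ws = Suc (Suc m)" using ws(1) by (simp add: tangent_tuples_def)
      have "dJ \<theta> j ws = d_along vert (J.lrep C \<theta>) (snd C j) (J.comps C ws)"
        by (rule d_J_chart[OF op \<theta> j C ws])
      also have "\<dots> = d_along vert (d_along vert (J.lrep C \<omega>)) (snd C j) (J.comps C ws)"
      proof (rule d_along_cong[OF oS])
        fix y i assume y: "y \<in> snd C ` fst C" and i: "i < length (J.comps C ws)"
        define us where "us = omit i (J.comps C ws)"
        have us: "length us = Suc m" "\<forall>u\<in>set us. fst u = 0"
          using i lw ws(2) set_omit[of i "J.comps C ws"] by (auto simp: us_def length_omit)
        obtain p where p: "p \<in> fst C" "y = snd C p" using y by auto
        have ch: "C \<in> charts_at JA p" using p CJ by (simp add: charts_at_def)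
        have pJ: "p \<in> jets" using p JA_fst_sub[OF CJ(1)] by blast
        have t: "map (J.tv C p) us \<in> tangent_tuples JA (Suc m) p" by (rule J.map_tv_tuple[OF ch us(1)])
        have k: "\<forall>v\<in>set (map (J.tv C p) us). fst (v C) = 0" using us(2) by (auto simp: J.tv_comp_self[OF ch])
        have "J.lrep C \<theta> y us = \<theta> p (map (J.tv C p) us)" unfolding p(2) by (rule J.lrep_at[OF ch])
        also have "\<dots> = dJ \<omega> p (map (J.tv C p) us)" by (rule eq[OF pJ ch t k])
        also have "\<dots> = d_along vert (J.lrep C \<omega>) y us"
          unfolding d_J_chart[OF op \<omega> pJ ch t k] J.comps_map_tv[OF ch] p(2) ..
        finally show "J.lrep C \<theta> y (omit i (J.comps C ws)) = d_along vert (J.lrep C \<omega>) y (omit i (J.comps C ws))"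
          by (simp only: us_def)
      qed (use CJ(2) in simp)
      also have "\<dots> = 0" by (rule d_along_d_along_zero[OF oS F]) (use CJ(2) lw in auto)
      finally show ?thesis .
    qed
    moreover have "alternating (Suc (Suc m)) (\<lambda>us. (\<lambda>_ _. 0) j (map (J.tv (some_chart JA j) j) us))" by (simp add: alternating_def)
    ultimately show ?thesis
      using wedge_dt_form_eq_iff[where \<alpha> = "dJ \<theta>" and \<beta> = "\<lambda>_ _. 0", OF j C alternating_d_J[OF op \<theta> j refl]] vs by auto
  qed
  then show ?thesis by (simp add: d_J_closed_mod_dt_def form_eq_def wedge_1form_def)
qed

text \<open>The neighbourhood is the full domain of an induced chart. The primitive is built from
  components in that chart, and \<open>d_J_chart\<close> verifies it whatever charts
  \<open>some_chart\<close> picks at the points of the domain.\<close>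

theorem d_J_closed_imp_locally_exact:
  assumes \<theta>: "k_form JA (Suc m) (jets) \<theta>" and sb: "semi_basic A \<pi> (Suc m) \<theta>"
    and cl: "d_J_closed_mod_dt A \<pi> (Suc m) \<theta>" and j: "j \<in> jets"
  shows "\<exists>U. openin (atlas_topology JA) U \<and> j \<in> U \<and>
    (\<exists>\<omega>. k_form JA m U \<omega> \<and> d_J_primitive_mod_dt A \<pi> (Suc m) U \<theta> \<omega>)"
proof -
  note op = openin_jet_space
  obtain c where c: "c \<in> FC" "j \<in> fst (JC c)" using jet_chart_exists[OF j] by blast
  define C where "C = JC c"
  have CJ: "C \<in> JA" using c by (simp add: C_def jet_atlas_def)
  define U where "U = fst C"
  define S where "S = snd C ` U"
  have U: "openin (atlas_topology JA) U" "j \<in> U" using openin_chart_dom[OF CJ] c by (simp_all add: U_def C_def)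
  have UJ: "U \<subseteq> jets" using JA_fst_sub[OF CJ] by (simp add: U_def)
  have ch: "C \<in> charts_at JA p" if "p \<in> U" for p using that CJ by (simp add: charts_at_def U_def)
  have oS: "open S" using jet_open_image[OF U(1) CJ] by (simp add: S_def U_def)
  have Sbase: "S = {z. base z \<in> snd c ` fst c}"
    using JC_image_overlap[OF c(1) c(1)] by (simp add: S_def U_def C_def)
  define F where "F = J.lrep C \<theta>"
  have F: "local_form (Suc m) S F"
    using J.local_form_lrep[OF \<theta> CJ] UJ by (simp add: F_def S_def U_def Int_absorb1)
  \<comment> \<open>Membership in S restricts only (t, x), so y0 = 0 serves as centre of every
    fibre.\<close>
  have star: "(t, x, 0 + s *\<^sub>R (y - 0)) \<in> S" if "(t, x, y) \<in> S" for t x y s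
    using that by (simp add: Sbase)
  have basic: "F z us = 0" if z: "z \<in> S" and us: "length us = Suc m" "i < Suc m" "us ! i \<in> range vert" for z us i
  proof -
    obtain p where p: "p \<in> U" "z = snd C p" using z by (auto simp: S_def)
    obtain w where "us ! i = (0, 0, w)" using us(3) by (auto simp: vert_def)
    then have "map (J.tv C p) us ! i \<in> vertical A \<pi> p"
      using vertical_tv[OF _ ch[OF p(1)]] p(1) UJ us by auto
    then show ?thesis
      using sb p(1) UJ us(2) J.map_tv_tuple[OF ch[OF p(1)] us(1)]
      unfolding F_def p(2) J.lrep_at[OF ch[OF p(1)]] semi_basic_def by blast
  qed
  have closed: "d_along vert F z us = 0" if z: "z \<in> S" and us: "length us = Suc (Suc m)" "\<forall>u\<in>set us. fst u = 0" for z us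
  proof -
    obtain p where p: "p \<in> U" "z = snd C p" using z by (auto simp: S_def)
    note chp = ch[OF p(1)]
    have pJ: "p \<in> jets" using p(1) UJ by blast
    have t: "map (J.tv C p) us \<in> tangent_tuples JA (Suc (Suc m)) p" by (rule J.map_tv_tuple[OF chp us(1)])
    have k: "\<forall>v\<in>set (map (J.tv C p) us). fst (v C) = 0" using us(2) by (auto simp: J.tv_comp_self[OF chp])
    have "alternating (Suc (Suc m)) (\<lambda>us. (\<lambda>_ _. 0) p (map (J.tv (some_chart JA p) p) us))" by (simp add: alternating_def)
    from wedge_dt_form_eq_iff[where \<alpha> = "dJ \<theta>" and \<beta> = "\<lambda>_ _. 0", OF pJ chp alternating_d_J[OF op \<theta> pJ refl] this]
    have "dJ \<theta> p (map (J.tv C p) us) = 0"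
      using cl pJ t k by (simp add: d_J_closed_mod_dt_def form_eq_def wedge_1form_def)
    then show ?thesis
      unfolding d_J_chart[OF op \<theta> pJ chp t k] J.comps_map_tv[OF chp] p(2) F_def .
  qed
  define W where "W = primitive F m 0"
  have W: "local_form m S W"
    unfolding W_def by (rule local_form_primitive[OF oS F star basic closed])
  have dW: "d_along vert W z vs = F z vs" if "z \<in> S" "length vs = Suc m" "\<forall>v\<in>set vs. fst v = 0" for z vs
    unfolding W_def by (rule d_along_primitive[OF oS F star basic closed that])
  define \<omega> where "\<omega> p vs = W (snd C p) (J.comps C vs)" for p vs
  have aU: "atlas_open JA U" using U(1) by (simp add: openin_atlas_topology[OF smooth_jet_atlas])
  have \<omega>: "k_form JA m U \<omega>" and lr: "\<And>z us. z \<in> S \<Longrightarrow> J.lrep C \<omega> z us = W z us"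
    using J.k_form_from_chart[OF CJ _ aU, of m W] W unfolding \<omega>_def[abs_def] by (simp_all add: S_def U_def)
  have "wedge_dt \<theta> p vs = wedge_dt (dJ \<omega>) p vs"
    if p: "p \<in> U" and vs: "vs \<in> tangent_tuples JA (Suc (Suc m)) p" for p vs
  proof -
    have pJ: "p \<in> jets" using p UJ by blast
    have zS: "snd C p \<in> S" using p by (simp add: S_def)
    have "\<theta> p ws = dJ \<omega> p ws"
      if ws: "ws \<in> tangent_tuples JA (Suc m) p" "\<forall>v\<in>set ws. fst (v C) = 0" for ws
    proof -
      have lw: "length (J.comps C ws) = Suc m" "\<forall>u\<in>set (J.comps C ws). fst u = 0"
        using ws by (auto simp: tangent_tuples_def)
      have "dJ \<omega> p ws = d_along vert (J.lrep C \<omega>) (snd C p) (J.comps C ws)"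
        by (rule d_J_chart[OF U(1) \<omega> p ch[OF p] ws])
      also have "\<dots> = d_along vert W (snd C p) (J.comps C ws)" by (rule d_along_cong[OF oS zS]) (rule lr)
      also have "\<dots> = F (snd C p) (J.comps C ws)" by (rule dW[OF zS lw])
      also have "\<dots> = \<theta> p ws"
        unfolding F_def J.lrep_at[OF ch[OF p]] J.tuple_comps(1)[OF ws(1) ch[OF p]] ..
      finally show ?thesis by simp
    qed
    then show ?thesis
      using wedge_dt_form_eq_iff[where \<alpha> = \<theta> and \<beta> = "dJ \<omega>", OF pJ ch[OF p] alternating_k_form_some[OF \<theta> pJ pJ] alternating_d_J[OF U(1) \<omega> p refl]] vs by blast
  qed
  then have "d_J_primitive_mod_dt A \<pi> (Suc m) U \<theta> \<omega>"
    by (simp add: d_J_primitive_mod_dt_def form_eq_def)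
  then show ?thesis using U \<omega> by blast
qed

end

theorem lemma2p4:
  fixes A :: "('p, real \<times> 'v::fin_dim_inner) chart set"
    and \<pi> :: "'p \<Rightarrow> real"
    and n k :: nat
    and \<theta> :: "('p jet, real \<times> 'v \<times> 'v) form"
  assumes "fibred_manifold A \<pi>"
    and "dim (UNIV :: (real \<times> 'v) set) = n + 1"
    and "k \<ge> 1"
    and "k_form (jet_atlas A \<pi>) k (jet_space A \<pi>) \<theta>"
  shows "((\<exists>\<omega>. k_form (jet_atlas A \<pi>) (k - 1) (jet_space A \<pi>) \<omega> \<and>
              d_J_primitive_mod_dt A \<pi> k (jet_space A \<pi>) \<theta> \<omega>)
           \<longrightarrow> d_J_closed_mod_dt A \<pi> k \<theta>)
         \<and>
         (semi_basic A \<pi> k \<theta> \<and> d_J_closed_mod_dt A \<pi> k \<theta> \<longrightarrow>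
         (\<forall>j\<in>jet_space A \<pi>. \<exists>U. openin (atlas_topology (jet_atlas A \<pi>)) U \<and> j \<in> U \<and>
            (\<exists>\<omega>. k_form (jet_atlas A \<pi>) (k - 1) U \<omega> \<and> d_J_primitive_mod_dt A \<pi> k U \<theta> \<omega>)))"
proof -
  interpret fibred A \<pi> using assms(1) by unfold_locales
  \<comment> \<open>The degree k - 1 of the primitive becomes m, the exponent of s in the homotopy
    operator.\<close>
  obtain m where k: "k = Suc m" using assms(3) by (cases k) auto
  note \<theta> = assms(4)[unfolded k]
  show ?thesis
    unfolding k diff_Suc_1 using d_J_exact_imp_closed[OF \<theta>] d_J_closed_imp_locally_exact[OF \<theta>] by blast
qed

end
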